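(* Let $\Omega\subset\mathbb{R}^N$ be an open, bounded and smooth subset, or $\Omega=\mathbb{R}^N$. Let $(\rho_\epsilon)_{\epsilon>0}\subset L^1(\mathbb{R}^N)$ be a family of non-negative radial functions such that, for every $\delta>0$, $$\lim_{\epsilon\to0}\int_{|h|<\delta}\rho_\epsilon(h)\,dh=1\quad\text{and}\quad\lim_{\epsilon\to0}\int_{|h|>\delta}\rho_\epsilon(h)\,dh=0.$$ Then, for every $u\in BV(\Omega)$, $$\lim_{\epsilon\to0}\int_\Omega\int_\Omega\frac{|u(x)-u(y)-\nabla u(x)\cdot(x-y)|}{|x-y|}\rho_\epsilon(x-y)\,dy\,dx=K_{1,N}\,|D^su|(\Omega).$$
   Context: $BV(\Omega)$ is the space of $u\in L^1(\Omega)$ whose distributional derivative $Du$ is a Radon measure with finite total variation $|Du|(\Omega)$. One decomposes $Du=\nabla u\,\mathcal{L}^N+D^su$, where $\nabla u$ is the Radon-Nikodym density of $Du$ with respect to Lebesgue measure $\mathcal{L}^N$ and $D^su$ is singular with respect to $\mathcal{L}^N$. The constant is $K_{1,N}=C_{1,N}/\mathcal{H}^{N-1}(\mathbb{S}^{N-1})$, where $\mathcal{H}^{N-1}$ is the $(N-1)$-dimensional Hausdorff measure and $C_{1,N}=\int_{\mathbb{S}^{N-1}}|e\cdot v|\,d\mathcal{H}^{N-1}(v)$ for any unit vector $e\in\mathbb{R}^N$; $C_{1,N}=2\omega_{N-1}$ with $\omega_{N-1}$ the volume of the unit ball of $\mathbb{R}^{N-1}$. *)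

theory Defs
  imports "HOL-Analysis.Analysis"
begin

section \<open>Smooth functions and smooth open sets\<close>

primrec Ck :: "nat \<Rightarrow> ('a::euclidean_space \<Rightarrow> real) \<Rightarrow> bool" where
  "Ck 0 f \<longleftrightarrow> continuous_on UNIV f"
| "Ck (Suc k) f \<longleftrightarrow> (\<forall>x. f differentiable at x) \<and>
     (\<forall>b\<in>Basis. Ck k (\<lambda>x. frechet_derivative f (at x) b))"

definition smooth :: "('a::euclidean_space \<Rightarrow> real) \<Rightarrow> bool" where
  "smooth f \<longleftrightarrow> (\<forall>k. Ck k f)"

text \<open>Near each boundary point, after a choice of the vertical direction \<open>e\<close>, the set is the
  region above the graph of a smooth function of the remaining \<open>N - 1\<close> coordinates.  Such a function
  is represented by a function \<open>\<gamma>\<close> on the whole space that is constant in direction \<open>e\<close>.\<close>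

definition smooth_boundary :: "'a::euclidean_space set \<Rightarrow> bool" where
  "smooth_boundary \<Omega> \<longleftrightarrow> (\<forall>x0\<in>frontier \<Omega>. \<exists>r>0. \<exists>e \<gamma>. norm e = 1 \<and> smooth \<gamma> \<and>
     (\<forall>y t. \<gamma> (y + t *\<^sub>R e) = \<gamma> y) \<and>
     \<Omega> \<inter> ball x0 r = {y \<in> ball x0 r. y \<bullet> e > \<gamma> y})"

definition test_function :: "'a::euclidean_space set \<Rightarrow> ('a \<Rightarrow> real) \<Rightarrow> bool" where
  "test_function \<Omega> \<phi> \<longleftrightarrow> smooth \<phi> \<and> compact (closure {x. \<phi> x \<noteq> 0}) \<and> closure {x. \<phi> x \<noteq> 0} \<subseteq> \<Omega>"


section \<open>Vector measures\<close>

text \<open>A finite \<open>\<real>\<^sup>N\<close>-valued measure on the Borel subsets of \<open>\<Omega>\<close>, as a countably additive set function.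
  Its values on other sets are irrelevant.  On an open subset of \<open>\<real>\<^sup>N\<close> finite Borel measures are
  automatically Radon measures.\<close>

definition vector_measure_on :: "'a::euclidean_space set \<Rightarrow> ('a set \<Rightarrow> 'a) \<Rightarrow> bool" where
  "vector_measure_on \<Omega> \<nu> \<longleftrightarrow> (\<forall>A::nat \<Rightarrow> 'a set.
     (\<forall>i. A i \<in> sets borel \<and> A i \<subseteq> \<Omega>) \<and> disjoint_family A \<longrightarrow>
     (\<lambda>i. \<nu> (A i)) sums \<nu> (\<Union>i. A i))"

text \<open>\<open>variation \<nu> B\<close> is \<open>|\<nu>|(B)\<close>.\<close>

definition variation :: "('a::euclidean_space set \<Rightarrow> 'a) \<Rightarrow> 'a set \<Rightarrow> ennreal" where
  "variation \<nu> B = (SUP A \<in> {A::nat \<Rightarrow> 'a set.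
     (\<forall>i. A i \<in> sets borel) \<and> disjoint_family A \<and> (\<Union>i. A i) = B}. \<Sum>i. ennreal (norm (\<nu> (A i))))"

text \<open>The integral of \<open>\<phi>\<close> with respect to a finite signed measure \<open>\<mu>\<close> on \<open>\<Omega>\<close>, through any
  representation of \<open>\<mu>\<close> as a difference of two finite positive measures (for instance its Jordan
  decomposition).  For bounded Borel \<open>\<phi>\<close> the value does not depend on the representation.\<close>

definition has_signed_integral ::
    "'a::euclidean_space set \<Rightarrow> ('a set \<Rightarrow> real) \<Rightarrow> ('a \<Rightarrow> real) \<Rightarrow> real \<Rightarrow> bool" where
  "has_signed_integral \<Omega> \<mu> \<phi> I \<longleftrightarrow> (\<exists>P Q. finite_measure P \<and> finite_measure Q \<and>
     sets P = sets (restrict_space borel \<Omega>) \<and> sets Q = sets (restrict_space borel \<Omega>) \<and>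
     (\<forall>A \<in> sets (restrict_space borel \<Omega>). \<mu> A = measure P A - measure Q A) \<and>
     integrable P \<phi> \<and> integrable Q \<phi> \<and> I = (LINT x|P. \<phi> x) - (LINT x|Q. \<phi> x))"


section \<open>Functions of bounded variation\<close>

definition is_distributional_derivative ::
    "'a::euclidean_space set \<Rightarrow> ('a \<Rightarrow> real) \<Rightarrow> ('a set \<Rightarrow> 'a) \<Rightarrow> bool" where
  "is_distributional_derivative \<Omega> u \<nu> \<longleftrightarrow> vector_measure_on \<Omega> \<nu> \<and>
     (\<forall>\<phi>. test_function \<Omega> \<phi> \<longrightarrow> (\<forall>b\<in>Basis. has_signed_integral \<Omega> (\<lambda>A. \<nu> A \<bullet> b) \<phi>
        (- (LINT x:\<Omega>|lebesgue. u x * frechet_derivative \<phi> (at x) b))))"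

definition BV :: "'a::euclidean_space set \<Rightarrow> ('a \<Rightarrow> real) set" where
  "BV \<Omega> = {u. set_integrable lebesgue \<Omega> u \<and>
     (\<exists>\<nu>. is_distributional_derivative \<Omega> u \<nu> \<and> variation \<nu> \<Omega> < \<infinity>)}"

text \<open>\<open>bv_deriv \<Omega> u\<close> is \<open>Du\<close>; it is determined uniquely on the Borel subsets of \<open>\<Omega>\<close>.\<close>

definition bv_deriv :: "'a::euclidean_space set \<Rightarrow> ('a \<Rightarrow> real) \<Rightarrow> 'a set \<Rightarrow> 'a" where
  "bv_deriv \<Omega> u = (SOME \<nu>. is_distributional_derivative \<Omega> u \<nu>)"

definition singular_on :: "'a::euclidean_space set \<Rightarrow> ('a set \<Rightarrow> 'a) \<Rightarrow> bool" where
  "singular_on \<Omega> \<nu> \<longleftrightarrow> (\<exists>Z \<in> null_sets lborel. Z \<subseteq> \<Omega> \<and> variation \<nu> (\<Omega> - Z) = 0)"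

text \<open>\<open>bv_grad \<Omega> u\<close> is the density \<open>\<nabla>u\<close> of the absolutely continuous part of \<open>Du\<close> in its Lebesgue
  decomposition (unique almost everywhere in \<open>\<Omega>\<close>), and \<open>bv_sing \<Omega> u\<close> is the remaining part
  \<open>D\<^sup>su\<close>.\<close>

definition bv_grad :: "'a::euclidean_space set \<Rightarrow> ('a \<Rightarrow> real) \<Rightarrow> 'a \<Rightarrow> 'a" where
  "bv_grad \<Omega> u = (SOME g. set_integrable lebesgue \<Omega> g \<and>
     singular_on \<Omega> (\<lambda>A. bv_deriv \<Omega> u A - (LINT x:A|lebesgue. g x)))"

definition bv_sing :: "'a::euclidean_space set \<Rightarrow> ('a \<Rightarrow> real) \<Rightarrow> 'a set \<Rightarrow> 'a" where
  "bv_sing \<Omega> u A = bv_deriv \<Omega> u A - (LINT x:A|lebesgue. bv_grad \<Omega> u x)"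


section \<open>Hausdorff measure and the constant \<open>K\<close>\<close>

text \<open>Empty covering sets are singled out because \<open>0 ^ 0 = 1\<close>: in dimension \<open>0\<close> a nonempty set has
  weight \<open>1\<close> and the empty set weight \<open>0\<close>.  Boundedness is required because \<^const>\<open>diameter\<close> is
  unspecified on unbounded sets.\<close>

definition hausdorff_premeasure :: "nat \<Rightarrow> real \<Rightarrow> 'a::metric_space set \<Rightarrow> ennreal" where
  "hausdorff_premeasure k \<delta> A = (INF C \<in> {C::nat \<Rightarrow> 'a set.
     A \<subseteq> (\<Union>i. C i) \<and> (\<forall>i. bounded (C i) \<and> diameter (C i) \<le> \<delta>)}.
     \<Sum>i. if C i = {} then 0 else ennreal (unit_ball_vol (real k) * (diameter (C i) / 2) ^ k))"

definition hausdorff_measure :: "nat \<Rightarrow> 'a::metric_space measure" where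
  "hausdorff_measure k =
     measure_of UNIV (sets borel) (\<lambda>A. SUP \<delta>\<in>{0<..}. hausdorff_premeasure k \<delta> A)"

text \<open>The constants \<open>C\<^sub>1\<^sub>,\<^sub>N\<close> and \<open>K\<^sub>1\<^sub>,\<^sub>N\<close> with \<open>N = DIM('a)\<close>.  Their values
  are the same for all unit vectors \<open>e\<close>.\<close>

definition C1 :: "'a::euclidean_space \<Rightarrow> real" where
  "C1 e = (LINT v:sphere 0 1|hausdorff_measure (DIM('a) - 1). \<bar>e \<bullet> v\<bar>)"

definition K1 :: "'a::euclidean_space \<Rightarrow> real" where
  "K1 e = C1 e / measure (hausdorff_measure (DIM('a) - 1)) (sphere (0::'a) 1)"

definition radial :: "('a::real_normed_vector \<Rightarrow> real) \<Rightarrow> bool" where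
  "radial \<rho> \<longleftrightarrow> (\<exists>f. \<forall>h. \<rho> h = f (norm h))"

end

theory Submission
  imports Defs "HOL-Computational_Algebra.Polynomial"
begin

text \<open>
  Write \<open>Du = \<nabla>u \<L>\<^sup>N + \<zeta> M\<close> with a finite measure \<open>M\<close>, so that \<open>\<zeta> M = D\<^sup>su\<close>.  For a vector \<open>h\<close> let
  \<open>R\<^sub>h(x) = u (x + h) - u x - \<nabla>u x \<bullet> h\<close>.  Substituting \<open>y = x + h\<close>, the double integral becomes the
  integral over \<open>h\<close> of \<open>\<rho>\<^sub>\<epsilon> h / |h|\<close> times the \<open>L\<^sup>1\<close> norm of \<open>R\<^sub>h\<close> over the points \<open>x\<close> such that \<open>x\<close> and
  \<open>x + h\<close> belong to \<open>\<Omega>\<close>.  The theorem follows from two facts.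

  The first fact is that this norm equals \<open>|D\<^sup>su \<bullet> h|(\<Omega>) = \<integral> |\<zeta> \<bullet> h| dM\<close> up to an error \<open>o(|h|)\<close> that is uniform
  in the direction of \<open>h\<close> (\<open>remainder_upper\<close>, \<open>remainder_lower\<close>).  Integrate \<open>R\<^sub>h\<close> against a test
  function \<open>\<phi>\<close>.  Since \<open>u (x + h) - u x\<close> is the integral of \<open>Du \<bullet> h\<close> along a segment, the result
  is the integral of a translate of \<open>\<phi>\<close> with respect to \<open>D\<^sup>su \<bullet> h\<close>, up to the error of translating
  \<open>\<nabla>u\<close>, and translation is continuous in \<open>L\<^sup>1\<close> (\<open>remainder_pairing\<close>).  Test functions with values in
  \<open>[-1, 1]\<close> compute \<open>L\<^sup>1\<close> norms, which gives the upper bound.  For the lower bound \<open>\<phi>\<close> approximates the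
  sign of \<open>\<zeta> \<bullet> h\<close>.  For the upper bound the segment from \<open>x\<close> to \<open>x + h\<close> has to stay in \<open>\<Omega>\<close>.  When \<open>x\<close>
  is closer to the boundary than \<open>|h|\<close>, a detour inside \<open>\<Omega>\<close> of length comparable to \<open>|h|\<close> replaces
  the segment.  It exists because the boundary is locally a Lipschitz graph, and it bounds the \<open>L\<^sup>1\<close> norm of
  \<open>u (x + h) - u x\<close> near the boundary by a multiple of \<open>|h| |Du|\<close> of a thin layer
  (\<open>boundary_difference_small\<close>).  The layer shrinks to the empty set, so this contribution is
  \<open>o(|h|)\<close>.

  The second fact is that \<open>\<integral> \<rho> h |w \<bullet> h| / |h| dh = K |w| \<integral> \<rho> h dh\<close> for a radial weight \<open>\<rho>\<close>
  (\<open>radial_direction_average\<close>).  The left side is the same for all unit vectors \<open>w\<close>, because Lebesgue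
  measure is invariant under reflections.  Averaging it over the sphere and exchanging the integrals gives
  the constant.  This rests on three properties of the Hausdorff measure: it is a measure on the Borel sets,
  it is invariant under isometries, and it is positive and finite on the sphere.

  Integrating the second identity over \<open>w = \<zeta> x\<close> with respect to \<open>M\<close> gives
  \<open>K \<integral> |\<zeta>| dM = K |D\<^sup>su|(\<Omega>)\<close> times the mass of \<open>\<rho>\<^sub>\<epsilon>\<close>, which tends to \<open>1\<close>.  The errors are controlled
  by the first fact for small \<open>h\<close>.  For \<open>h\<close> away from \<open>0\<close> all quotients are bounded and the mass
  of \<open>\<rho>\<^sub>\<epsilon>\<close> vanishes in the limit.
\<close>


section \<open>Test functions\<close>

lemma Ck_SucI:
  fixes f :: "'a::euclidean_space \<Rightarrow> real"
  assumes "\<And>x. (f has_derivative f' x) (at x)" "\<And>b. b \<in> Basis \<Longrightarrow> Ck k (\<lambda>x. f' x b)"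
  shows "Ck (Suc k) f"
proof -
  have "frechet_derivative f (at x) = f' x" for x
    using assms(1) frechet_derivative_at by metis
  then show ?thesis using assms by (auto simp: differentiable_def)
qed

lemma Ck_differentiable: "Ck (Suc k) f \<Longrightarrow> (f has_derivative frechet_derivative f (at x)) (at x)"
  by (simp add: frechet_derivative_works)

lemma Ck_continuous: "Ck k f \<Longrightarrow> continuous_on UNIV f"
  by (cases k) (auto intro: differentiable_imp_continuous_on simp: differentiable_on_def)

lemma Ck_SucD: "Ck (Suc k) f \<Longrightarrow> Ck k f"
proof (induction k arbitrary: f)
  case 0
  then show ?case using Ck_continuous[of "Suc 0" f] by simp
next
  case (Suc k)
  then show ?case by (metis Ck.simps(2))
qed

lemma Ck_const: "Ck k (\<lambda>x. c)"
proof (induction k arbitrary: c)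
  case (Suc k)
  show ?case by (rule Ck_SucI[where f' = "\<lambda>_ _. 0"]) (auto simp: Suc)
qed auto

lemma Ck_bounded_linear: "bounded_linear f \<Longrightarrow> Ck k f"
proof (cases k)
  case (Suc n)
  assume "bounded_linear f"
  then show ?thesis unfolding Suc
    by (intro Ck_SucI[where f' = "\<lambda>_. f"] bounded_linear_imp_has_derivative Ck_const)
qed (auto intro: linear_continuous_on)

lemma Ck_add: "Ck k f \<Longrightarrow> Ck k g \<Longrightarrow> Ck k (\<lambda>x. f x + g x)"
proof (induction k arbitrary: f g)
  case (Suc k)
  show ?case
    by (rule Ck_SucI, rule has_derivative_add[OF Ck_differentiable[OF Suc.prems(1)] Ck_differentiable[OF Suc.prems(2)]])
      (use Suc in auto)
qed (auto intro!: continuous_intros)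

lemma Ck_mult: "Ck k f \<Longrightarrow> Ck k g \<Longrightarrow> Ck k (\<lambda>x. f x * g x)"
proof (induction k arbitrary: f g)
  case (Suc k)
  have 1: "Ck k f" "Ck k g" using Suc.prems Ck_SucD by blast+
  show ?case
    by (rule Ck_SucI, rule has_derivative_mult[OF Ck_differentiable[OF Suc.prems(1)] Ck_differentiable[OF Suc.prems(2)]])
      (use Suc 1 in \<open>auto intro!: Ck_add\<close>)
qed (auto intro!: continuous_intros)

lemma Ck_sum: "(\<And>i. i \<in> I \<Longrightarrow> Ck k (f i)) \<Longrightarrow> Ck k (\<lambda>x. \<Sum>i\<in>I. f i x)"
  by (induction I rule: infinite_finite_induct) (auto intro: Ck_const Ck_add)

lemma Ck_real_polynomial_function: "real_polynomial_function p \<Longrightarrow> Ck k p"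
  by (induction p rule: real_polynomial_function.induct)
    (auto intro: Ck_const Ck_add Ck_mult Ck_bounded_linear)

lemma Ck_translate: "Ck k f \<Longrightarrow> Ck k (\<lambda>x. f (x + a))"
proof (induction k arbitrary: f)
  case 0
  then show ?case by (auto intro!: continuous_on_compose2[of UNIV f] continuous_intros)
next
  case (Suc k)
  have "((\<lambda>x. f (x + a)) has_derivative frechet_derivative f (at (x + a))) (at x)" for x
    by (rule has_derivative_compose[of "\<lambda>x. x + a" "\<lambda>h. h", OF _ Ck_differentiable[OF Suc.prems]])
      (auto intro!: derivative_eq_intros)
  then show ?case by (rule Ck_SucI) (use Suc in auto)
qed

text \<open>A polynomial in \<open>1 / t\<close> times \<open>exp (- 1 / t)\<close>, extended by \<open>0\<close> to \<open>t \<le> 0\<close>; the polynomial is a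
  parameter because derivatives stay in this family.\<close>

definition exp_flat :: "real poly \<Rightarrow> real \<Rightarrow> real" where
  "exp_flat p t = (if t > 0 then poly p (1 / t) * exp (- 1 / t) else 0)"

lemma poly_times_exp_tendsto_0: "((\<lambda>s. poly p s * exp (- s)) \<longlongrightarrow> (0::real)) at_top"
proof -
  have "((\<lambda>s. \<Sum>i\<le>degree p. coeff p i * (s ^ i / exp s)) \<longlongrightarrow> (\<Sum>i\<le>degree p. coeff p i * 0)) at_top"
    by (intro tendsto_sum tendsto_mult tendsto_const tendsto_power_div_exp_0)
  then show ?thesis
    by (simp add: poly_altdef exp_minus divide_inverse sum_distrib_right mult.assoc)
qed

lemma exp_flat_tendsto_0: "((\<lambda>t. exp_flat p t) \<longlongrightarrow> 0) (at 0)"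
proof -
  have "((\<lambda>t. poly p (inverse t) * exp (- inverse t)) \<longlongrightarrow> 0) (at_right 0)"
    by (rule filterlim_compose[OF poly_times_exp_tendsto_0 filterlim_inverse_at_top_right])
  then have r: "((\<lambda>t. exp_flat p t) \<longlongrightarrow> 0) (at_right 0)"
    by (rule Lim_transform_eventually)
       (auto simp: exp_flat_def eventually_at_filter divide_inverse)
  have "((\<lambda>t. exp_flat p t) \<longlongrightarrow> 0) (at_left 0)"
    by (rule Lim_transform_eventually[of "\<lambda>_. 0"])
       (auto simp: exp_flat_def eventually_at_filter)
  with r show ?thesis by (simp add: filterlim_split_at)
qed

text \<open>The functions \<open>P(1/t) exp(-1/t)\<close> are closed under differentiation, which makes all of them
  smooth at once.\<close>

lemma exp_flat_has_derivative:
  "(exp_flat p has_real_derivative exp_flat ([:0,0,1:] * (p - pderiv p)) t) (at t)"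
proof -
  consider "t > 0" | "t < 0" | "t = 0" by linarith
  then show ?thesis
  proof cases
    case 1
    have "((\<lambda>t. poly p (1 / t) * exp (- 1 / t)) has_real_derivative
        exp_flat ([:0,0,1:] * (p - pderiv p)) t) (at t)"
      using 1 by (auto intro!: derivative_eq_intros DERIV_chain2[OF poly_DERIV]
          simp: exp_flat_def field_simps power2_eq_square)
    then show ?thesis
      by (rule DERIV_cong_ev[THEN iffD1, rotated 3])
        (use 1 eventually_nhds_in_open[of "{0<..}" t] in \<open>auto simp: exp_flat_def elim!: eventually_mono\<close>)
  next
    case 2
    have "((\<lambda>t. 0) has_real_derivative exp_flat ([:0,0,1:] * (p - pderiv p)) t) (at t)"
      using 2 by (auto simp: exp_flat_def)
    then show ?thesis
      by (rule DERIV_cong_ev[THEN iffD1, rotated 3])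
        (use 2 eventually_nhds_in_open[of "{..<0}" t] in \<open>auto simp: exp_flat_def elim!: eventually_mono\<close>)
  next
    case 3
    have "((\<lambda>h. exp_flat (pCons 0 p) h) \<longlongrightarrow> 0) (at 0)" by (rule exp_flat_tendsto_0)
    then have "((\<lambda>h. (exp_flat p (0 + h) - exp_flat p 0) / h) \<longlongrightarrow> 0) (at 0)"
      by (rule Lim_transform_eventually) (auto simp: exp_flat_def eventually_at_filter)
    then show ?thesis using 3 by (simp add: DERIV_def exp_flat_def)
  qed
qed

lemma Ck_exp_flat:
  assumes "\<And>k. Ck k q"
  shows "Ck k (\<lambda>x. exp_flat p (q x))"
proof (induction k arbitrary: p)
  case 0
  have "continuous_on UNIV (exp_flat p)"
    by (rule continuous_at_imp_continuous_on) (intro ballI DERIV_isCont[OF exp_flat_has_derivative])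
  then show ?case
    using continuous_on_compose2[of UNIV "exp_flat p" UNIV q] Ck_continuous[OF assms] by auto
next
  case (Suc k)
  have q: "Ck (Suc k) q" by (rule assms)
  have "((\<lambda>x. exp_flat p (q x)) has_derivative
     (\<lambda>h. exp_flat ([:0,0,1:] * (p - pderiv p)) (q x) * frechet_derivative q (at x) h)) (at x)" for x
    by (rule has_derivative_compose[OF Ck_differentiable[OF q]
        exp_flat_has_derivative[unfolded has_field_derivative_def]])
  then show ?case by (rule Ck_SucI) (use Suc q in \<open>auto intro!: Ck_mult simp del: mult_pCons_left\<close>)
qed

definition bump :: "'a::euclidean_space \<Rightarrow> real \<Rightarrow> 'a \<Rightarrow> real" where
  "bump c r x = exp_flat 1 (r\<^sup>2 - (norm (x - c))\<^sup>2)"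

lemma Ck_bump: "Ck k (bump c r)"
proof -
  have 1: "Ck k (\<lambda>x. ((x - c) \<bullet> b)\<^sup>2)" for k and b :: 'a
  proof -
    have "Ck k (\<lambda>x. x \<bullet> b + - (c \<bullet> b))"
      by (intro Ck_add Ck_const Ck_bounded_linear bounded_linear_inner_left)
    from Ck_mult[OF this this] show ?thesis by (simp add: power2_eq_square inner_diff_left)
  qed
  have "Ck k (\<lambda>x. r\<^sup>2 + (-1) * (\<Sum>b\<in>Basis. ((x - c) \<bullet> b)\<^sup>2))" for k
    by (intro Ck_add Ck_mult Ck_const Ck_sum 1)
  moreover have "(norm y)\<^sup>2 = (\<Sum>b\<in>Basis. (y \<bullet> b)\<^sup>2)" for y :: 'a
    unfolding power2_norm_eq_inner by (subst euclidean_inner) (simp add: power2_eq_square)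
  ultimately have "Ck k (\<lambda>x. r\<^sup>2 - (norm (x - c))\<^sup>2)" for k
    by simp
  from Ck_exp_flat[OF this] show ?thesis unfolding bump_def[abs_def] .
qed

lemma bump_nonneg: "bump c r x \<ge> 0" and bump_le_1: "bump c r x \<le> 1"
  by (auto simp: bump_def exp_flat_def)

lemma bump_pos_iff: "r > 0 \<Longrightarrow> bump c r x > 0 \<longleftrightarrow> dist c x < r"
proof -
  assume "r > 0"
  then have "(norm (x - c))\<^sup>2 < r\<^sup>2 \<longleftrightarrow> norm (x - c) < r"
    using power2_less_imp_less[of "norm (x - c)" r] power_strict_mono[of "norm (x - c)" r 2] by auto
  then show ?thesis by (simp add: bump_def exp_flat_def dist_norm norm_minus_commute)
qed

lemma bump_eq_0_iff: "r > 0 \<Longrightarrow> bump c r x = 0 \<longleftrightarrow> dist c x \<ge> r"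
  using bump_pos_iff[of r c x] bump_nonneg[of c r x] by linarith

lemma test_functionI:
  assumes "\<And>k. Ck k \<phi>" "compact K" "K \<subseteq> \<Omega>" "\<And>x. x \<notin> K \<Longrightarrow> \<phi> x = 0"
  shows "test_function \<Omega> \<phi>"
proof -
  have "closure {x. \<phi> x \<noteq> 0} \<subseteq> K"
    using assms by (intro closure_minimal) (auto intro: compact_imp_closed)
  moreover from this have "compact (closure {x. \<phi> x \<noteq> 0})"
    using compact_Int_closed[OF assms(2), of "closure {x. \<phi> x \<noteq> 0}"] by (simp add: inf_absorb2)
  ultimately show ?thesis using assms unfolding test_function_def smooth_def by auto
qed

lemma test_function_support:
  assumes "test_function \<Omega> \<phi>"
  obtains K where "compact K" "K \<subseteq> \<Omega>" "\<And>x. x \<notin> K \<Longrightarrow> \<phi> x = 0"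
proof (rule that)
  show "compact (closure {x. \<phi> x \<noteq> 0})" "closure {x. \<phi> x \<noteq> 0} \<subseteq> \<Omega>"
    using assms unfolding test_function_def by auto
  show "\<phi> x = 0" if "x \<notin> closure {x. \<phi> x \<noteq> 0}" for x
    using that closure_subset[of "{x. \<phi> x \<noteq> 0}"] by auto
qed

lemma test_function_Ck: "test_function \<Omega> \<phi> \<Longrightarrow> Ck k \<phi>"
  by (auto simp: test_function_def smooth_def)

lemma test_function_translate:
  assumes "test_function A \<phi>" "\<And>x. x \<in> A \<Longrightarrow> x + a \<in> B"
  shows "test_function B (\<lambda>x. \<phi> (x - a))"
proof -
  obtain K where K: "compact K" "K \<subseteq> A" "\<And>x. x \<notin> K \<Longrightarrow> \<phi> x = 0"
    using test_function_support[OF assms(1)] by metis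
  show ?thesis
  proof (rule test_functionI[of _ "(\<lambda>x. a + x) ` K"])
    show "Ck k (\<lambda>x. \<phi> (x - a))" for k
      using Ck_translate[OF test_function_Ck[OF assms(1)], of k "-a"] by simp
    show "compact ((\<lambda>x. a + x) ` K)" by (rule compact_translation[OF K(1)])
    show "(\<lambda>x. a + x) ` K \<subseteq> B" using assms(2) K(2) by (auto simp: add.commute)
    fix x assume "x \<notin> (\<lambda>x. a + x) ` K"
    then have "x - a \<notin> K" by (auto simp: image_iff)
    then show "\<phi> (x - a) = 0" by (rule K(3))
  qed
qed

text \<open>Smooth approximation without mollifiers: a sum \<open>s\<close> of bump functions is positive on the support
  \<open>K\<close> of \<open>\<phi>\<close>, so \<open>\<phi> / s\<close> is continuous; a polynomial close to it on the support of \<open>s\<close>, multiplied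
  by \<open>s\<close>, is a test function close to \<open>\<phi>\<close>.\<close>

lemma test_function_uniform_approx:
  fixes \<phi> :: "'a::euclidean_space \<Rightarrow> real"
  assumes cont: "continuous_on UNIV \<phi>" and K: "compact K" "K \<subseteq> \<Omega>" "open \<Omega>"
    and supp: "\<And>x. x \<notin> K \<Longrightarrow> \<phi> x = 0" and bd: "\<And>x. \<bar>\<phi> x\<bar> \<le> 1" and "\<eta> > 0"
  shows "\<exists>\<psi>. test_function \<Omega> \<psi> \<and> (\<forall>x. \<bar>\<psi> x\<bar> \<le> 1) \<and> (\<forall>x. \<bar>\<psi> x - \<phi> x\<bar> \<le> \<eta>)"
proof -
  have "\<forall>x\<in>K. \<exists>r>0. cball x r \<subseteq> \<Omega>"
    using K open_contains_cball by blast
  then obtain r where r: "\<And>x. x \<in> K \<Longrightarrow> r x > 0 \<and> cball x (r x) \<subseteq> \<Omega>" by metis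
  obtain T where T: "T \<subseteq> K" "finite T" "K \<subseteq> (\<Union>c\<in>T. ball c (r c))"
  proof (rule compactE_image[OF K(1), of K "\<lambda>c. ball c (r c)"])
    show "K \<subseteq> (\<Union>c\<in>K. ball c (r c))" using r by force
  qed auto
  define s where "s x = (\<Sum>c\<in>T. bump c (r c) x)" for x
  define S where "S = (\<Union>c\<in>T. cball c (r c))"
  have S: "compact S" "S \<subseteq> \<Omega>" using T r unfolding S_def by auto
  have s0: "s x \<ge> 0" for x unfolding s_def by (intro sum_nonneg bump_nonneg)
  have s1: "s x \<le> card T" for x unfolding s_def using sum_bounded_above[of T "\<lambda>c. bump c (r c) x" 1] bump_le_1 by auto
  have sK: "s x > 0" if xK: "x \<in> K" for x
  proof -
    obtain c where c: "c \<in> T" "dist c x < r c" using subsetD[OF T(3) xK] by auto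
    then have "bump c (r c) x > 0" using bump_pos_iff r T by blast
    then show ?thesis unfolding s_def by (intro sum_pos2[OF T(2) c(1)]) (auto intro: bump_nonneg)
  qed
  have sS: "s x = 0" if "x \<notin> S" for x
    unfolding s_def
  proof (intro sum.neutral ballI)
    fix c assume "c \<in> T"
    then have "r c > 0" "dist c x \<ge> r c" using that r T(1) by (auto simp: S_def)
    then show "bump c (r c) x = 0" by (simp add: bump_eq_0_iff)
  qed
  have sCk: "Ck k s" for k unfolding s_def[abs_def] by (intro Ck_sum Ck_bump)
  have scont: "continuous_on A s" for A using Ck_continuous[OF sCk] continuous_on_subset by blast
  define f where "f x = \<phi> x / s x" for x
  have "continuous_on ({x. s x > 0} \<union> - K) f"
  proof (rule continuous_on_open_Un)
    show "open {x. 0 < s x}" by (intro open_Collect_less scont continuous_on_const)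
    show "open (- K)" using K compact_imp_closed by blast
    show "continuous_on {x. 0 < s x} f" unfolding f_def
      using continuous_on_subset[OF cont] by (auto intro!: continuous_intros scont)
    show "continuous_on (- K) f"
      by (rule continuous_on_eq[OF continuous_on_const[of _ 0]]) (auto simp: f_def supp)
  qed
  then have fcont: "continuous_on S f" using sK by (auto intro: continuous_on_subset)
  have fs: "f x * s x = \<phi> x" for x using supp sK[of x] by (cases "x \<in> K") (auto simp: f_def)
  define m where "m = real (card T)"
  define d where "d = \<eta> / (2 * (m + 1))"
  have m: "m \<ge> 0" by (simp add: m_def)
  have d: "d > 0" "d * m \<le> \<eta> / 2"
    using \<open>\<eta> > 0\<close> m by (auto simp: d_def field_simps)
  obtain p where p: "real_polynomial_function p" "\<And>x. x \<in> S \<Longrightarrow> \<bar>f x - p x\<bar> < d"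
    using Stone_Weierstrass_real_polynomial_function[OF S(1) fcont d(1)] by metis
  \<comment> \<open>This function is close to \<open>\<phi>\<close> but may slightly exceed \<open>1\<close> in absolute value; dividing by \<open>q\<close> below
    restores the bound.\<close>
  define \<psi>0 where "\<psi>0 x = p x * s x" for x
  have near: "\<bar>\<psi>0 x - \<phi> x\<bar> \<le> d * m" for x
  proof (cases "x \<in> S")
    case True
    have "\<bar>\<psi>0 x - \<phi> x\<bar> = \<bar>f x - p x\<bar> * s x"
      using s0[of x] unfolding \<psi>0_def fs[symmetric] by (simp add: abs_mult left_diff_distrib[symmetric] abs_minus_commute)
    also have "\<dots> \<le> d * m" using p(2)[OF True] s0[of x] s1[of x] by (intro mult_mono) (auto simp: m_def)
    finally show ?thesis .
  next
    case False
    then show ?thesis using sS fs[of x] d m by (auto simp: \<psi>0_def)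
  qed
  define q where "q = 1 + d * m"
  have q: "q \<ge> 1" using d m by (simp add: q_def)
  have b0: "\<bar>\<psi>0 x\<bar> \<le> q" for x using near[of x] bd[of x] unfolding q_def by linarith
  define \<psi> where "\<psi> x = \<psi>0 x * (1 / q)" for x
  have "test_function \<Omega> \<psi>"
    by (rule test_functionI[OF _ S]) (auto simp: \<psi>_def[abs_def] \<psi>0_def[abs_def] sS
        intro!: Ck_mult Ck_const Ck_real_polynomial_function[OF p(1)] sCk simp del: times_divide_eq_right)
  moreover have "\<bar>\<psi> x\<bar> \<le> 1" for x using b0[of x] q by (simp add: \<psi>_def)
  moreover have "\<bar>\<psi> x - \<phi> x\<bar> \<le> \<eta>" for x
  proof -
    have "\<bar>\<psi> x - \<psi>0 x\<bar> = \<bar>\<psi>0 x\<bar> * (1 - 1 / q)"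
    proof -
      have "\<psi> x - \<psi>0 x = - (\<psi>0 x * (1 - 1 / q))" by (simp add: \<psi>_def algebra_simps)
      then show ?thesis using q by (simp add: abs_mult)
    qed
    also have "\<dots> \<le> q * (1 - 1 / q)" using b0 q by (intro mult_right_mono) auto
    also have "\<dots> = d * m" using q by (simp add: q_def field_simps)
    finally show ?thesis using near[of x] d(2) by linarith
  qed
  ultimately show ?thesis by blast
qed

section \<open>Density of test functions in \<open>L\<^sup>1\<close>\<close>

text \<open>By induction over integrable functions.  For an indicator, regularity of \<open>m\<close> provides a compact set
  inside and an open set outside of nearly the same measure, and Urysohn's lemma a continuous function
  in between.\<close>

lemma finite_measure_continuous_compact_support_approx:
  fixes f :: "'a::euclidean_space \<Rightarrow> real"
  assumes fin: "finite_measure m" and sb: "sets m = sets borel" and op: "open \<Omega>"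
    and f: "integrable m f" and f0: "\<And>x. x \<notin> \<Omega> \<Longrightarrow> f x = 0" and "\<eta> > 0"
  shows "\<exists>\<phi> K. continuous_on UNIV \<phi> \<and> integrable m \<phi> \<and> compact K \<and> K \<subseteq> \<Omega> \<and> (\<forall>x. x \<notin> K \<longrightarrow> \<phi> x = 0)
    \<and> (LINT x|m. \<bar>f x - \<phi> x\<bar>) < \<eta>"
proof -
  interpret finite_measure m by fact
  define P where "P f \<longleftrightarrow> (\<forall>\<eta>>0. \<exists>\<phi> K. continuous_on UNIV \<phi> \<and> integrable m \<phi> \<and> compact K \<and> K \<subseteq> \<Omega> \<and>
     (\<forall>x. x \<notin> K \<longrightarrow> \<phi> x = 0) \<and> (LINT x|m. \<bar>indicator \<Omega> x * f x - \<phi> x\<bar>) < \<eta>)" for f :: "'a \<Rightarrow> real"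
  have \<Omega>m: "\<Omega> \<in> sets m" using op sb by auto
  have "P f" using f
  proof (induction rule: integrable_induct)
    case (base A c)
    show ?case unfolding P_def
    proof (intro allI impI)
      fix \<eta> :: real assume "\<eta> > 0"
      define \<epsilon> where "\<epsilon> = \<eta> / (2 * (\<bar>c\<bar> + 1))"
      have \<epsilon>: "\<epsilon> > 0" "\<bar>c\<bar> * (2 * \<epsilon>) < \<eta>" using \<open>\<eta> > 0\<close> by (auto simp: \<epsilon>_def field_simps)
      define B where "B = A \<inter> \<Omega>"
      have B: "B \<in> sets m" "B \<in> sets borel" using base \<Omega>m sb by (auto simp: B_def)
      have "\<exists>K\<in>{K. K \<subseteq> B \<and> compact K}. emeasure m B < emeasure m K + ennreal \<epsilon>"
      proof (rule SUP_approx_ennreal)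
        show "emeasure m B = (SUP K\<in>{K. K \<subseteq> B \<and> compact K}. emeasure m K)"
          by (rule inner_regular[OF sb _ B(2)]) simp
      qed (use \<epsilon> in auto)
      then obtain K where K: "K \<subseteq> B" "compact K" "emeasure m B < emeasure m K + ennreal \<epsilon>" by auto
      have "\<exists>U\<in>{U. B \<subseteq> U \<and> open U}. emeasure m U < emeasure m B + ennreal \<epsilon>"
      proof (rule INF_approx_ennreal)
        show "emeasure m B = (INF U\<in>{U. B \<subseteq> U \<and> open U}. emeasure m U)"
          by (rule outer_regular[OF sb _ B(2)]) simp
      qed (use \<epsilon> in auto)
      then obtain U where U: "B \<subseteq> U" "open U" "emeasure m U < emeasure m B + ennreal \<epsilon>" by auto
      have Km: "K \<in> sets m" and Um: "U \<in> sets m" using K U sb by (auto simp: compact_imp_closed)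
      have "measure m B < measure m K + \<epsilon>" "measure m U < measure m B + \<epsilon>"
        using K(3) U(3) \<epsilon>(1)
        by (auto simp: emeasure_eq_measure ennreal_plus[symmetric] ennreal_less_iff simp del: ennreal_plus)
      then have mUK: "measure m (U - K) < 2 * \<epsilon>"
        using K U by (subst finite_measure_Diff) (auto simp: Um Km)
      obtain r where r: "r > 0" "(\<Union>x\<in>K. cball x r) \<subseteq> U \<inter> \<Omega>"
        using compact_subset_open_imp_cball_epsilon_subset[OF K(2), of "U \<inter> \<Omega>"] K(1) U(1,2) op
        unfolding B_def by (metis Int_subset_iff open_Int order_trans)
      have Kr: "compact (\<Union>x\<in>K. cball x r)" by (rule compact_minkowski_sum_cball[OF K(2)])
      obtain \<phi> :: "'a \<Rightarrow> real" where \<phi>: "continuous_on UNIV \<phi>" "\<And>x. \<phi> x \<in> closed_segment 1 0"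
        "\<And>x. x \<in> K \<Longrightarrow> \<phi> x = 1" "\<And>x. x \<in> - (\<Union>x\<in>K. ball x r) \<Longrightarrow> \<phi> x = 0"
      proof (rule Urysohn_local[of UNIV K "- (\<Union>x\<in>K. ball x r)" "1::real" 0])
        show "closedin (top_of_set UNIV) K" using K compact_imp_closed by auto
        show "closedin (top_of_set UNIV) (- (\<Union>x\<in>K. ball x r))" by auto
        show "K \<inter> - (\<Union>x\<in>K. ball x r) = {}" using r(1) centre_in_ball by blast
      qed auto
      have \<phi>01: "0 \<le> \<phi> x" "\<phi> x \<le> 1" for x using \<phi>(2)[of x] by (auto simp: closed_segment_eq_real_ivl)
      have \<phi>m: "\<phi> \<in> borel_measurable m" using borel_measurable_continuous_onI[OF \<phi>(1)] sb by (simp cong: measurable_cong_sets)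
      have int: "integrable m \<phi>" by (rule integrable_const_bound[of _ 1]) (use \<phi>01 \<phi>m in auto)
      have supp: "\<phi> x = 0" if "x \<notin> (\<Union>x\<in>K. cball x r)" for x using that by (intro \<phi>(4)) force
      have "(LINT x|m. \<bar>indicator \<Omega> x * (indicator A x *\<^sub>R c) - c * \<phi> x\<bar>) \<le> (LINT x|m. \<bar>c\<bar> * indicator (U - K) x)"
      proof (rule integral_mono)
        show "integrable m (\<lambda>x. \<bar>indicator \<Omega> x * (indicator A x *\<^sub>R c) - c * \<phi> x\<bar>)"
          using base int by (intro integrable_abs Bochner_Integration.integrable_diff integrable_mult_indicator[where 'b=real, simplified] \<Omega>m)
             (auto intro!: integrable_real_indicator)
        show "integrable m (\<lambda>x. \<bar>c\<bar> * indicator (U - K) x)"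
          using Um Km by (auto intro!: integrable_real_indicator simp: emeasure_eq_measure)
        fix x
        have "\<bar>indicator \<Omega> x * (indicator A x *\<^sub>R c) - c * \<phi> x\<bar> = \<bar>c\<bar> * \<bar>indicator B x - \<phi> x\<bar>"
        proof -
          have "indicator \<Omega> x * (indicator A x *\<^sub>R c) - c * \<phi> x = c * (indicator B x - \<phi> x)"
            by (auto simp: B_def indicator_def algebra_simps)
          then show ?thesis by (simp only: abs_mult)
        qed
        also have "\<bar>indicator B x - \<phi> x\<bar> \<le> indicator (U - K) x"
        proof (cases "x \<in> U")
          case True
          then show ?thesis using \<phi>01[of x] \<phi>(3)[of x] K(1) by (auto simp: indicator_def)
        next
          case False
          then have "x \<notin> (\<Union>x\<in>K. cball x r)" "x \<notin> B" using r(2) U(1) by blast+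
          then show ?thesis using supp[of x] by simp
        qed
        finally show "\<bar>indicator \<Omega> x * (indicator A x *\<^sub>R c) - c * \<phi> x\<bar> \<le> \<bar>c\<bar> * indicator (U - K) x"
          by (simp add: mult_left_mono)
      qed
      also have "\<dots> = \<bar>c\<bar> * measure m (U - K)" using Um Km by simp
      also have "\<dots> \<le> \<bar>c\<bar> * (2 * \<epsilon>)" using mUK by (intro mult_left_mono) auto
      also have "\<dots> < \<eta>" by fact
      finally have "(LINT x|m. \<bar>indicator \<Omega> x * (indicator A x *\<^sub>R c) - c * \<phi> x\<bar>) < \<eta>" .
      then show "\<exists>\<phi> K. continuous_on UNIV \<phi> \<and> integrable m \<phi> \<and> compact K \<and> K \<subseteq> \<Omega> \<and>
           (\<forall>x. x \<notin> K \<longrightarrow> \<phi> x = 0) \<and> (LINT x|m. \<bar>indicator \<Omega> x * (indicator A x *\<^sub>R c) - \<phi> x\<bar>) < \<eta>"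
        using r Kr int supp by (intro exI[of _ "\<lambda>x. c * \<phi> x"] exI[of _ "\<Union>x\<in>K. cball x r"])
          (auto intro!: continuous_intros \<phi>(1))
    qed
  next
    case (add f g)
    show ?case unfolding P_def
    proof (intro allI impI)
      fix \<eta> :: real assume "\<eta> > 0"
      then have "\<eta> / 2 > 0" by simp
      obtain \<phi> K where 1: "continuous_on UNIV \<phi>" "integrable m \<phi>" "compact K" "K \<subseteq> \<Omega>"
        "\<And>x. x \<notin> K \<Longrightarrow> \<phi> x = 0" "(LINT x|m. \<bar>indicator \<Omega> x * f x - \<phi> x\<bar>) < \<eta> / 2"
        using add.IH(1) \<open>\<eta> / 2 > 0\<close> unfolding P_def by metis
      obtain \<psi> L where 2: "continuous_on UNIV \<psi>" "integrable m \<psi>" "compact L" "L \<subseteq> \<Omega>"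
        "\<And>x. x \<notin> L \<Longrightarrow> \<psi> x = 0" "(LINT x|m. \<bar>indicator \<Omega> x * g x - \<psi> x\<bar>) < \<eta> / 2"
        using add.IH(2) \<open>\<eta> / 2 > 0\<close> unfolding P_def by metis
      have i: "integrable m (\<lambda>x. indicator \<Omega> x * f x)" "integrable m (\<lambda>x. indicator \<Omega> x * g x)"
        using integrable_mult_indicator[OF \<Omega>m add.hyps(1)] integrable_mult_indicator[OF \<Omega>m add.hyps(2)] by auto
      have "(LINT x|m. \<bar>indicator \<Omega> x * (f x + g x) - (\<phi> x + \<psi> x)\<bar>) \<le>
        (LINT x|m. \<bar>indicator \<Omega> x * f x - \<phi> x\<bar> + \<bar>indicator \<Omega> x * g x - \<psi> x\<bar>)"
        using i 1 2 by (intro integral_mono) (auto simp: distrib_left)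
      also have "\<dots> < \<eta>" using 1 2 i by (subst Bochner_Integration.integral_add) auto
      finally show "\<exists>\<phi> K. continuous_on UNIV \<phi> \<and> integrable m \<phi> \<and> compact K \<and> K \<subseteq> \<Omega> \<and>
           (\<forall>x. x \<notin> K \<longrightarrow> \<phi> x = 0) \<and> (LINT x|m. \<bar>indicator \<Omega> x * (f x + g x) - \<phi> x\<bar>) < \<eta>"
        using 1 2 by (intro exI[of _ "\<lambda>x. \<phi> x + \<psi> x"] exI[of _ "K \<union> L"])
          (auto intro!: continuous_intros)
    qed
  next
    case (lim f s)
    show ?case unfolding P_def
    proof (intro allI impI)
      fix \<eta> :: real assume "\<eta> > 0"
      then have "\<eta> / 2 > 0" by simp
      have "(\<lambda>i. LINT x|m. \<bar>f x - s i x\<bar>) \<longlonglongrightarrow> (LINT x|m. 0)"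
      proof (rule integral_dominated_convergence[where w = "\<lambda>x. 3 * \<bar>f x\<bar>"])
        show "AE x in m. (\<lambda>i. \<bar>f x - s i x\<bar>) \<longlonglongrightarrow> 0"
          using lim.hyps(2) by (intro AE_I2 tendsto_rabs_zero) (auto intro!: tendsto_eq_intros)
        show "AE x in m. norm \<bar>f x - s i x\<bar> \<le> 3 * \<bar>f x\<bar>" for i
        proof (rule AE_I2)
          fix x assume "x \<in> space m"
          from lim.hyps(3)[OF this, of i] show "norm \<bar>f x - s i x\<bar> \<le> 3 * \<bar>f x\<bar>" by simp
        qed
      qed (use lim in auto)
      then have "\<forall>\<^sub>F i in sequentially. (LINT x|m. \<bar>f x - s i x\<bar>) < \<eta> / 2"
        using \<open>\<eta> / 2 > 0\<close> by (intro order_tendstoD) auto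
      then obtain i where i: "(LINT x|m. \<bar>f x - s i x\<bar>) < \<eta> / 2"
        by (auto simp: eventually_sequentially)
      obtain \<phi> K where 1: "continuous_on UNIV \<phi>" "integrable m \<phi>" "compact K" "K \<subseteq> \<Omega>"
        "\<And>x. x \<notin> K \<Longrightarrow> \<phi> x = 0" "(LINT x|m. \<bar>indicator \<Omega> x * s i x - \<phi> x\<bar>) < \<eta> / 2"
        using lim.IH[of i] \<open>\<eta> / 2 > 0\<close> unfolding P_def by metis
      have ii: "integrable m (\<lambda>x. indicator \<Omega> x * f x)" "integrable m (\<lambda>x. indicator \<Omega> x * s i x)"
        using integrable_mult_indicator[OF \<Omega>m lim.hyps(4)] integrable_mult_indicator[OF \<Omega>m lim.hyps(1)] by auto
      have "(LINT x|m. \<bar>indicator \<Omega> x * f x - \<phi> x\<bar>) \<le>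
        (LINT x|m. \<bar>indicator \<Omega> x * s i x - \<phi> x\<bar> + \<bar>f x - s i x\<bar>)"
        using ii 1 lim by (intro integral_mono) (auto simp: indicator_def)
      also have "\<dots> < \<eta>" using 1 i ii lim by (subst Bochner_Integration.integral_add) auto
      finally show "\<exists>\<phi> K. continuous_on UNIV \<phi> \<and> integrable m \<phi> \<and> compact K \<and> K \<subseteq> \<Omega> \<and>
           (\<forall>x. x \<notin> K \<longrightarrow> \<phi> x = 0) \<and> (LINT x|m. \<bar>indicator \<Omega> x * f x - \<phi> x\<bar>) < \<eta>"
        using 1 by blast
    qed
  qed
  moreover have "indicator \<Omega> x * f x = f x" for x using f0 by (auto simp: indicator_def)
  ultimately show ?thesis using \<open>\<eta> > 0\<close> unfolding P_def by simp
qed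

lemma test_function_borel [measurable]: "test_function \<Omega> \<phi> \<Longrightarrow> \<phi> \<in> borel_measurable borel"
  using Ck_continuous[OF test_function_Ck] by (rule borel_measurable_continuous_onI)

text \<open>Truncation to \<open>[-1, 1]\<close> brings the continuous approximation closer to \<open>f\<close>, and afterwards it is replaced
  by a test function that is uniformly close to it.\<close>

lemma finite_measure_test_function_approx:
  fixes f :: "'a::euclidean_space \<Rightarrow> real"
  assumes fin: "finite_measure m" and sb: "sets m = sets borel" and op: "open \<Omega>"
    and f: "f \<in> borel_measurable borel" "\<And>x. \<bar>f x\<bar> \<le> 1" and f0: "\<And>x. x \<notin> \<Omega> \<Longrightarrow> f x = 0" and "\<eta> > 0"
  shows "\<exists>\<psi>. test_function \<Omega> \<psi> \<and> (\<forall>x. \<bar>\<psi> x\<bar> \<le> 1) \<and> (LINT x|m. \<bar>f x - \<psi> x\<bar>) < \<eta>"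
proof -
  interpret finite_measure m by fact
  have bm: "borel_measurable m = (borel_measurable borel :: ('a \<Rightarrow> real) set)"
    using sb by (intro measurable_cong_sets) auto
  have fi: "integrable m f" by (rule integrable_const_bound[of _ 1]) (use f bm in auto)
  have "\<eta> / 2 > 0" using \<open>\<eta> > 0\<close> by simp
  from finite_measure_continuous_compact_support_approx[OF fin sb op fi f0 this]
  obtain \<phi> K where \<phi>: "continuous_on UNIV \<phi>" "integrable m \<phi>" "compact K" "K \<subseteq> \<Omega>"
    "\<And>x. x \<notin> K \<Longrightarrow> \<phi> x = 0" "(LINT x|m. \<bar>f x - \<phi> x\<bar>) < \<eta> / 2" by metis
  define \<phi>' where "\<phi>' x = max (-1) (min 1 (\<phi> x))" for x
  define \<epsilon> where "\<epsilon> = \<eta> / (2 * (measure m (space m) + 1))"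
  have \<epsilon>: "\<epsilon> > 0" "\<epsilon> * measure m (space m) < \<eta> / 2"
    using \<open>\<eta> > 0\<close> by (auto simp: \<epsilon>_def field_simps add_pos_nonneg)
  have "\<exists>\<psi>. test_function \<Omega> \<psi> \<and> (\<forall>x. \<bar>\<psi> x\<bar> \<le> 1) \<and> (\<forall>x. \<bar>\<psi> x - \<phi>' x\<bar> \<le> \<epsilon>)"
    by (rule test_function_uniform_approx[OF _ \<phi>(3,4) op _ _ \<epsilon>(1)])
      (auto simp: \<phi>'_def[abs_def] \<phi>(5) intro!: continuous_intros \<phi>(1))
  then obtain \<psi> where \<psi>: "test_function \<Omega> \<psi>" "\<And>x. \<bar>\<psi> x\<bar> \<le> 1" "\<And>x. \<bar>\<psi> x - \<phi>' x\<bar> \<le> \<epsilon>" by auto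
  have \<psi>i: "integrable m \<psi>" by (rule integrable_const_bound[of _ 1]) (use \<psi> bm test_function_borel in auto)
  have "(LINT x|m. \<bar>f x - \<psi> x\<bar>) \<le> (LINT x|m. \<bar>f x - \<phi> x\<bar> + \<epsilon>)"
  proof (rule integral_mono)
    fix x
    have "\<bar>f x - \<phi>' x\<bar> \<le> \<bar>f x - \<phi> x\<bar>" using f(2)[of x] by (auto simp: \<phi>'_def)
    with \<psi>(3)[of x] show "\<bar>f x - \<psi> x\<bar> \<le> \<bar>f x - \<phi> x\<bar> + \<epsilon>" by linarith
  qed (use fi \<psi>i \<phi> in auto)
  also have "\<dots> < \<eta>" using fi \<phi> \<epsilon> by (subst Bochner_Integration.integral_add) (auto simp: mult.commute)
  finally show ?thesis using \<psi> by blast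
qed

text \<open>The \<open>L\<^sup>1\<close> norm over an open set is a supremum over test functions: approximate the sign of \<open>F\<close> in
  \<open>L\<^sup>1(|F| M)\<close>.\<close>

lemma L1_norm_test_function:
  fixes F :: "'a::euclidean_space \<Rightarrow> real"
  assumes sb: "sets M = sets borel" and F: "integrable M F" and op: "open A" and "\<eta> > 0"
  shows "\<exists>\<psi>. test_function A \<psi> \<and> (\<forall>x. \<bar>\<psi> x\<bar> \<le> 1) \<and> (LINT x|M. indicator A x * \<bar>F x\<bar>) \<le> (LINT x|M. \<psi> x * F x) + \<eta>"
proof -
  have Fm: "F \<in> borel_measurable M" using F by auto
  have bm: "borel_measurable M = (borel_measurable borel :: ('a \<Rightarrow> real) set)"
    using sb by (intro measurable_cong_sets) auto
  have Am: "A \<in> sets M" using op sb by auto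
  define m where "m = density M (\<lambda>x. ennreal \<bar>F x\<bar>)"
  have sm: "sets m = sets borel" using sb by (simp add: m_def)
  have fin: "finite_measure m"
  proof (rule finite_measureI)
    show "emeasure m (space m) \<noteq> \<infinity>"
      using F Fm by (simp add: m_def emeasure_density integrable_iff_bounded)
  qed
  define f where "f x = indicator A x * sgn (F x)" for x
  have fb: "f \<in> borel_measurable borel" using Fm Am unfolding f_def bm[symmetric] by measurable
  have "\<exists>\<psi>. test_function A \<psi> \<and> (\<forall>x. \<bar>\<psi> x\<bar> \<le> 1) \<and> (LINT x|m. \<bar>f x - \<psi> x\<bar>) < \<eta>"
    by (rule finite_measure_test_function_approx[OF fin sm op fb]) (auto simp: f_def indicator_def sgn_if \<open>\<eta> > 0\<close>)
  then obtain \<psi> where \<psi>: "test_function A \<psi>" "\<And>x. \<bar>\<psi> x\<bar> \<le> 1" "(LINT x|m. \<bar>f x - \<psi> x\<bar>) < \<eta>" by auto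
  have \<psi>m: "\<psi> \<in> borel_measurable M" using test_function_borel[OF \<psi>(1)] bm by auto
  have fm: "f \<in> borel_measurable M" using fb bm by auto
  have i1: "integrable M (\<lambda>x. \<psi> x * F x)"
    by (rule Bochner_Integration.integrable_bound[OF F]) (use \<psi>m Fm \<psi>(2) in \<open>auto simp: abs_mult mult_left_le_one_le\<close>)
  have i2: "integrable M (\<lambda>x. f x * F x)"
  proof (rule Bochner_Integration.integrable_bound[OF F])
    show "(\<lambda>x. f x * F x) \<in> borel_measurable M" using fm Fm by measurable
  qed (auto simp: f_def indicator_def sgn_if)
  have "(LINT x|m. \<bar>f x - \<psi> x\<bar>) = (LINT x|M. \<bar>F x\<bar> * \<bar>f x - \<psi> x\<bar>)"
    unfolding m_def using Fm fm \<psi>m by (subst integral_density) auto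
  moreover have "(LINT x|M. f x * F x) - (LINT x|M. \<psi> x * F x) \<le> (LINT x|M. \<bar>F x\<bar> * \<bar>f x - \<psi> x\<bar>)"
  proof -
    have "(LINT x|M. f x * F x) - (LINT x|M. \<psi> x * F x) = (LINT x|M. f x * F x - \<psi> x * F x)"
      using i1 i2 by simp
    also have "\<dots> \<le> (LINT x|M. \<bar>f x * F x - \<psi> x * F x\<bar>)"
      using i1 i2 by (intro integral_mono) auto
    also have "(\<lambda>x. \<bar>f x * F x - \<psi> x * F x\<bar>) = (\<lambda>x. \<bar>F x\<bar> * \<bar>f x - \<psi> x\<bar>)"
      by (simp add: left_diff_distrib[symmetric] abs_mult fun_eq_iff)
    finally show ?thesis .
  qed
  moreover have "(LINT x|M. f x * F x) = (LINT x|M. indicator A x * \<bar>F x\<bar>)"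
    by (intro Bochner_Integration.integral_cong) (auto simp: f_def indicator_def sgn_if)
  ultimately have "(LINT x|M. indicator A x * \<bar>F x\<bar>) \<le> (LINT x|M. \<psi> x * F x) + \<eta>"
    using \<psi>(3) by linarith
  then show ?thesis using \<psi> by blast
qed

lemma L1_norm_le_test_function:
  fixes F :: "'a::euclidean_space \<Rightarrow> real"
  assumes sb: "sets M = sets borel" and F: "integrable M F" and op: "open A"
    and bd: "\<And>\<psi>. test_function A \<psi> \<Longrightarrow> (\<And>x. \<bar>\<psi> x\<bar> \<le> 1) \<Longrightarrow> (LINT x|M. \<psi> x * F x) \<le> C"
  shows "(LINT x|M. indicator A x * \<bar>F x\<bar>) \<le> C"
proof (rule field_le_epsilon)
  fix \<eta> :: real assume "\<eta> > 0"
  from L1_norm_test_function[OF sb F op this] obtain \<psi> where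
    "test_function A \<psi>" "\<And>x. \<bar>\<psi> x\<bar> \<le> 1" "(LINT x|M. indicator A x * \<bar>F x\<bar>) \<le> (LINT x|M. \<psi> x * F x) + \<eta>"
    by auto
  with bd[of \<psi>] show "(LINT x|M. indicator A x * \<bar>F x\<bar>) \<le> C + \<eta>" by fastforce
qed

lemma lborel_integral_translate:
  fixes f :: "'a::euclidean_space \<Rightarrow> 'b::{banach, second_countable_topology}"
  assumes "f \<in> borel_measurable borel"
  shows "(LINT x|lborel. f (x + c)) = (LINT x|lborel. f x)"
    and "integrable lborel (\<lambda>x. f (x + c)) \<longleftrightarrow> integrable lborel f"
proof -
  have "(LINT x|lborel. f x) = (LINT x|distr lborel borel ((+) c). f x)" by (simp add: lborel_distr_plus)
  also have "\<dots> = (LINT x|lborel. f (c + x))" using assms by (subst integral_distr) auto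
  finally show "(LINT x|lborel. f (x + c)) = (LINT x|lborel. f x)" by (simp add: add.commute)
  have "integrable lborel f \<longleftrightarrow> integrable (distr lborel borel ((+) c)) f" by (simp add: lborel_distr_plus)
  also have "\<dots> \<longleftrightarrow> integrable lborel (\<lambda>x. f (c + x))" using assms by (subst integrable_distr_eq) auto
  finally show "integrable lborel (\<lambda>x. f (x + c)) \<longleftrightarrow> integrable lborel f" by (simp add: add.commute)
qed

text \<open>A continuous function with compact support is uniformly continuous, these functions are dense, and
  translation preserves the \<open>L\<^sup>1\<close> norm.\<close>

lemma L1_translation_continuous_real:
  fixes f :: "'a::euclidean_space \<Rightarrow> real"
  assumes f: "integrable lborel f" and "\<eta> > 0"
  shows "\<exists>\<delta>>0. \<forall>k. norm k < \<delta> \<longrightarrow> (LINT x|lborel. \<bar>f (x + k) - f x\<bar>) < \<eta>"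
proof -
  have fb: "f \<in> borel_measurable borel" using f by auto
  have "(\<lambda>n. (LINT x|lborel. \<bar>f x - indicator (ball 0 (real n)) x * f x\<bar>)) \<longlonglongrightarrow> (LINT x|(lborel::'a measure). 0)"
  proof (rule integral_dominated_convergence[where w = "\<lambda>x. \<bar>f x\<bar>"])
    show "AE x in lborel. (\<lambda>n. \<bar>f x - indicator (ball 0 (real n)) x * f x\<bar>) \<longlonglongrightarrow> 0"
    proof (rule AE_I2)
      fix x :: 'a
      have "\<forall>\<^sub>F n in sequentially. real n > norm x"
        using filterlim_real_sequentially eventually_gt_at_top filterlim_iff by blast
      then have "\<forall>\<^sub>F n in sequentially. \<bar>f x - indicator (ball 0 (real n)) x * f x\<bar> = 0"
        by (rule eventually_mono) (auto simp: indicator_def)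
      then show "(\<lambda>n. \<bar>f x - indicator (ball 0 (real n)) x * f x\<bar>) \<longlonglongrightarrow> 0" by (rule tendsto_eventually)
    qed
  qed (use f in \<open>auto simp: indicator_def\<close>)
  then have "\<forall>\<^sub>F n in sequentially. (LINT x|lborel. \<bar>f x - indicator (ball 0 (real n)) x * f x\<bar>) < \<eta> / 6"
    using \<open>\<eta> > 0\<close> by (intro order_tendstoD) auto
  then obtain n where n: "(LINT x|lborel. \<bar>f x - indicator (ball 0 (real n)) x * f x\<bar>) < \<eta> / 6"
    by (auto simp: eventually_sequentially)
  define B where "B = ball (0::'a) (real n)"
  define m where "m = density lborel (\<lambda>x. ennreal (indicator B x))"
  have Bb: "B \<in> sets borel" by (simp add: B_def)
  have fin: "finite_measure m"
  proof (rule finite_measureI)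
    have "emeasure m (space m) = (\<integral>\<^sup>+x. ennreal (indicator B x) * indicator (space m) x \<partial>lborel)"
      unfolding m_def by (rule emeasure_density) (simp_all add: Bb borel_measurable_indicator)
    also have "\<dots> = (\<integral>\<^sup>+x. indicator B x \<partial>lborel)"
      by (intro nn_integral_cong) (auto simp: m_def indicator_def)
    also have "\<dots> = emeasure lborel B" by (simp add: B_def)
    finally have "emeasure m (space m) = emeasure lborel B" .
    then show "emeasure m (space m) \<noteq> \<infinity>"
      using emeasure_lborel_ball_finite[of "0::'a" "real n"] by (simp add: B_def)
  qed
  have fBi: "integrable lborel (\<lambda>x. indicator B x * f x)"
    using integrable_mult_indicator[of B lborel f] f by (simp add: B_def)
  have mint: "integrable m h \<longleftrightarrow> integrable lborel (\<lambda>x. indicator B x * h x)"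
    "(LINT x|m. h x) = (LINT x|lborel. indicator B x * h x)" if "h \<in> borel_measurable borel" for h :: "'a \<Rightarrow> real"
    using that integrable_density[of h lborel "indicator B"] integral_density[of h lborel "indicator B"] Bb
    by (auto simp: m_def)
  have "\<exists>\<phi> K. continuous_on UNIV \<phi> \<and> integrable m \<phi> \<and> compact K \<and> K \<subseteq> B \<and> (\<forall>x. x \<notin> K \<longrightarrow> \<phi> x = 0)
    \<and> (LINT x|m. \<bar>indicator B x * f x - \<phi> x\<bar>) < \<eta> / 6"
  proof (rule finite_measure_continuous_compact_support_approx[OF fin])
    show "integrable m (\<lambda>x. indicator B x * f x)"
    proof (subst mint)
      have "(\<lambda>x. indicator B x * (indicator B x * f x)) = (\<lambda>x. indicator B x * f x)"
        by (auto simp: indicator_def)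
      then show "integrable lborel (\<lambda>x. indicator B x * (indicator B x * f x))" using fBi by simp
    qed (use fb Bb in measurable)
  qed (use \<open>\<eta> > 0\<close> in \<open>auto simp: m_def B_def\<close>)
  then obtain \<phi> K where \<phi>: "continuous_on UNIV \<phi>" "integrable m \<phi>" "compact K" "K \<subseteq> B"
    "\<And>x. x \<notin> K \<Longrightarrow> \<phi> x = 0" "(LINT x|m. \<bar>indicator B x * f x - \<phi> x\<bar>) < \<eta> / 6" by auto
  have \<phi>b: "\<phi> \<in> borel_measurable borel" using \<phi>(1) by (rule borel_measurable_continuous_onI)
  have \<phi>B: "indicator B x * \<phi> x = \<phi> x" for x using \<phi>(4,5) by (auto simp: indicator_def)
  have \<phi>i: "integrable lborel \<phi>" using mint(1)[OF \<phi>b] \<phi>(2) by (simp add: \<phi>B)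
  have "(LINT x|m. \<bar>indicator B x * f x - \<phi> x\<bar>) = (LINT x|lborel. indicator B x * \<bar>indicator B x * f x - \<phi> x\<bar>)"
    by (rule mint(2)) (use fb Bb \<phi>b in measurable)
  also have "\<dots> = (LINT x|lborel. \<bar>indicator B x * f x - \<phi> x\<bar>)"
    using \<phi>B by (intro Bochner_Integration.integral_cong refl) (metis indicator_eq_0_iff indicator_eq_1_iff mult_cancel_right1 mult_zero_left abs_zero diff_self mult_cancel_left1)
  finally have near1: "(LINT x|lborel. \<bar>indicator B x * f x - \<phi> x\<bar>) < \<eta> / 6" using \<phi>(6) by simp
  have near: "(LINT x|lborel. \<bar>f x - \<phi> x\<bar>) < \<eta> / 3"
  proof -
    have "(LINT x|lborel. \<bar>f x - \<phi> x\<bar>) \<le> (LINT x|lborel. \<bar>f x - indicator B x * f x\<bar> + \<bar>indicator B x * f x - \<phi> x\<bar>)"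
      using f fBi \<phi>i by (intro integral_mono) auto
    also have "\<dots> < \<eta> / 3" using f fBi \<phi>i n near1 by (subst Bochner_Integration.integral_add) (auto simp: B_def)
    finally show ?thesis .
  qed
  define V where "V = measure lborel (cball (0::'a) (real n + 1))"
  define \<epsilon> where "\<epsilon> = \<eta> / (3 * (V + 1))"
  have V: "V \<ge> 0" by (simp add: V_def)
  have \<epsilon>: "\<epsilon> > 0" "\<epsilon> * V < \<eta> / 3" using \<open>\<eta> > 0\<close> V by (auto simp: \<epsilon>_def field_simps add_pos_nonneg)
  have "uniformly_continuous_on (cball 0 (real n + 2)) \<phi>"
    using \<phi>(1) by (intro compact_uniformly_continuous) (auto intro: continuous_on_subset)
  then obtain d where d: "d > 0" "\<And>x y. x \<in> cball 0 (real n + 2) \<Longrightarrow> y \<in> cball 0 (real n + 2) \<Longrightarrow> dist y x < d \<Longrightarrow> dist (\<phi> y) (\<phi> x) < \<epsilon>"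
    using \<epsilon>(1) unfolding uniformly_continuous_on_def by metis
  show ?thesis
  proof (intro exI[of _ "min d 1"] conjI allI impI)
    show "min d 1 > 0" using d by simp
    fix k :: 'a assume k: "norm k < min d 1"
    have pt: "\<bar>\<phi> (x + k) - \<phi> x\<bar> \<le> \<epsilon> * indicator (cball 0 (real n + 1)) x" for x
    proof (cases "x \<in> cball 0 (real n + 1)")
      case True
      then have "norm (x + k) \<le> real n + 2" using norm_triangle_ineq[of x k] k by auto
      then have "x \<in> cball 0 (real n + 2)" "x + k \<in> cball 0 (real n + 2)" "dist (x + k) x < d"
        using True k by (auto simp: mem_cball_0 dist_norm simp del: mem_cball)
      from d(2)[OF this] show ?thesis using True by (simp add: dist_real_def)
    next
      case False
      then have "norm x > real n + 1" by auto
      moreover have "norm x \<le> norm (x + k) + norm k" using norm_triangle_ineq4[of "x + k" k] by simp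
      ultimately have "x \<notin> B" "x + k \<notin> B" using k by (auto simp: B_def)
      then have "\<phi> x = 0" "\<phi> (x + k) = 0" using \<phi>(4,5) by blast+
      then show ?thesis using \<epsilon>(1) by simp
    qed
    have fk: "integrable lborel (\<lambda>x. f (x + k))" "integrable lborel (\<lambda>x. \<phi> (x + k))"
      using f \<phi>i by (auto simp: lborel_integral_translate fb \<phi>b)
    have "(LINT x|lborel. \<bar>\<phi> (x + k) - \<phi> x\<bar>) \<le> (LINT x|lborel. \<epsilon> * indicator (cball (0::'a) (real n + 1)) x)"
    proof (rule integral_mono)
      show "integrable lborel (\<lambda>x. \<epsilon> * indicat_real (cball (0::'a) (real n + 1)) x)"
        using emeasure_lborel_cball_finite[of "0::'a" "real n + 1"] by auto
    qed (use fk \<phi>i pt in auto)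
    also have "\<dots> = \<epsilon> * V" by (simp add: V_def)
    finally have 1: "(LINT x|lborel. \<bar>\<phi> (x + k) - \<phi> x\<bar>) < \<eta> / 3" using \<epsilon>(2) by simp
    have "(\<lambda>x. \<bar>f x - \<phi> x\<bar>) \<in> borel_measurable borel" using fb \<phi>b by measurable
    from lborel_integral_translate(1)[OF this, of k]
    have 2: "(LINT x|lborel. \<bar>f (x + k) - \<phi> (x + k)\<bar>) < \<eta> / 3" using near by simp
    have "(LINT x|lborel. \<bar>f (x + k) - f x\<bar>) \<le> (LINT x|lborel. \<bar>f (x + k) - \<phi> (x + k)\<bar> + (\<bar>\<phi> (x + k) - \<phi> x\<bar> + \<bar>f x - \<phi> x\<bar>))"
      using f fk \<phi>i by (intro integral_mono) auto
    also have "\<dots> = (LINT x|lborel. \<bar>f (x + k) - \<phi> (x + k)\<bar>) + ((LINT x|lborel. \<bar>\<phi> (x + k) - \<phi> x\<bar>) + (LINT x|lborel. \<bar>f x - \<phi> x\<bar>))"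
      using f fk \<phi>i by (subst Bochner_Integration.integral_add, simp, simp)+ simp
    finally show "(LINT x|lborel. \<bar>f (x + k) - f x\<bar>) < \<eta>" using 1 2 near by linarith
  qed
qed

lemma L1_translation_continuous:
  fixes g :: "'a::euclidean_space \<Rightarrow> 'b::euclidean_space"
  assumes g: "integrable lborel g" and "\<eta> > 0"
  shows "\<exists>\<delta>>0. \<forall>k. norm k < \<delta> \<longrightarrow> (LINT x|lborel. norm (g (x + k) - g x)) < \<eta>"
proof -
  define \<epsilon> where "\<epsilon> = \<eta> / DIM('b)"
  have \<epsilon>: "\<epsilon> > 0" using \<open>\<eta> > 0\<close> by (simp add: \<epsilon>_def)
  have gb: "integrable lborel (\<lambda>x. g x \<bullet> b)" for b using g by simp
  have "\<forall>b. \<exists>\<delta>>0. \<forall>k. norm k < \<delta> \<longrightarrow> (LINT x|lborel. \<bar>g (x + k) \<bullet> b - g x \<bullet> b\<bar>) < \<epsilon>"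
    using L1_translation_continuous_real[OF gb \<epsilon>] by blast
  then obtain d where d: "\<And>b. d b > 0" "\<And>b k. norm k < d b \<Longrightarrow> (LINT x|lborel. \<bar>g (x + k) \<bullet> b - g x \<bullet> b\<bar>) < \<epsilon>"
    by metis
  show ?thesis
  proof (intro exI[of _ "Min (d ` Basis)"] conjI allI impI)
    show "Min (d ` Basis) > 0" using d(1) by (subst Min_gr_iff) auto
    fix k :: 'a assume k: "norm k < Min (d ` Basis)"
    have gk: "integrable lborel (\<lambda>x. g (x + k))" using g by (subst lborel_integral_translate) auto
    have "(LINT x|lborel. norm (g (x + k) - g x)) \<le> (LINT x|lborel. (\<Sum>b\<in>Basis. \<bar>g (x + k) \<bullet> b - g x \<bullet> b\<bar>))"
    proof (rule integral_mono)
      show "norm (g (x + k) - g x) \<le> (\<Sum>b\<in>Basis. \<bar>g (x + k) \<bullet> b - g x \<bullet> b\<bar>)" for x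
        using norm_le_l1[of "g (x + k) - g x"] by (simp add: inner_diff_left)
    qed (use g gk in auto)
    also have "\<dots> = (\<Sum>b\<in>Basis. (LINT x|lborel. \<bar>g (x + k) \<bullet> b - g x \<bullet> b\<bar>))"
      using g gk by (intro Bochner_Integration.integral_sum) auto
    also have "\<dots> < (\<Sum>b\<in>(Basis::'b set). \<epsilon>)"
      using k by (intro sum_strict_mono d(2)) auto
    also have "\<dots> = \<eta>" by (simp add: \<epsilon>_def)
    finally show "(LINT x|lborel. norm (g (x + k) - g x)) < \<eta>" .
  qed
qed

section \<open>Difference quotients of functions of bounded variation\<close>

lemma test_function_sum:
  assumes "finite I" "\<And>i. i \<in> I \<Longrightarrow> test_function \<Omega> (\<phi> i)"
  shows "test_function \<Omega> (\<lambda>x. \<Sum>i\<in>I. c i * \<phi> i x)"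
proof -
  have "\<forall>i\<in>I. \<exists>K. compact K \<and> K \<subseteq> \<Omega> \<and> (\<forall>x. x \<notin> K \<longrightarrow> \<phi> i x = 0)"
    using test_function_support[OF assms(2)] by metis
  then obtain K where K: "\<And>i. i \<in> I \<Longrightarrow> compact (K i)" "\<And>i. i \<in> I \<Longrightarrow> K i \<subseteq> \<Omega>"
    "\<And>i x. i \<in> I \<Longrightarrow> x \<notin> K i \<Longrightarrow> \<phi> i x = 0" by metis
  show ?thesis
  proof (rule test_functionI[of _ "\<Union>i\<in>I. K i"])
    show "Ck k (\<lambda>x. \<Sum>i\<in>I. c i * \<phi> i x)" for k
      using assms(2) by (intro Ck_sum Ck_mult Ck_const test_function_Ck) auto
    show "(\<Sum>i\<in>I. c i * \<phi> i x) = 0" if "x \<notin> (\<Union>i\<in>I. K i)" for x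
      using that K(3) by (intro sum.neutral) auto
  qed (use K assms in auto)
qed

lemma test_function_has_derivative:
  "test_function \<Omega> \<phi> \<Longrightarrow> (\<phi> has_derivative frechet_derivative \<phi> (at x)) (at x)"
  using Ck_differentiable test_function_Ck by blast

lemma test_function_bounded_linear:
  "test_function \<Omega> \<phi> \<Longrightarrow> bounded_linear (frechet_derivative \<phi> (at x))"
  using test_function_has_derivative has_derivative_bounded_linear by blast

lemma bounded_linear_Basis_sum:
  fixes D :: "'a::euclidean_space \<Rightarrow> real"
  assumes "bounded_linear D"
  shows "D h = (\<Sum>b\<in>Basis. (h \<bullet> b) * D b)"
proof -
  interpret bounded_linear D by fact
  have "D h = D (\<Sum>b\<in>Basis. (h \<bullet> b) *\<^sub>R b)" by (simp add: euclidean_representation)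
  then show ?thesis by (simp add: sum scaleR)
qed

lemmas frechet_derivative_Basis_sum = bounded_linear_Basis_sum[OF test_function_bounded_linear]

lemma test_function_deriv:
  fixes \<phi> :: "'a::euclidean_space \<Rightarrow> real"
  assumes "test_function \<Omega> \<phi>"
  shows "test_function \<Omega> (\<lambda>x. frechet_derivative \<phi> (at x) h)"
proof -
  obtain K where K: "compact K" "K \<subseteq> \<Omega>" "\<And>x. x \<notin> K \<Longrightarrow> \<phi> x = 0"
    using test_function_support[OF assms] by metis
  have 0: "frechet_derivative \<phi> (at x) = (\<lambda>h. 0)" if "x \<notin> K" for x
  proof -
    have "((\<lambda>x. 0) has_derivative frechet_derivative \<phi> (at x)) (at x)"
      using K compact_imp_closed that
      by (intro has_derivative_transform_within_open[OF test_function_has_derivative[OF assms], of "-K"]) auto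
    then show ?thesis using has_derivative_unique has_derivative_const by blast
  qed
  have "test_function \<Omega> (\<lambda>x. frechet_derivative \<phi> (at x) b)" if "b \<in> Basis" for b
  proof (rule test_functionI[OF _ K(1,2)])
    show "Ck k (\<lambda>x. frechet_derivative \<phi> (at x) b)" for k
      using test_function_Ck[OF assms, of "Suc k"] that by simp
  qed (simp add: 0)
  then show ?thesis
    unfolding frechet_derivative_Basis_sum[OF assms, of _ h] by (intro test_function_sum) auto
qed

lemma test_function_bounded:
  assumes "test_function \<Omega> \<phi>"
  obtains B where "\<And>x. \<bar>\<phi> x\<bar> \<le> B"
proof -
  obtain K where K: "compact K" "K \<subseteq> \<Omega>" "\<And>x. x \<notin> K \<Longrightarrow> \<phi> x = 0"
    using test_function_support[OF assms] by metis
  have "compact (\<phi> ` K)"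
    using Ck_continuous[OF test_function_Ck[OF assms]] K(1) continuous_on_subset
    by (intro compact_continuous_image) auto
  then obtain B where "\<And>y. y \<in> \<phi> ` K \<Longrightarrow> \<bar>y\<bar> \<le> B"
    using compact_imp_bounded bounded_real by (metis (no_types))
  then have "\<bar>\<phi> x\<bar> \<le> max B 0" for x using K(3)[of x] by (cases "x \<in> K") fastforce+
  then show ?thesis by (rule that)
qed

lemma test_function_line_derivative:
  assumes "test_function \<Omega> \<phi>"
  shows "((\<lambda>s. \<phi> (x - s *\<^sub>R h)) has_real_derivative - frechet_derivative \<phi> (at (x - t *\<^sub>R h)) h) (at t)"
proof -
  interpret bounded_linear "frechet_derivative \<phi> (at (x - t *\<^sub>R h))"
    by (rule test_function_bounded_linear[OF assms])
  have "((\<lambda>s. \<phi> (x - s *\<^sub>R h)) has_derivative (\<lambda>k. frechet_derivative \<phi> (at (x - t *\<^sub>R h)) (- (k *\<^sub>R h)))) (at t)"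
    by (rule has_derivative_compose[OF _ test_function_has_derivative[OF assms]])
      (auto intro!: derivative_eq_intros)
  then show ?thesis unfolding has_field_derivative_def
    by (rule has_derivative_eq_rhs) (simp add: neg scaleR fun_eq_iff)
qed

lemma test_function_line_lipschitz:
  assumes "test_function \<Omega> \<phi>" "\<And>x. \<bar>frechet_derivative \<phi> (at x) h\<bar> \<le> B"
  shows "\<bar>\<phi> (x - s *\<^sub>R h) - \<phi> (x - t *\<^sub>R h)\<bar> \<le> B * \<bar>s - t\<bar>"
  using field_differentiable_bound[of UNIV "\<lambda>s. \<phi> (x - s *\<^sub>R h)"
      "\<lambda>t. - frechet_derivative \<phi> (at (x - t *\<^sub>R h)) h" B s t]
    test_function_line_derivative[OF assms(1)] assms(2) by simp

lemma test_function_uniformly_continuous: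
  fixes \<phi> :: "'a::euclidean_space \<Rightarrow> real"
  assumes "test_function \<Omega> \<phi>" "\<eta> > 0"
  obtains \<delta> where "\<delta> > 0" "\<And>x k. norm k < \<delta> \<Longrightarrow> \<bar>\<phi> (x - k) - \<phi> x\<bar> \<le> \<eta>"
proof -
  have "\<forall>b. \<exists>B. \<forall>x. \<bar>frechet_derivative \<phi> (at x) b\<bar> \<le> B"
    using test_function_bounded[OF test_function_deriv[OF assms(1)]] by metis
  then obtain B where B: "\<And>b x. \<bar>frechet_derivative \<phi> (at x) b\<bar> \<le> B b" by metis
  define C where "C = (\<Sum>b\<in>Basis. B b) + 1"
  have B0: "B b \<ge> 0" for b using B[of 0 b] by simp
  then have C: "C > 0" unfolding C_def by (intro add_nonneg_pos sum_nonneg) auto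
  have D: "\<bar>frechet_derivative \<phi> (at x) k\<bar> \<le> C * norm k" for x k
  proof -
    have "\<bar>frechet_derivative \<phi> (at x) k\<bar> \<le> (\<Sum>b\<in>Basis. \<bar>(k \<bullet> b) * frechet_derivative \<phi> (at x) b\<bar>)"
      unfolding frechet_derivative_Basis_sum[OF assms(1), of x k] by (rule sum_abs)
    also have "\<dots> \<le> (\<Sum>b\<in>Basis. norm k * B b)"
      by (intro sum_mono) (auto simp: abs_mult intro!: mult_mono B Basis_le_norm)
    also have "\<dots> = (C - 1) * norm k" by (simp add: C_def sum_distrib_left mult.commute)
    also have "\<dots> \<le> C * norm k" by (intro mult_right_mono) auto
    finally show ?thesis .
  qed
  show ?thesis
  proof (rule that[of "\<eta> / C"])
    show "\<eta> / C > 0" using C assms by simp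
    fix x k :: 'a assume "norm k < \<eta> / C"
    then have "C * norm k \<le> \<eta>" using C by (simp add: field_simps)
    then show "\<bar>\<phi> (x - k) - \<phi> x\<bar> \<le> \<eta>"
      using test_function_line_lipschitz[OF assms(1) D, of x 1 k 0] by simp
  qed
qed

lemma integrable_bounded_mult:
  fixes f :: "'b \<Rightarrow> real"
  assumes "integrable N f" "\<phi> \<in> borel_measurable N" "\<And>x. \<bar>\<phi> x\<bar> \<le> B"
  shows "integrable N (\<lambda>x. \<phi> x * f x)"
proof (rule Bochner_Integration.integrable_bound[of N "\<lambda>x. B * f x"])
  show "AE x in N. norm (\<phi> x * f x) \<le> norm (B * f x)"
  proof (rule AE_I2)
    fix x
    have "\<bar>\<phi> x\<bar> \<le> \<bar>B\<bar>" using assms(3)[of x] by linarith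
    then show "norm (\<phi> x * f x) \<le> norm (B * f x)" by (simp add: abs_mult mult_right_mono)
  qed
qed (use assms in auto)

text \<open>A function \<open>U\<close> with distributional derivative \<open>\<zeta> M + g \<L>\<close> on \<open>\<Omega>\<close>.  In the application \<open>g\<close> is \<open>\<nabla>u\<close> and
  \<open>\<zeta> M\<close> is \<open>D\<^sup>su\<close>.  All functions are Borel and vanish off \<open>\<Omega>\<close>, so that integrals over \<open>\<Omega>\<close> are integrals
  over the space.\<close>

locale split_distributional_derivative =
  fixes \<Omega> :: "'a::euclidean_space set" and U :: "'a \<Rightarrow> real" and g :: "'a \<Rightarrow> 'a"
    and M :: "'a measure" and \<zeta> :: "'a \<Rightarrow> 'a"
  assumes open_\<Omega>: "open \<Omega>"
    and integrable_U: "integrable lborel U"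
    and integrable_g: "integrable lborel g"
    and finite_M: "finite_measure M"
    and sets_M: "sets M = sets borel"
    and integrable_\<zeta>: "integrable M \<zeta>"
    and U_zero: "\<And>x. x \<notin> \<Omega> \<Longrightarrow> U x = 0"
    and g_zero: "\<And>x. x \<notin> \<Omega> \<Longrightarrow> g x = 0"
    and \<zeta>_zero: "\<And>x. x \<notin> \<Omega> \<Longrightarrow> \<zeta> x = 0"
    and integration_by_parts: "\<And>\<phi> b. test_function \<Omega> \<phi> \<Longrightarrow> b \<in> Basis \<Longrightarrow>
       (LINT x|M. \<phi> x * (\<zeta> x \<bullet> b)) + (LINT x|lborel. \<phi> x * (g x \<bullet> b)) =
       - (LINT x|lborel. U x * frechet_derivative \<phi> (at x) b)"
begin

lemma measurable_M: "borel_measurable M = borel_measurable borel"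
  using sets_M by (intro measurable_cong_sets) auto

lemma borel_U [measurable]: "U \<in> borel_measurable borel"
  using integrable_U by auto

lemma borel_g [measurable]: "g \<in> borel_measurable borel"
  using integrable_g by auto

lemma borel_\<zeta> [measurable]: "\<zeta> \<in> borel_measurable borel"
  using integrable_\<zeta> borel_measurable_integrable measurable_M by blast

lemma integrable_shift_U: "integrable lborel (\<lambda>x. U (x + h))"
  using integrable_U by (simp add: lborel_integral_translate)

lemma integrable_shift_g: "integrable lborel (\<lambda>x. g (x + h))"
  using integrable_g by (simp add: lborel_integral_translate)

lemma integrable_test_mult:
  assumes "test_function A \<phi>" "integrable N f" "sets N = sets borel"
  shows "integrable N (\<lambda>x. \<phi> x * (f x :: real))"
proof -
  obtain B where "\<And>x. \<bar>\<phi> x\<bar> \<le> B" using test_function_bounded[OF assms(1)] by metis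
  moreover have "\<phi> \<in> borel_measurable N"
    using test_function_borel[OF assms(1)] measurable_cong_sets[OF assms(3) refl] by blast
  ultimately show ?thesis using assms(2) by (intro integrable_bounded_mult)
qed

lemma integrable_\<zeta>_inner: "integrable M (\<lambda>x. \<zeta> x \<bullet> h)"
  using integrable_\<zeta> by simp

lemma integrable_g_inner: "integrable lborel (\<lambda>x. g x \<bullet> h)"
  using integrable_g by simp

text \<open>The integral of \<open>\<phi>\<close> with respect to the signed measure \<open>DU \<bullet> h\<close>.\<close>

definition deriv_pairing :: "('a \<Rightarrow> real) \<Rightarrow> 'a \<Rightarrow> real" where
  "deriv_pairing \<phi> h = (LINT x|M. \<phi> x * (\<zeta> x \<bullet> h)) + (LINT x|lborel. \<phi> x * (g x \<bullet> h))"

lemma directional_integration_by_parts: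
  assumes "test_function \<Omega> \<phi>"
  shows "(LINT x|lborel. U x * frechet_derivative \<phi> (at x) h) = - deriv_pairing \<phi> h"
proof -
  have i1: "integrable M (\<lambda>x. \<phi> x * (\<zeta> x \<bullet> b))" for b
    by (rule integrable_test_mult[OF assms integrable_\<zeta>_inner sets_M])
  have i2: "integrable lborel (\<lambda>x. \<phi> x * (g x \<bullet> b))" for b
    by (rule integrable_test_mult[OF assms integrable_g_inner]) simp
  have i3: "integrable lborel (\<lambda>x. U x * frechet_derivative \<phi> (at x) b)" for b
    using integrable_test_mult[OF test_function_deriv[OF assms] integrable_U] by (simp add: mult.commute)
  have hb: "y \<bullet> h = (\<Sum>b\<in>Basis. (h \<bullet> b) * (y \<bullet> b))" for y
    by (subst euclidean_inner) (simp add: mult.commute)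
  have e: "(\<Sum>b\<in>Basis. (h \<bullet> b) * (c * (y \<bullet> b))) = c * (y \<bullet> h)" for c y
    by (subst hb[of y]) (simp add: sum_distrib_left mult_ac)
  have "(LINT x|lborel. U x * frechet_derivative \<phi> (at x) h) =
    (LINT x|lborel. (\<Sum>b\<in>Basis. (h \<bullet> b) * (U x * frechet_derivative \<phi> (at x) b)))"
    by (subst frechet_derivative_Basis_sum[OF assms]) (simp add: sum_distrib_left mult_ac)
  also have "\<dots> = (\<Sum>b\<in>Basis. (h \<bullet> b) * (LINT x|lborel. U x * frechet_derivative \<phi> (at x) b))"
    using i3 by (subst Bochner_Integration.integral_sum) auto
  also have "\<dots> = (\<Sum>b\<in>Basis. - ((h \<bullet> b) * (LINT x|M. \<phi> x * (\<zeta> x \<bullet> b)) + (h \<bullet> b) * (LINT x|lborel. \<phi> x * (g x \<bullet> b))))"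
    by (intro sum.cong refl) (simp add: integration_by_parts[OF assms] flip: distrib_left)
  also have "\<dots> = - (\<Sum>b\<in>Basis. (h \<bullet> b) * (LINT x|M. \<phi> x * (\<zeta> x \<bullet> b))) - (\<Sum>b\<in>Basis. (h \<bullet> b) * (LINT x|lborel. \<phi> x * (g x \<bullet> b)))"
    by (simp add: sum_subtractf sum_negf)
  also have "(\<Sum>b\<in>Basis. (h \<bullet> b) * (LINT x|M. \<phi> x * (\<zeta> x \<bullet> b))) = (LINT x|M. (\<Sum>b\<in>Basis. (h \<bullet> b) * (\<phi> x * (\<zeta> x \<bullet> b))))"
    using i1 by (subst Bochner_Integration.integral_sum) auto
  also have "\<dots> = (LINT x|M. \<phi> x * (\<zeta> x \<bullet> h))"
    by (simp only: e)
  also have "(\<Sum>b\<in>Basis. (h \<bullet> b) * (LINT x|lborel. \<phi> x * (g x \<bullet> b))) = (LINT x|lborel. (\<Sum>b\<in>Basis. (h \<bullet> b) * (\<phi> x * (g x \<bullet> b))))"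
    using i2 by (subst Bochner_Integration.integral_sum) auto
  also have "\<dots> = (LINT x|lborel. \<phi> x * (g x \<bullet> h))"
    by (simp only: e)
  finally show ?thesis by (simp add: deriv_pairing_def)
qed

text \<open>Differentiation under the integral sign: along the line the difference quotients of \<open>\<phi>\<close> are bounded by a
  Lipschitz constant, so dominated convergence applies.\<close>

lemma pairing_line_derivative:
  assumes \<phi>: "test_function A \<phi>"
  shows "((\<lambda>s. LINT x|lborel. U x * \<phi> (x - s *\<^sub>R h)) has_real_derivative
     - (LINT x|lborel. U x * frechet_derivative \<phi> (at (x - t *\<^sub>R h)) h)) (at t)"
proof -
  define \<psi> where "\<psi> x = frechet_derivative \<phi> (at x) h" for x
  have \<psi>t: "test_function A \<psi>" unfolding \<psi>_def[abs_def] by (rule test_function_deriv[OF \<phi>])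
  obtain B where B: "\<And>x. \<bar>\<psi> x\<bar> \<le> B" using test_function_bounded[OF \<psi>t] by metis
  have [measurable]: "\<phi> \<in> borel_measurable borel" "\<psi> \<in> borel_measurable borel"
    using test_function_borel \<phi> \<psi>t by blast+
  have tr: "test_function UNIV (\<lambda>x. \<phi> (x - s *\<^sub>R h))" for s
    by (rule test_function_translate[OF \<phi>]) auto
  have i: "integrable lborel (\<lambda>x. U x * \<phi> (x - s *\<^sub>R h))" for s
    using integrable_test_mult[OF tr integrable_U] by (simp add: mult.commute)
  define Q where "Q k x = (\<phi> (x - (t + k) *\<^sub>R h) - \<phi> (x - t *\<^sub>R h)) / k" for k x
  have QB: "\<bar>Q k x\<bar> \<le> B" for k x
  proof (cases "k = 0")
    case True
    then show ?thesis using B[of x] by (simp add: Q_def)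
  next
    case False
    then show ?thesis
      using test_function_line_lipschitz[OF \<phi>, of h B x "t + k" t] B by (simp add: Q_def \<psi>_def field_simps)
  qed
  have "((\<lambda>k. LINT x|lborel. U x * Q k x) \<longlongrightarrow> (LINT x|lborel. U x * - \<psi> (x - t *\<^sub>R h))) (at 0)"
    unfolding tendsto_at_iff_sequentially
  proof (intro allI impI)
    fix X :: "nat \<Rightarrow> real" assume X: "\<forall>i. X i \<in> UNIV - {0}" "X \<longlonglongrightarrow> 0"
    have "(\<lambda>n. LINT x|lborel. U x * Q (X n) x) \<longlonglongrightarrow> (LINT x|lborel. U x * - \<psi> (x - t *\<^sub>R h))"
    proof (rule integral_dominated_convergence[where w = "\<lambda>x. B * \<bar>U x\<bar>"])
      show "integrable lborel (\<lambda>x. B * \<bar>U x\<bar>)" using integrable_U by simp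
      show "AE x in lborel. (\<lambda>n. U x * Q (X n) x) \<longlonglongrightarrow> U x * - \<psi> (x - t *\<^sub>R h)"
      proof (intro AE_I2 tendsto_mult tendsto_const)
        fix x
        have "((\<lambda>k. Q k x) \<longlongrightarrow> - \<psi> (x - t *\<^sub>R h)) (at 0)"
          using test_function_line_derivative[OF \<phi>, of x h t] unfolding Q_def DERIV_def \<psi>_def by simp
        then show "(\<lambda>n. Q (X n) x) \<longlonglongrightarrow> - \<psi> (x - t *\<^sub>R h)"
          using X unfolding tendsto_at_iff_sequentially by (auto simp: comp_def)
      qed
      show "AE x in lborel. norm (U x * Q (X n) x) \<le> B * \<bar>U x\<bar>" for n
      proof (rule AE_I2)
        fix x
        show "norm (U x * Q (X n) x) \<le> B * \<bar>U x\<bar>"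
          using mult_right_mono[OF QB[of "X n" x], of "\<bar>U x\<bar>"] by (simp add: abs_mult mult.commute)
      qed
    qed (simp_all add: Q_def)
    then show "((\<lambda>k. LINT x|lborel. U x * Q k x) \<circ> X) \<longlonglongrightarrow> (LINT x|lborel. U x * - \<psi> (x - t *\<^sub>R h))"
      by (simp add: comp_def)
  qed
  moreover have "(LINT x|lborel. U x * Q k x) =
      ((LINT x|lborel. U x * \<phi> (x - (t + k) *\<^sub>R h)) - (LINT x|lborel. U x * \<phi> (x - t *\<^sub>R h))) / k" for k
  proof -
    have "(LINT x|lborel. U x * Q k x) = (LINT x|lborel. (U x * \<phi> (x - (t + k) *\<^sub>R h) - U x * \<phi> (x - t *\<^sub>R h)) / k)"
      by (simp add: Q_def right_diff_distrib)
    then show ?thesis using i by simp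
  qed
  ultimately show ?thesis by (simp add: DERIV_def \<psi>_def)
qed

text \<open>The mean value theorem for \<open>t \<mapsto> \<integral> U \<phi>(\<cdot> - t h)\<close> replaces the representation of a difference
  of \<open>U\<close> as an average of \<open>DU\<close> along the segment.\<close>

lemma difference_eq_pairing:
  assumes \<phi>: "\<And>t. 0 \<le> t \<Longrightarrow> t \<le> 1 \<Longrightarrow> test_function \<Omega> (\<lambda>x. \<phi> (x - t *\<^sub>R h))"
  obtains \<theta> where "0 < \<theta>" "\<theta> < 1"
    "(LINT x|lborel. \<phi> x * (U (x + h) - U x)) = deriv_pairing (\<lambda>x. \<phi> (x - \<theta> *\<^sub>R h)) h"
proof -
  have \<phi>0: "test_function \<Omega> \<phi>" using \<phi>[of 0] by simp
  have [measurable]: "\<phi> \<in> borel_measurable borel" using test_function_borel \<phi>0 by blast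
  define J where "J s = (LINT x|lborel. U x * \<phi> (x - s *\<^sub>R h))" for s
  define J' where "J' t = - (LINT x|lborel. U x * frechet_derivative \<phi> (at (x - t *\<^sub>R h)) h)" for t
  have J: "(J has_real_derivative J' t) (at t)" for t
    unfolding J_def[abs_def] J'_def by (rule pairing_line_derivative[OF \<phi>0])
  have "\<exists>z>0. z < 1 \<and> J 1 - J 0 = (1 - 0) * J' z"
    by (rule MVT2) (use J in auto)
  then obtain \<theta> where \<theta>: "0 < \<theta>" "\<theta> < 1" "J 1 - J 0 = J' \<theta>" by auto
  have i: "integrable lborel (\<lambda>x. \<phi> x * U x)" "integrable lborel (\<lambda>x. \<phi> x * U (x + h))"
    by (rule integrable_test_mult[OF \<phi>0 integrable_U], simp)
      (rule integrable_test_mult[OF \<phi>0 integrable_shift_U], simp)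
  have "(LINT x|lborel. U (x + h) * \<phi> ((x + h) - h)) = (LINT x|lborel. U x * \<phi> (x - h))"
    by (rule lborel_integral_translate(1)[where f = "\<lambda>x. U x * \<phi> (x - h)"]) measurable
  then have "(LINT x|lborel. \<phi> x * (U (x + h) - U x)) = J 1 - J 0"
    using i by (simp add: J_def right_diff_distrib mult.commute)
  also have "\<dots> = J' \<theta>" by (rule \<theta>)
  also have "frechet_derivative \<phi> (at (x - \<theta> *\<^sub>R h)) = frechet_derivative (\<lambda>x. \<phi> (x - \<theta> *\<^sub>R h)) (at x)" for x
  proof (rule frechet_derivative_at)
    show "((\<lambda>x. \<phi> (x - \<theta> *\<^sub>R h)) has_derivative frechet_derivative \<phi> (at (x - \<theta> *\<^sub>R h))) (at x)"
      by (rule has_derivative_compose[of "\<lambda>x. x - \<theta> *\<^sub>R h" "\<lambda>h. h", OF _ test_function_has_derivative[OF \<phi>0]])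
        (auto intro!: derivative_eq_intros)
  qed
  then have "J' \<theta> = deriv_pairing (\<lambda>x. \<phi> (x - \<theta> *\<^sub>R h)) h"
    unfolding J'_def using directional_integration_by_parts[OF \<phi>[of \<theta>]] \<theta> by simp
  finally show ?thesis using \<theta> that by blast
qed

text \<open>An upper bound for \<open>|DU|(W)\<close>.\<close>

definition mass :: "'a set \<Rightarrow> real" where
  "mass W = (LINT x|M. indicator W x * norm (\<zeta> x)) + (LINT x|lborel. indicator W x * norm (g x))"

lemma integrable_indicator_norm:
  assumes "W \<in> sets borel"
  shows "integrable M (\<lambda>x. indicator W x * norm (\<zeta> x))" "integrable lborel (\<lambda>x. indicator W x * norm (g x))"
  using integrable_mult_indicator[of W M "\<lambda>x. norm (\<zeta> x)"] integrable_mult_indicator[of W lborel "\<lambda>x. norm (g x)"]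
    assms integrable_\<zeta> integrable_g sets_M by auto

text \<open>By duality with test functions on \<open>A\<close>: each translate \<open>\<psi> (\<cdot> - \<theta> h)\<close> is supported in \<open>W\<close> and is bounded
  by \<open>1\<close>.\<close>

lemma translation_difference_bound:
  assumes A: "open A" and W: "W \<in> sets borel" "W \<subseteq> \<Omega>"
    and seg: "\<And>x t. x \<in> A \<Longrightarrow> 0 \<le> t \<Longrightarrow> t \<le> 1 \<Longrightarrow> x + t *\<^sub>R h \<in> W"
  shows "(LINT x|lborel. indicator A x * \<bar>U (x + h) - U x\<bar>) \<le> norm h * mass W"
proof (rule L1_norm_le_test_function[OF _ _ A])
  show "integrable lborel (\<lambda>x. U (x + h) - U x)" using integrable_U integrable_shift_U by simp
  fix \<psi> assume \<psi>: "test_function A \<psi>" "\<And>x. \<bar>\<psi> x\<bar> \<le> 1"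
  have tr: "test_function \<Omega> (\<lambda>x. \<psi> (x - t *\<^sub>R h))" if "0 \<le> t" "t \<le> 1" for t
    using seg W that by (intro test_function_translate[OF \<psi>(1)]) blast
  obtain \<theta> where \<theta>: "0 < \<theta>" "\<theta> < 1"
    "(LINT x|lborel. \<psi> x * (U (x + h) - U x)) = deriv_pairing (\<lambda>x. \<psi> (x - \<theta> *\<^sub>R h)) h"
    using difference_eq_pairing[OF tr] by metis
  have tr\<theta>: "test_function \<Omega> (\<lambda>x. \<psi> (x - \<theta> *\<^sub>R h))" using tr \<theta> by simp
  obtain K where K: "K \<subseteq> A" "\<And>x. x \<notin> K \<Longrightarrow> \<psi> x = 0" using test_function_support[OF \<psi>(1)] by metis
  have pt: "\<psi> (x - \<theta> *\<^sub>R h) * (v \<bullet> h) \<le> norm h * (indicator W x * norm v)" for x v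
  proof (cases "x \<in> W")
    case True
    have "\<psi> (x - \<theta> *\<^sub>R h) * (v \<bullet> h) \<le> \<bar>\<psi> (x - \<theta> *\<^sub>R h)\<bar> * \<bar>v \<bullet> h\<bar>" by (simp flip: abs_mult)
    also have "\<dots> \<le> 1 * (norm v * norm h)" using \<psi>(2) Cauchy_Schwarz_ineq2 by (intro mult_mono) auto
    finally show ?thesis using True by (simp add: mult.commute)
  next
    case False
    then have "x - \<theta> *\<^sub>R h \<notin> A" using seg[of "x - \<theta> *\<^sub>R h" \<theta>] \<theta> by auto
    then have "\<psi> (x - \<theta> *\<^sub>R h) = 0" using K by blast
    then show ?thesis using False by simp
  qed
  have "deriv_pairing (\<lambda>x. \<psi> (x - \<theta> *\<^sub>R h)) h \<le>
     (LINT x|M. norm h * (indicator W x * norm (\<zeta> x))) + (LINT x|lborel. norm h * (indicator W x * norm (g x)))"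
    unfolding deriv_pairing_def
    using integrable_test_mult[OF tr\<theta> integrable_\<zeta>_inner sets_M] integrable_test_mult[OF tr\<theta> integrable_g_inner]
      integrable_indicator_norm[OF W(1)]
    by (intro add_mono integral_mono pt integrable_mult_right) auto
  then show "(LINT x|lborel. \<psi> x * (U (x + h) - U x)) \<le> norm h * mass W"
    unfolding \<theta>(3) mass_def by (simp add: distrib_left)
qed simp

abbreviation remainder :: "'a \<Rightarrow> 'a \<Rightarrow> real" where
  "remainder h x \<equiv> U (x + h) - U x - g x \<bullet> h"

lemma integrable_remainder: "integrable lborel (remainder h)"
  using integrable_U integrable_shift_U integrable_g_inner by simp

text \<open>Up to the \<open>L\<^sup>1\<close> modulus of continuity of \<open>g\<close>, testing the remainder sees only the part \<open>\<zeta> M\<close>.\<close>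

lemma remainder_pairing:
  assumes \<phi>: "\<And>t. 0 \<le> t \<Longrightarrow> t \<le> 1 \<Longrightarrow> test_function \<Omega> (\<lambda>x. \<phi> (x - t *\<^sub>R h))" and \<phi>1: "\<And>x. \<bar>\<phi> x\<bar> \<le> 1"
    and \<omega>: "\<And>k. norm k \<le> norm h \<Longrightarrow> (LINT x|lborel. norm (g (x + k) - g x)) \<le> \<omega>"
  obtains \<theta> where "0 < \<theta>" "\<theta> < 1"
    "\<bar>(LINT x|lborel. \<phi> x * remainder h x) - (LINT x|M. \<phi> (x - \<theta> *\<^sub>R h) * (\<zeta> x \<bullet> h))\<bar> \<le> norm h * \<omega>"
proof -
  have \<phi>0: "test_function \<Omega> \<phi>" using \<phi>[of 0] by simp
  have [measurable]: "\<phi> \<in> borel_measurable borel" using test_function_borel \<phi>0 by blast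
  obtain \<theta> where \<theta>: "0 < \<theta>" "\<theta> < 1"
    "(LINT x|lborel. \<phi> x * (U (x + h) - U x)) = deriv_pairing (\<lambda>x. \<phi> (x - \<theta> *\<^sub>R h)) h"
    using difference_eq_pairing[OF \<phi>] by metis
  let ?k = "\<theta> *\<^sub>R h"
  have k: "norm ?k \<le> norm h" using \<theta> by (simp add: mult_left_le_one_le)
  have i: "integrable lborel (\<lambda>x. \<phi> x * (U (x + h) - U x))" "integrable lborel (\<lambda>x. \<phi> x * (g x \<bullet> h))"
     "integrable lborel (\<lambda>x. \<phi> x * (g (x + ?k) \<bullet> h))"
    using integrable_U integrable_shift_U integrable_g_inner integrable_shift_g
    by (auto intro!: integrable_test_mult[OF \<phi>0])
  have "(LINT x|lborel. \<phi> ((x + ?k) - ?k) * (g (x + ?k) \<bullet> h)) = (LINT x|lborel. \<phi> (x - ?k) * (g x \<bullet> h))"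
    by (rule lborel_integral_translate(1)[where f = "\<lambda>x. \<phi> (x - ?k) * (g x \<bullet> h)"]) measurable
  then have "(LINT x|lborel. \<phi> x * remainder h x) - (LINT x|M. \<phi> (x - ?k) * (\<zeta> x \<bullet> h)) =
     (LINT x|lborel. \<phi> x * (g (x + ?k) \<bullet> h)) - (LINT x|lborel. \<phi> x * (g x \<bullet> h))"
    using i \<theta>(3) by (simp add: right_diff_distrib[of _ "_ - _" "_ \<bullet> _"] deriv_pairing_def)
  also have "\<dots> = (LINT x|lborel. \<phi> x * ((g (x + ?k) - g x) \<bullet> h))"
    using i by (simp add: inner_diff_left right_diff_distrib)
  finally have eq: "(LINT x|lborel. \<phi> x * remainder h x) - (LINT x|M. \<phi> (x - ?k) * (\<zeta> x \<bullet> h)) =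
     (LINT x|lborel. \<phi> x * ((g (x + ?k) - g x) \<bullet> h))" .
  have "\<bar>LINT x|lborel. \<phi> x * ((g (x + ?k) - g x) \<bullet> h)\<bar> \<le> (LINT x|lborel. norm h * norm (g (x + ?k) - g x))"
  proof (rule order_trans[OF integral_abs_bound integral_mono])
    show "integrable lborel (\<lambda>x. \<bar>\<phi> x * ((g (x + ?k) - g x) \<bullet> h)\<bar>)"
      using integrable_g integrable_shift_g by (intro integrable_abs integrable_test_mult[OF \<phi>0]) auto
    show "integrable lborel (\<lambda>x. norm h * norm (g (x + ?k) - g x))"
      using integrable_g integrable_shift_g by auto
    fix x
    have "\<bar>\<phi> x\<bar> * \<bar>(g (x + ?k) - g x) \<bullet> h\<bar> \<le> 1 * (norm (g (x + ?k) - g x) * norm h)"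
      using \<phi>1 Cauchy_Schwarz_ineq2 by (intro mult_mono) auto
    then show "\<bar>\<phi> x * ((g (x + ?k) - g x) \<bullet> h)\<bar> \<le> norm h * norm (g (x + ?k) - g x)"
      by (simp add: abs_mult mult.commute)
  qed
  also have "\<dots> \<le> norm h * \<omega>" using \<omega>[OF k] by (simp add: mult_left_mono)
  finally show ?thesis using that[OF \<theta>(1,2)] eq by simp
qed

lemma integrable_indicator_abs:
  fixes F :: "'a \<Rightarrow> real"
  assumes "integrable lborel F" "A \<in> sets borel"
  shows "integrable lborel (\<lambda>x. indicator A x * \<bar>F x\<bar>)"
  using integrable_mult_indicator[of A lborel "\<lambda>x. \<bar>F x\<bar>"] assms by simp

lemma interior_remainder_bound:
  assumes A: "open A" and seg: "\<And>x t. x \<in> A \<Longrightarrow> 0 \<le> t \<Longrightarrow> t \<le> 1 \<Longrightarrow> x + t *\<^sub>R h \<in> \<Omega>"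
    and \<omega>: "\<And>k. norm k \<le> norm h \<Longrightarrow> (LINT x|lborel. norm (g (x + k) - g x)) \<le> \<omega>"
  shows "(LINT x|lborel. indicator A x * \<bar>remainder h x\<bar>) \<le> (LINT x|M. \<bar>\<zeta> x \<bullet> h\<bar>) + norm h * \<omega>"
proof (rule L1_norm_le_test_function[OF _ integrable_remainder A])
  fix \<psi> assume \<psi>: "test_function A \<psi>" "\<And>x. \<bar>\<psi> x\<bar> \<le> 1"
  have tr: "test_function \<Omega> (\<lambda>x. \<psi> (x - t *\<^sub>R h))" if "0 \<le> t" "t \<le> 1" for t
    using seg that by (intro test_function_translate[OF \<psi>(1)]) blast
  obtain \<theta> where \<theta>: "0 < \<theta>" "\<theta> < 1"
    "\<bar>(LINT x|lborel. \<psi> x * remainder h x) - (LINT x|M. \<psi> (x - \<theta> *\<^sub>R h) * (\<zeta> x \<bullet> h))\<bar> \<le> norm h * \<omega>"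
    by (rule remainder_pairing[OF tr \<psi>(2) \<omega>])
  have tr\<theta>: "test_function \<Omega> (\<lambda>x. \<psi> (x - \<theta> *\<^sub>R h))" using tr \<theta> by simp
  have "(LINT x|M. \<psi> (x - \<theta> *\<^sub>R h) * (\<zeta> x \<bullet> h)) \<le> (LINT x|M. \<bar>\<zeta> x \<bullet> h\<bar>)"
  proof (rule integral_mono)
    show "\<psi> (x - \<theta> *\<^sub>R h) * (\<zeta> x \<bullet> h) \<le> \<bar>\<zeta> x \<bullet> h\<bar>" for x
      using mult_right_mono[OF \<psi>(2)[of "x - \<theta> *\<^sub>R h"], of "\<bar>\<zeta> x \<bullet> h\<bar>"] abs_ge_self[of "\<psi> (x - \<theta> *\<^sub>R h) * (\<zeta> x \<bullet> h)"]
      unfolding abs_mult by simp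
  qed (use integrable_test_mult[OF tr\<theta> integrable_\<zeta>_inner sets_M] integrable_\<zeta>_inner in auto)
  with \<theta>(3) show "(LINT x|lborel. \<psi> x * remainder h x) \<le> (LINT x|M. \<bar>\<zeta> x \<bullet> h\<bar>) + norm h * \<omega>"
    by linarith
qed simp

lemma g_modulus:
  assumes "\<eta> > 0"
  obtains \<delta> where "\<delta> > 0" "\<And>k. norm k < \<delta> \<Longrightarrow> (LINT x|lborel. norm (g (x + k) - g x)) \<le> \<eta>"
  using L1_translation_continuous[OF integrable_g assms] less_imp_le by metis

definition overlap :: "'a \<Rightarrow> 'a set" where
  "overlap h = {x \<in> \<Omega>. x + h \<in> \<Omega>}"

lemma open_overlap: "open (overlap h)"
proof -
  have "overlap h = \<Omega> \<inter> (\<lambda>x. x + h) -` \<Omega>" by (auto simp: overlap_def)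
  moreover have "open ((\<lambda>x. x + h) -` \<Omega>)"
    by (rule open_vimage[OF open_\<Omega>]) (intro continuous_intros)
  ultimately show ?thesis using open_\<Omega> by auto
qed

text \<open>Test the remainder against a function close to the sign of \<open>\<zeta> \<bullet> v\<close> in \<open>L\<^sup>1(|\<zeta>| M)\<close>.  A short translation
  of this function and a small deviation of \<open>h\<close> from the direction \<open>v\<close> change the result only slightly.\<close>

lemma remainder_lower_near_direction:
  assumes v: "norm v = 1" and "\<eta> > 0"
  obtains \<delta> where "\<delta> > 0" "\<And>h. h \<noteq> 0 \<Longrightarrow> norm h < \<delta> \<Longrightarrow> norm (h /\<^sub>R norm h - v) < \<delta> \<Longrightarrow>
    (LINT x|lborel. indicator (overlap h) x * \<bar>remainder h x\<bar>) \<ge> (LINT x|M. \<bar>\<zeta> x \<bullet> h\<bar>) - \<eta> * norm h"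
proof -
  define Z where "Z = (LINT x|M. norm (\<zeta> x))"
  have Z: "Z \<ge> 0" unfolding Z_def by simp
  \<comment> \<open>The total error consists of three terms \<open>\<epsilon> Z\<close>, from the translation of \<open>\<phi>\<close> and from replacing \<open>v\<close> twice,
    and of two terms \<open>\<epsilon>\<close>.\<close>
  define \<epsilon> where "\<epsilon> = \<eta> / (3 * Z + 2)"
  have \<epsilon>: "\<epsilon> > 0" "3 * \<epsilon> * Z + 2 * \<epsilon> = \<eta>"
  proof -
    have "3 * Z + 2 > 0" using Z by simp
    then show "\<epsilon> > 0" using assms(2) by (simp add: \<epsilon>_def)
    have "3 * \<epsilon> * Z + 2 * \<epsilon> = \<epsilon> * (3 * Z + 2)" by (simp add: algebra_simps)
    then show "3 * \<epsilon> * Z + 2 * \<epsilon> = \<eta>" using \<open>3 * Z + 2 > 0\<close> by (simp add: \<epsilon>_def)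
  qed
  obtain \<phi> where \<phi>: "test_function \<Omega> \<phi>" "\<And>x. \<bar>\<phi> x\<bar> \<le> 1"
    "(LINT x|M. indicator \<Omega> x * \<bar>\<zeta> x \<bullet> v\<bar>) \<le> (LINT x|M. \<phi> x * (\<zeta> x \<bullet> v)) + \<epsilon>"
    using L1_norm_test_function[OF sets_M integrable_\<zeta>_inner open_\<Omega> \<epsilon>(1)] by metis
  have ind: "indicator \<Omega> x * \<bar>\<zeta> x \<bullet> v\<bar> = \<bar>\<zeta> x \<bullet> v\<bar>" for x
    using \<zeta>_zero[of x] by (auto simp: indicator_def)
  have \<phi>3: "(LINT x|M. \<bar>\<zeta> x \<bullet> v\<bar>) \<le> (LINT x|M. \<phi> x * (\<zeta> x \<bullet> v)) + \<epsilon>" using \<phi>(3) by (simp only: ind)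
  obtain K where K: "compact K" "K \<subseteq> \<Omega>" "\<And>x. x \<notin> K \<Longrightarrow> \<phi> x = 0"
    using test_function_support[OF \<phi>(1)] by metis
  have \<phi>K: "test_function K \<phi>" by (rule test_functionI[OF test_function_Ck[OF \<phi>(1)] K(1) _ K(3)]) auto
  obtain r where r: "r > 0" "(\<Union>x\<in>K. cball x r) \<subseteq> \<Omega>"
    using compact_subset_open_imp_cball_epsilon_subset[OF K(1) open_\<Omega> K(2)] by metis
  obtain d1 where d1: "d1 > 0" "\<And>x k. norm k < d1 \<Longrightarrow> \<bar>\<phi> (x - k) - \<phi> x\<bar> \<le> \<epsilon>"
    by (rule test_function_uniformly_continuous[OF \<phi>(1) \<epsilon>(1)]) blast
  obtain d2 where d2: "d2 > 0" "\<And>k. norm k < d2 \<Longrightarrow> (LINT x|lborel. norm (g (x + k) - g x)) \<le> \<epsilon>"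
    by (rule g_modulus[OF \<epsilon>(1)]) blast
  show ?thesis
  proof (rule that[of "min (min r \<epsilon>) (min d1 d2)"])
    show "min (min r \<epsilon>) (min d1 d2) > 0" using r \<epsilon> d1 d2 by simp
    fix h assume h: "h \<noteq> 0" "norm h < min (min r \<epsilon>) (min d1 d2)" "norm (h /\<^sub>R norm h - v) < min (min r \<epsilon>) (min d1 d2)"
    define w where "w = h /\<^sub>R norm h"
    have hw: "h = norm h *\<^sub>R w" using h by (simp add: w_def)
    have segK: "x + t *\<^sub>R h \<in> \<Omega>" if "x \<in> K" "0 \<le> t" "t \<le> 1" for x t
    proof -
      have "norm (t *\<^sub>R h) \<le> norm h" using that by (simp add: mult_left_le_one_le)
      then have "norm (t *\<^sub>R h) \<le> r" using h by linarith
      then have "x + t *\<^sub>R h \<in> cball x r" by (simp add: dist_norm)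
      then show ?thesis using r(2) that(1) by blast
    qed
    have tr: "test_function \<Omega> (\<lambda>x. \<phi> (x - t *\<^sub>R h))" if "0 \<le> t" "t \<le> 1" for t
      using segK that by (intro test_function_translate[OF \<phi>K]) blast
    have \<omega>: "(LINT x|lborel. norm (g (x + k) - g x)) \<le> \<epsilon>" if "norm k \<le> norm h" for k
      using d2(2) that h by simp
    obtain \<theta> where \<theta>: "0 < \<theta>" "\<theta> < 1"
      "\<bar>(LINT x|lborel. \<phi> x * remainder h x) - (LINT x|M. \<phi> (x - \<theta> *\<^sub>R h) * (\<zeta> x \<bullet> h))\<bar> \<le> norm h * \<epsilon>"
      by (rule remainder_pairing[OF tr \<phi>(2) \<omega>])
    have tr\<theta>: "test_function \<Omega> (\<lambda>x. \<phi> (x - \<theta> *\<^sub>R h))" using tr \<theta> by simp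
    have k: "norm (\<theta> *\<^sub>R h) < d1"
    proof -
      have "norm (\<theta> *\<^sub>R h) \<le> norm h" using \<theta>(1,2) by (simp add: mult_left_le_one_le)
      then show ?thesis using h(2) by linarith
    qed
    have up: "(LINT x|lborel. \<phi> x * remainder h x) \<le> (LINT x|lborel. indicator (overlap h) x * \<bar>remainder h x\<bar>)"
    proof (rule integral_mono)
      show "integrable lborel (\<lambda>x. \<phi> x * remainder h x)" by (rule integrable_test_mult[OF \<phi>(1) integrable_remainder]) simp
      show "integrable lborel (\<lambda>x. indicator (overlap h) x * \<bar>remainder h x\<bar>)"
        by (rule integrable_indicator_abs[OF integrable_remainder]) (simp add: open_overlap)
      fix x
      show "\<phi> x * remainder h x \<le> indicator (overlap h) x * \<bar>remainder h x\<bar>"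
      proof (cases "x \<in> K")
        case True
        then have "x \<in> overlap h" using segK[of x 1] K(2) by (auto simp: overlap_def)
        moreover have "\<phi> x * remainder h x \<le> 1 * \<bar>remainder h x\<bar>"
          using mult_right_mono[OF \<phi>(2)[of x], of "\<bar>remainder h x\<bar>"] abs_ge_self[of "\<phi> x * remainder h x"]
          unfolding abs_mult by linarith
        ultimately show ?thesis by simp
      qed (simp add: K(3))
    qed
    have w\<zeta>: "\<bar>\<zeta> x \<bullet> w\<bar> \<le> \<bar>\<zeta> x \<bullet> v\<bar> + \<epsilon> * norm (\<zeta> x)" "\<bar>\<zeta> x \<bullet> v - \<zeta> x \<bullet> w\<bar> \<le> \<epsilon> * norm (\<zeta> x)" for x
    proof -
      have "\<bar>\<zeta> x \<bullet> (w - v)\<bar> \<le> norm (\<zeta> x) * norm (w - v)" by (rule Cauchy_Schwarz_ineq2)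
      also have "\<dots> \<le> norm (\<zeta> x) * \<epsilon>" using h(3) by (intro mult_left_mono) (auto simp: w_def)
      finally have "\<bar>\<zeta> x \<bullet> w - \<zeta> x \<bullet> v\<bar> \<le> \<epsilon> * norm (\<zeta> x)" by (simp add: inner_diff_right mult.commute)
      then show "\<bar>\<zeta> x \<bullet> w\<bar> \<le> \<bar>\<zeta> x \<bullet> v\<bar> + \<epsilon> * norm (\<zeta> x)" "\<bar>\<zeta> x \<bullet> v - \<zeta> x \<bullet> w\<bar> \<le> \<epsilon> * norm (\<zeta> x)" by linarith+
    qed
    have iw: "integrable M (\<lambda>x. \<phi> (x - \<theta> *\<^sub>R h) * (\<zeta> x \<bullet> w))" "integrable M (\<lambda>x. \<phi> x * (\<zeta> x \<bullet> v))"
      using integrable_test_mult[OF tr\<theta> integrable_\<zeta>_inner sets_M] integrable_test_mult[OF \<phi>(1) integrable_\<zeta>_inner sets_M] by auto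
    have "(LINT x|M. \<phi> x * (\<zeta> x \<bullet> v)) \<le> (LINT x|M. \<phi> (x - \<theta> *\<^sub>R h) * (\<zeta> x \<bullet> w) + 2 * \<epsilon> * norm (\<zeta> x))"
    proof (rule integral_mono)
      fix x
      have "\<phi> x * (\<zeta> x \<bullet> v) - \<phi> (x - \<theta> *\<^sub>R h) * (\<zeta> x \<bullet> w) =
        (\<phi> x - \<phi> (x - \<theta> *\<^sub>R h)) * (\<zeta> x \<bullet> v) + \<phi> (x - \<theta> *\<^sub>R h) * (\<zeta> x \<bullet> v - \<zeta> x \<bullet> w)" by (simp add: algebra_simps)
      also have "\<dots> \<le> \<bar>\<phi> x - \<phi> (x - \<theta> *\<^sub>R h)\<bar> * \<bar>\<zeta> x \<bullet> v\<bar> + \<bar>\<phi> (x - \<theta> *\<^sub>R h)\<bar> * \<bar>\<zeta> x \<bullet> v - \<zeta> x \<bullet> w\<bar>"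
        by (intro add_mono) (simp_all flip: abs_mult)
      also have "\<dots> \<le> \<epsilon> * norm (\<zeta> x) + 1 * (\<epsilon> * norm (\<zeta> x))"
        using d1(2)[OF k, of x] \<phi>(2) w\<zeta>(2) Cauchy_Schwarz_ineq2[of "\<zeta> x" v] v \<epsilon>
        by (intro add_mono mult_mono) (auto simp: abs_minus_commute)
      finally show "\<phi> x * (\<zeta> x \<bullet> v) \<le> \<phi> (x - \<theta> *\<^sub>R h) * (\<zeta> x \<bullet> w) + 2 * \<epsilon> * norm (\<zeta> x)" by linarith
    qed (use iw integrable_\<zeta> in auto)
    also have "\<dots> = (LINT x|M. \<phi> (x - \<theta> *\<^sub>R h) * (\<zeta> x \<bullet> w)) + 2 * \<epsilon> * Z"
      using iw integrable_\<zeta> by (simp add: Z_def)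
    finally have 1: "(LINT x|M. \<phi> x * (\<zeta> x \<bullet> v)) \<le> (LINT x|M. \<phi> (x - \<theta> *\<^sub>R h) * (\<zeta> x \<bullet> w)) + 2 * \<epsilon> * Z" .
    have "(LINT x|M. \<bar>\<zeta> x \<bullet> w\<bar>) \<le> (LINT x|M. \<bar>\<zeta> x \<bullet> v\<bar> + \<epsilon> * norm (\<zeta> x))"
      using w\<zeta>(1) integrable_\<zeta> by (intro integral_mono) auto
    also have "\<dots> = (LINT x|M. \<bar>\<zeta> x \<bullet> v\<bar>) + \<epsilon> * Z" using integrable_\<zeta> by (simp add: Z_def)
    finally have 2: "(LINT x|M. \<bar>\<zeta> x \<bullet> w\<bar>) \<le> (LINT x|M. \<phi> (x - \<theta> *\<^sub>R h) * (\<zeta> x \<bullet> w)) + (3 * \<epsilon> * Z + \<epsilon>)"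
      using 1 \<phi>3 by linarith
    have 3: "(LINT x|M. \<bar>\<zeta> x \<bullet> h\<bar>) = norm h * (LINT x|M. \<bar>\<zeta> x \<bullet> w\<bar>)"
      by (subst hw) (simp add: abs_mult)
    have 4: "(LINT x|M. \<phi> (x - \<theta> *\<^sub>R h) * (\<zeta> x \<bullet> h)) = norm h * (LINT x|M. \<phi> (x - \<theta> *\<^sub>R h) * (\<zeta> x \<bullet> w))"
    proof -
      have "\<zeta> x \<bullet> h = norm h * (\<zeta> x \<bullet> w)" for x by (subst hw) simp
      then have "(\<lambda>x. \<phi> (x - \<theta> *\<^sub>R h) * (\<zeta> x \<bullet> h)) = (\<lambda>x. norm h * (\<phi> (x - \<theta> *\<^sub>R h) * (\<zeta> x \<bullet> w)))" by (simp add: mult_ac)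
      then show ?thesis by simp
    qed
    have "(LINT x|M. \<bar>\<zeta> x \<bullet> h\<bar>) - \<eta> * norm h \<le> (LINT x|M. \<phi> (x - \<theta> *\<^sub>R h) * (\<zeta> x \<bullet> h)) - norm h * \<epsilon>"
      using mult_left_mono[OF 2, of "norm h"] unfolding 3 4 \<epsilon>(2)[symmetric] by (simp add: algebra_simps)
    then show "(LINT x|lborel. indicator (overlap h) x * \<bar>remainder h x\<bar>) \<ge> (LINT x|M. \<bar>\<zeta> x \<bullet> h\<bar>) - \<eta> * norm h"
      using up \<theta>(3) by linarith
  qed
qed

text \<open>Compactness of the unit sphere makes the lower bound uniform in the direction of \<open>h\<close>.\<close>

lemma remainder_lower:
  assumes "\<eta> > 0"
  obtains \<delta> where "\<delta> > 0" "\<And>h. h \<noteq> 0 \<Longrightarrow> norm h < \<delta> \<Longrightarrow>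
    (LINT x|lborel. indicator (overlap h) x * \<bar>remainder h x\<bar>) \<ge> (LINT x|M. \<bar>\<zeta> x \<bullet> h\<bar>) - \<eta> * norm h"
proof -
  define P where "P h \<longleftrightarrow> (LINT x|lborel. indicator (overlap h) x * \<bar>remainder h x\<bar>) \<ge>
    (LINT x|M. \<bar>\<zeta> x \<bullet> h\<bar>) - \<eta> * norm h" for h
  have "\<exists>\<delta>>0. \<forall>h. h \<noteq> 0 \<longrightarrow> norm h < \<delta> \<longrightarrow> norm (h /\<^sub>R norm h - v) < \<delta> \<longrightarrow> P h" if "v \<in> sphere 0 1" for v
  proof -
    have "norm v = 1" using that by simp
    then obtain \<delta> where "\<delta> > 0" "\<And>h. h \<noteq> 0 \<Longrightarrow> norm h < \<delta> \<Longrightarrow> norm (h /\<^sub>R norm h - v) < \<delta> \<Longrightarrow> P h"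
      unfolding P_def by (rule remainder_lower_near_direction[OF _ assms]) blast
    then show ?thesis by blast
  qed
  then obtain d where d: "\<And>v. v \<in> sphere 0 1 \<Longrightarrow> d v > 0"
    "\<And>v h. v \<in> sphere 0 1 \<Longrightarrow> h \<noteq> 0 \<Longrightarrow> norm h < d v \<Longrightarrow> norm (h /\<^sub>R norm h - v) < d v \<Longrightarrow> P h" by metis
  obtain T where T: "T \<subseteq> sphere 0 1" "finite T" "sphere (0::'a) 1 \<subseteq> (\<Union>v\<in>T. ball v (d v))"
  proof (rule compactE_image[of "sphere (0::'a) 1" "sphere 0 1" "\<lambda>v. ball v (d v)"])
    show "sphere (0::'a) 1 \<subseteq> (\<Union>v\<in>sphere 0 1. ball v (d v))" using d(1) by (meson UN_I centre_in_ball subsetI)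
  qed auto
  show ?thesis
  proof (rule that[of "Min (insert 1 (d ` T))"])
    show "Min (insert 1 (d ` T)) > 0" using T d(1) by (subst Min_gr_iff) auto
    fix h :: 'a assume h: "h \<noteq> 0" "norm h < Min (insert 1 (d ` T))"
    have "h /\<^sub>R norm h \<in> sphere 0 1" using h by simp
    then obtain v where v: "v \<in> T" "h /\<^sub>R norm h \<in> ball v (d v)" using T(3) by blast
    have "norm h < d v" using h(2) v T(2) by (subst (asm) Min_gr_iff) auto
    moreover have "norm (h /\<^sub>R norm h - v) < d v" using v(2) by (simp add: dist_norm norm_minus_commute)
    ultimately have "P h" using d(2)[of v h] v(1) T(1) h(1) by blast
    then show "(LINT x|lborel. indicator (overlap h) x * \<bar>remainder h x\<bar>) \<ge> (LINT x|M. \<bar>\<zeta> x \<bullet> h\<bar>) - \<eta> * norm h"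
      unfolding P_def .
  qed
qed

end

section \<open>The boundary layer\<close>

lemma Ck_lipschitz_on_cball:
  fixes f :: "'a::euclidean_space \<Rightarrow> real"
  assumes f: "Ck (Suc 0) f" and r: "r > 0"
  obtains L where "L \<ge> 0" "\<And>x y. x \<in> cball z r \<Longrightarrow> y \<in> cball z r \<Longrightarrow> \<bar>f x - f y\<bar> \<le> L * norm (x - y)"
proof -
  have bl: "bounded_linear (frechet_derivative f (at x))" for x
    using Ck_differentiable[OF f] has_derivative_bounded_linear by blast
  have "\<exists>B. \<forall>x\<in>cball z r. \<bar>frechet_derivative f (at x) b\<bar> \<le> B" if "b \<in> Basis" for b
  proof -
    have "continuous_on UNIV (\<lambda>x. frechet_derivative f (at x) b)" using f that by simp
    then have "compact ((\<lambda>x. frechet_derivative f (at x) b) ` cball z r)"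
      by (intro compact_continuous_image) (auto intro: continuous_on_subset)
    then obtain B where "\<forall>y\<in>(\<lambda>x. frechet_derivative f (at x) b) ` cball z r. norm y \<le> B"
      using compact_imp_bounded bounded_iff by metis
    then show ?thesis by auto
  qed
  then obtain B where B: "\<And>b x. b \<in> Basis \<Longrightarrow> x \<in> cball z r \<Longrightarrow> \<bar>frechet_derivative f (at x) b\<bar> \<le> B b" by metis
  define L where "L = (\<Sum>b\<in>Basis. B b)"
  have L: "L \<ge> 0" unfolding L_def
  proof (rule sum_nonneg)
    fix b :: 'a assume "b \<in> Basis"
    from B[OF this, of z] r show "0 \<le> B b" by simp
  qed
  show ?thesis
  proof (rule that[OF L])
    fix x y assume xy: "x \<in> cball z r" "y \<in> cball z r"
    have "norm (f x - f y) \<le> L * norm (x - y)"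
    proof (rule differentiable_bound[OF convex_cball _ _ xy])
      show "(f has_derivative frechet_derivative f (at x)) (at x within cball z r)" for x
        using Ck_differentiable[OF f] has_derivative_at_withinI by blast
      fix x assume x: "x \<in> cball z r"
      show "onorm (frechet_derivative f (at x)) \<le> L"
      proof (rule onorm_le)
        fix h
        have "\<bar>frechet_derivative f (at x) h\<bar> \<le> (\<Sum>b\<in>Basis. \<bar>(h \<bullet> b) * frechet_derivative f (at x) b\<bar>)"
          unfolding bounded_linear_Basis_sum[OF bl, of x h] by (rule sum_abs)
        also have "\<dots> \<le> (\<Sum>b\<in>Basis. norm h * B b)"
          by (intro sum_mono) (auto simp: abs_mult intro!: mult_mono B x Basis_le_norm)
        finally show "norm (frechet_derivative f (at x) h) \<le> L * norm h"
          by (simp add: L_def sum_distrib_left mult.commute)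
      qed
    qed
    then show "\<bar>f x - f y\<bar> \<le> L * norm (x - y)" by simp
  qed
qed

definition near_frontier :: "'a::metric_space set \<Rightarrow> real \<Rightarrow> 'a set" where
  "near_frontier \<Omega> c = {x \<in> \<Omega>. \<exists>y\<in>frontier \<Omega>. dist y x < c}"

lemma open_near_frontier: "open \<Omega> \<Longrightarrow> open (near_frontier \<Omega> c)"
proof -
  assume "open \<Omega>"
  moreover have "near_frontier \<Omega> c = \<Omega> \<inter> (\<Union>y\<in>frontier \<Omega>. ball y c)" by (auto simp: near_frontier_def)
  ultimately show ?thesis by auto
qed

lemma near_frontier_mono: "c \<le> d \<Longrightarrow> near_frontier \<Omega> c \<subseteq> near_frontier \<Omega> d"
  by (force simp: near_frontier_def)

text \<open>Above a Lipschitz graph two nearby points \<open>x\<close> and \<open>x + h\<close> of \<open>\<Omega>\<close> are joined, inside \<open>\<Omega>\<close>, by going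
  up in direction \<open>e\<close>, then along \<open>h\<close>, then down again, provided one goes up by a fixed multiple of
  \<open>|h|\<close>.\<close>

lemma smooth_boundary_detour:
  fixes \<Omega> :: "'a::euclidean_space set"
  assumes sm: "smooth_boundary \<Omega>" and z: "z \<in> frontier \<Omega>"
  obtains r L e where "r > 0" "L \<ge> 0" "norm e = 1"
    "\<And>x h t. x \<in> \<Omega> \<Longrightarrow> dist z x < r \<Longrightarrow> norm (h::'a) < r \<Longrightarrow> 0 \<le> t \<Longrightarrow> t \<le> (1 + L) * norm h \<Longrightarrow> x + t *\<^sub>R e \<in> \<Omega>"
    "\<And>x h t. x \<in> \<Omega> \<Longrightarrow> x + h \<in> \<Omega> \<Longrightarrow> dist z x < r \<Longrightarrow> norm (h::'a) < r \<Longrightarrow> 0 \<le> t \<Longrightarrow> t \<le> (1 + L) * norm h \<Longrightarrow> x + h + t *\<^sub>R e \<in> \<Omega>"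
    "\<And>x h t. x \<in> \<Omega> \<Longrightarrow> dist z x < r \<Longrightarrow> norm (h::'a) < r \<Longrightarrow> 0 \<le> t \<Longrightarrow> t \<le> 1 \<Longrightarrow> x + ((1 + L) * norm h) *\<^sub>R e + t *\<^sub>R h \<in> \<Omega>"
proof -
  obtain r0 e \<gamma> where r0: "r0 > 0" and e: "norm e = 1" and \<gamma>1: "smooth \<gamma>" and \<gamma>2: "\<forall>y t. \<gamma> (y + t *\<^sub>R e) = \<gamma> y"
    and eq: "\<Omega> \<inter> ball z r0 = {y \<in> ball z r0. y \<bullet> e > \<gamma> y}"
    using bspec[OF sm[unfolded smooth_boundary_def] z] by (elim exE conjE) (rule that)
  note \<gamma> = \<gamma>1 \<gamma>2[rule_format]
  obtain L where L: "L \<ge> 0" "\<And>x y. x \<in> cball z r0 \<Longrightarrow> y \<in> cball z r0 \<Longrightarrow> \<bar>\<gamma> x - \<gamma> y\<bar> \<le> L * norm (x - y)"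
    using Ck_lipschitz_on_cball[of \<gamma> r0] \<gamma>(1) r0 unfolding smooth_def by metis
  define r where "r = r0 / (4 + L)"
  have r: "r > 0" "r * (4 + L) = r0" using r0 L by (auto simp: r_def)
  have ee: "e \<bullet> e = 1" using e by (simp add: norm_eq_1)
  have "r * L \<ge> 0" using r L by simp
  then have r4: "4 * r \<le> r0" using r(2) by (simp add: algebra_simps)
  have bound: "norm (x - z) + norm k + t < r0"
    if "dist z x < r" "norm h < r" "norm k \<le> norm h" "t \<le> (1 + L) * norm h" for x h k :: 'a and t
  proof -
    have "(1 + L) * norm h \<le> (1 + L) * r" using that L by (intro mult_left_mono) auto
    then show ?thesis using that r by (simp add: dist_norm norm_minus_commute algebra_simps)
  qed
  have inball: "x + k + t *\<^sub>R e \<in> ball z r0" if "norm (x - z) + norm k + t < r0" "0 \<le> t" for x k t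
  proof -
    have "norm (x + k + t *\<^sub>R e - z) = norm ((x - z) + (k + t *\<^sub>R e))" by (simp add: algebra_simps)
    also have "\<dots> \<le> norm (x - z) + (norm k + norm (t *\<^sub>R e))"
      using norm_triangle_ineq[of "x - z" "k + t *\<^sub>R e"] norm_triangle_ineq[of k "t *\<^sub>R e"] by linarith
    also have "\<dots> < r0" using that e by simp
    finally show ?thesis by (simp add: dist_norm norm_minus_commute)
  qed
  have \<Omega>I: "y \<in> \<Omega>" if "y \<in> ball z r0" "y \<bullet> e > \<gamma> y" for y using eq that by blast
  have \<Omega>D: "y \<bullet> e > \<gamma> y" if "y \<in> ball z r0" "y \<in> \<Omega>" for y using eq that by blast
  have up: "y + t *\<^sub>R e \<in> \<Omega>" if "y \<in> \<Omega>" "y \<in> ball z r0" "y + t *\<^sub>R e \<in> ball z r0" "0 \<le> t" for y t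
    using that \<Omega>D[of y] by (intro \<Omega>I) (auto simp: inner_add_left ee \<gamma>(2))
  show ?thesis
  proof (rule that[OF r(1) L(1) e])
    fix x h :: 'a and t :: real
    assume x: "x \<in> \<Omega>" "dist z x < r" "norm h < r" "0 \<le> t"
    show "x + t *\<^sub>R e \<in> \<Omega>" if "t \<le> (1 + L) * norm h"
      using up[OF x(1), of t] inball[of x 0 t] inball[of x 0 0] bound[of x h 0 t] bound[of x h 0 0] x that L by simp
    show "x + h + t *\<^sub>R e \<in> \<Omega>" if "x + h \<in> \<Omega>" "t \<le> (1 + L) * norm h"
      using up[OF that(1), of t] inball[of x h t] inball[of x h 0] bound[of x h h t] bound[of x h h 0] x that L by simp
    show "x + ((1 + L) * norm h) *\<^sub>R e + t *\<^sub>R h \<in> \<Omega>" if "t \<le> 1"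
    proof -
      define s where "s = (1 + L) * norm h"
      have s: "s \<ge> 0" using L by (simp add: s_def)
      have th: "norm (t *\<^sub>R h) \<le> norm h" using x that by (simp add: mult_left_le_one_le)
      have b: "x + t *\<^sub>R h + s *\<^sub>R e \<in> ball z r0" "x + t *\<^sub>R h + 0 *\<^sub>R e \<in> ball z r0" "x + 0 + 0 *\<^sub>R e \<in> ball z r0"
        using inball[of x "t *\<^sub>R h" s] inball[of x "t *\<^sub>R h" 0] inball[of x 0 0]
          bound[of x h "t *\<^sub>R h" s] bound[of x h "t *\<^sub>R h" 0] bound[of x h 0 0] x th s L by (simp_all add: s_def)
      have "\<gamma> (x + t *\<^sub>R h) \<le> \<gamma> x + L * norm (t *\<^sub>R h)" using L(2)[of "x + t *\<^sub>R h" x] b by simp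
      also have "\<dots> \<le> \<gamma> x + L * norm h" using th L by (simp only: add_left_mono mult_left_mono)
      also have "\<dots> < x \<bullet> e + L * norm h" using \<Omega>D[of x] b x by simp
      also have "\<dots> \<le> (x + t *\<^sub>R h + s *\<^sub>R e) \<bullet> e"
      proof -
        have "\<bar>(t *\<^sub>R h) \<bullet> e\<bar> \<le> norm h" using Cauchy_Schwarz_ineq2[of "t *\<^sub>R h" e] th e by simp
        then have "(t *\<^sub>R h) \<bullet> e \<ge> - norm h" by linarith
        then show ?thesis by (simp add: inner_add_left ee s_def algebra_simps)
      qed
      finally have "x + t *\<^sub>R h + s *\<^sub>R e \<in> \<Omega>" using b by (intro \<Omega>I) (auto simp: \<gamma>(2))
      then show ?thesis by (simp add: s_def add_ac)
    qed
  qed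
qed

context split_distributional_derivative
begin

lemma mass_nonneg: "mass W \<ge> 0"
  unfolding mass_def by (intro add_nonneg_nonneg Bochner_Integration.integral_nonneg) auto

lemma mass_mono:
  assumes "V \<subseteq> W" "V \<in> sets borel" "W \<in> sets borel"
  shows "mass V \<le> mass W"
proof -
  have "indicator V x * norm v \<le> (indicator W x * norm v :: real)" for x and v :: 'a
    using assms(1) by (intro mult_right_mono) (auto simp: indicator_def)
  then show ?thesis unfolding mass_def
    using integrable_indicator_norm[OF assms(2)] integrable_indicator_norm[OF assms(3)]
    by (intro add_mono integral_mono) auto
qed

text \<open>Every point of the open set \<open>\<Omega>\<close> leaves the layer eventually, so the layer carries little mass.\<close>

lemma mass_near_frontier_small:
  assumes "\<eta> > 0"
  obtains c where "c > 0" "mass (near_frontier \<Omega> c) < \<eta>"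
proof -
  define W where "W n = near_frontier \<Omega> (inverse (real (Suc n)))" for n
  have Wb: "W n \<in> sets borel" for n unfolding W_def using open_near_frontier[OF open_\<Omega>] by simp
  have ev: "(\<lambda>n. indicator (W n) x * norm (v::'a)) \<longlonglongrightarrow> 0" for x v
  proof -
    have "\<forall>\<^sub>F n in sequentially. x \<notin> W n"
    proof (cases "x \<in> \<Omega>")
      case True
      then obtain d where d: "d > 0" "ball x d \<subseteq> \<Omega>" using open_\<Omega> open_contains_ball by blast
      have far: "dist y x \<ge> d" if "y \<in> frontier \<Omega>" for y
      proof (rule ccontr)
        assume "\<not> dist y x \<ge> d"
        then have "y \<in> \<Omega>" using d by (auto simp: dist_commute)
        then show False using that open_\<Omega> by (simp add: frontier_def interior_open)
      qed
      have "\<forall>\<^sub>F n in sequentially. inverse (real (Suc n)) < d"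
        using LIMSEQ_inverse_real_of_nat d(1) by (rule order_tendstoD)
      then show ?thesis
        by (rule eventually_mono) (use far in \<open>force simp: W_def near_frontier_def\<close>)
    qed (auto simp: W_def near_frontier_def)
    then have "\<forall>\<^sub>F n in sequentially. indicator (W n) x * norm v = 0"
      by (rule eventually_mono) auto
    then show ?thesis by (rule tendsto_eventually)
  qed
  have "(\<lambda>n. LINT x|M. indicator (W n) x * norm (\<zeta> x)) \<longlonglongrightarrow> (LINT x|M. 0)"
    by (rule integral_dominated_convergence[where w = "\<lambda>x. norm (\<zeta> x)"])
      (use ev integrable_\<zeta> integrable_indicator_norm[OF Wb] in \<open>auto simp: indicator_def\<close>)
  moreover have "(\<lambda>n. LINT x|lborel. indicator (W n) x * norm (g x)) \<longlonglongrightarrow> (LINT x|(lborel::'a measure). 0)"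
    by (rule integral_dominated_convergence[where w = "\<lambda>x. norm (g x)"])
      (use ev integrable_g integrable_indicator_norm[OF Wb] in \<open>auto simp: indicator_def\<close>)
  ultimately have "(\<lambda>n. mass (W n)) \<longlonglongrightarrow> 0 + 0" unfolding mass_def by (intro tendsto_add) auto
  then have "\<forall>\<^sub>F n in sequentially. mass (W n) < \<eta>" using assms by (intro order_tendstoD) auto
  then obtain n where "mass (W n) < \<eta>" by (auto simp: eventually_sequentially)
  then show ?thesis using that[of "inverse (real (Suc n))"] by (simp add: W_def)
qed

text \<open>Each of the three legs of the detour translates a set along segments inside \<open>\<Omega>\<close>, so
  \<open>translation_difference_bound\<close> applies to it.  The detour has length comparable to \<open>|h|\<close> and therefore
  stays in a layer of that thickness.\<close>

lemma local_boundary_difference_bound: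
  assumes sm: "smooth_boundary \<Omega>" and z: "z \<in> frontier \<Omega>"
  obtains r C where "r > 0" "C \<ge> 0"
    "\<And>h. h \<noteq> 0 \<Longrightarrow> norm h < r \<Longrightarrow>
      (LINT x|lborel. indicator (near_frontier \<Omega> (2 * norm h) \<inter> overlap h \<inter> ball z r) x * \<bar>U (x + h) - U x\<bar>)
      \<le> C * norm h * mass (near_frontier \<Omega> (C * norm h))"
proof -
  obtain r L e where r: "r > 0" "L \<ge> 0" and e: "norm e = 1"
    and leg1: "\<And>x h t. x \<in> \<Omega> \<Longrightarrow> dist z x < r \<Longrightarrow> norm (h::'a) < r \<Longrightarrow> 0 \<le> t \<Longrightarrow> t \<le> (1 + L) * norm h \<Longrightarrow> x + t *\<^sub>R e \<in> \<Omega>"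
    and leg3: "\<And>x h t. x \<in> \<Omega> \<Longrightarrow> x + h \<in> \<Omega> \<Longrightarrow> dist z x < r \<Longrightarrow> norm (h::'a) < r \<Longrightarrow> 0 \<le> t \<Longrightarrow> t \<le> (1 + L) * norm h \<Longrightarrow> x + h + t *\<^sub>R e \<in> \<Omega>"
    and leg2: "\<And>x h t. x \<in> \<Omega> \<Longrightarrow> dist z x < r \<Longrightarrow> norm (h::'a) < r \<Longrightarrow> 0 \<le> t \<Longrightarrow> t \<le> 1 \<Longrightarrow> x + ((1 + L) * norm h) *\<^sub>R e + t *\<^sub>R h \<in> \<Omega>"
    by (rule smooth_boundary_detour[OF sm z]) blast
  define C where "C = 4 + 2 * L"
  show ?thesis
  proof (rule that[of r C])
    show "C \<ge> 0" using r by (simp add: C_def)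
    fix h :: 'a assume h: "h \<noteq> 0" "norm h < r"
    define s where "s = (1 + L) * norm h"
    define A where "A = near_frontier \<Omega> (2 * norm h) \<inter> overlap h \<inter> ball z r"
    define W where "W = near_frontier \<Omega> (C * norm h)"
    have s0: "s \<ge> 0" using r by (simp add: s_def)
    have A: "open A" unfolding A_def using open_near_frontier[OF open_\<Omega>] open_overlap by auto
    have W: "W \<in> sets borel" "W \<subseteq> \<Omega>" unfolding W_def using open_near_frontier[OF open_\<Omega>]
      by (auto simp: near_frontier_def)
    have tA: "open ((\<lambda>x. x - k) ` A)" for k
      using open_translation[OF A, of "-k"] by (simp add: image_image algebra_simps)
    have AD: "x \<in> \<Omega>" "x + h \<in> \<Omega>" "dist z x < r" "\<exists>y\<in>frontier \<Omega>. dist y x < 2 * norm h" if "x \<in> A" for x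
      using that by (auto simp: A_def near_frontier_def overlap_def)
    have WI: "x + k \<in> W" if xA: "x \<in> A" and xk: "x + k \<in> \<Omega>" and nk: "norm k \<le> norm h + s" for x k
    proof -
      obtain y where y: "y \<in> frontier \<Omega>" "dist y x < 2 * norm h" using AD(4)[OF xA] by blast
      have "dist y (x + k) \<le> dist y x + norm k"
        using dist_triangle[of y "x + k" x] by (simp add: dist_norm)
      also have "\<dots> < C * norm h"
      proof -
        have "L * norm h \<ge> 0" using r(2) by simp
        moreover have "norm k \<le> 2 * norm h + L * norm h" using nk by (simp add: s_def algebra_simps)
        moreover have "C * norm h = 4 * norm h + 2 * (L * norm h)" by (simp add: C_def algebra_simps)
        ultimately show ?thesis using y(2) by linarith
      qed
      finally show ?thesis using y(1) xk by (auto simp: W_def near_frontier_def)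
    qed
    have shift: "(LINT x|lborel. indicator A x * \<bar>U (x + k + l) - U (x + k)\<bar>) \<le> norm l * mass W"
      if "\<And>x t. x \<in> A \<Longrightarrow> 0 \<le> t \<Longrightarrow> t \<le> 1 \<Longrightarrow> x + k + t *\<^sub>R l \<in> W" for k l
    proof -
      have "(LINT x|lborel. indicator A ((x + k) - k) * \<bar>U (x + k + l) - U (x + k)\<bar>)
          = (LINT x|lborel. indicator A (x - k) * \<bar>U (x + l) - U x\<bar>)"
      proof (rule lborel_integral_translate(1)[where f = "\<lambda>x. indicator A (x - k) * \<bar>U (x + l) - U x\<bar>"])
        have [measurable]: "A \<in> sets borel" using A by simp
        show "(\<lambda>x. indicator A (x - k) * \<bar>U (x + l) - U x\<bar>) \<in> borel_measurable borel" by measurable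
      qed
      moreover have "(indicator A (x - k) :: real) = indicator ((\<lambda>x. x - (-k)) ` A) x" for x
      proof -
        have "x \<in> (\<lambda>x. x - (-k)) ` A" if "x - k \<in> A"
          using imageI[OF that, of "\<lambda>x. x - (-k)"] by simp
        then have "x - k \<in> A \<longleftrightarrow> x \<in> (\<lambda>x. x - (-k)) ` A" by auto
        then show ?thesis by (simp only: indicator_def)
      qed
      moreover have "(LINT x|lborel. indicator ((\<lambda>x. x - (-k)) ` A) x * \<bar>U (x + l) - U x\<bar>) \<le> norm l * mass W"
        using that by (intro translation_difference_bound[OF tA W]) auto
      ultimately show ?thesis by simp
    qed
    have n1: "norm (t *\<^sub>R s *\<^sub>R e) \<le> s" if "0 \<le> t" "t \<le> 1" for t
      using that e s0 by (simp add: mult_left_le_one_le)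
    have ts: "0 \<le> t * s" "t * s \<le> (1 + L) * norm h" if "0 \<le> t" "t \<le> 1" for t
      using that s0 by (auto simp: s_def[symmetric] mult_left_le_one_le)
    have 1: "(LINT x|lborel. indicator A x * \<bar>U (x + 0 + s *\<^sub>R e) - U (x + 0)\<bar>) \<le> norm (s *\<^sub>R e) * mass W"
    proof (rule shift)
      fix x and t :: real assume x: "x \<in> A" "0 \<le> t" "t \<le> 1"
      have "x + (t * s) *\<^sub>R e \<in> \<Omega>" using AD[OF x(1)] h ts[OF x(2,3)] by (intro leg1[of x h]) auto
      moreover have "norm (t *\<^sub>R s *\<^sub>R e) \<le> norm h + s" using n1[OF x(2,3)] norm_ge_zero[of h] by linarith
      ultimately show "x + 0 + t *\<^sub>R s *\<^sub>R e \<in> W" using WI[OF x(1), of "t *\<^sub>R s *\<^sub>R e"] by simp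
    qed
    have 2: "(LINT x|lborel. indicator A x * \<bar>U (x + s *\<^sub>R e + h) - U (x + s *\<^sub>R e)\<bar>) \<le> norm h * mass W"
    proof (rule shift)
      fix x and t :: real assume x: "x \<in> A" "0 \<le> t" "t \<le> 1"
      have "x + s *\<^sub>R e + t *\<^sub>R h \<in> \<Omega>" unfolding s_def using AD[OF x(1)] h x by (intro leg2[of x h]) auto
      moreover have "norm (s *\<^sub>R e + t *\<^sub>R h) \<le> norm h + s"
        using norm_triangle_ineq[of "s *\<^sub>R e" "t *\<^sub>R h"] e s0 x mult_left_le_one_le[of "norm h" t] by simp
      ultimately show "x + s *\<^sub>R e + t *\<^sub>R h \<in> W" using WI[OF x(1), of "s *\<^sub>R e + t *\<^sub>R h"] by (simp add: add.assoc)
    qed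
    have 3: "(LINT x|lborel. indicator A x * \<bar>U (x + h + s *\<^sub>R e) - U (x + h)\<bar>) \<le> norm (s *\<^sub>R e) * mass W"
    proof (rule shift)
      fix x and t :: real assume x: "x \<in> A" "0 \<le> t" "t \<le> 1"
      have "x + h + (t * s) *\<^sub>R e \<in> \<Omega>" using AD[OF x(1)] h ts[OF x(2,3)] by (intro leg3[of x h]) auto
      moreover have "norm (h + t *\<^sub>R s *\<^sub>R e) \<le> norm h + s"
        using norm_triangle_ineq[of h "t *\<^sub>R s *\<^sub>R e"] n1[OF x(2,3)] by linarith
      ultimately show "x + h + t *\<^sub>R s *\<^sub>R e \<in> W" using WI[OF x(1), of "h + t *\<^sub>R s *\<^sub>R e"] by (simp add: add.assoc)
    qed
    have i: "integrable lborel (\<lambda>x. indicator A x * \<bar>U (x + k + l) - U (x + k)\<bar>)" for k l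
      using integrable_shift_U[of "k + l"] integrable_shift_U[of k] A
      by (intro integrable_indicator_abs) (auto simp: add.assoc)
    have "(LINT x|lborel. indicator A x * \<bar>U (x + h) - U x\<bar>) \<le>
      (LINT x|lborel. (indicator A x * \<bar>U (x + 0 + s *\<^sub>R e) - U (x + 0)\<bar> + indicator A x * \<bar>U (x + s *\<^sub>R e + h) - U (x + s *\<^sub>R e)\<bar>)
         + indicator A x * \<bar>U (x + h + s *\<^sub>R e) - U (x + h)\<bar>)"
    proof (rule integral_mono)
      show "integrable lborel (\<lambda>x. indicator A x * \<bar>U (x + h) - U x\<bar>)" using i[of 0 h] by simp
      fix x
      have "\<bar>U (x + h) - U x\<bar> \<le> \<bar>U (x + 0 + s *\<^sub>R e) - U (x + 0)\<bar> + \<bar>U (x + s *\<^sub>R e + h) - U (x + s *\<^sub>R e)\<bar>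
         + \<bar>U (x + h + s *\<^sub>R e) - U (x + h)\<bar>"
        by (simp add: add_ac)
      then show "indicator A x * \<bar>U (x + h) - U x\<bar> \<le> (indicator A x * \<bar>U (x + 0 + s *\<^sub>R e) - U (x + 0)\<bar> + indicator A x * \<bar>U (x + s *\<^sub>R e + h) - U (x + s *\<^sub>R e)\<bar>)
         + indicator A x * \<bar>U (x + h + s *\<^sub>R e) - U (x + h)\<bar>"
        by (auto simp: indicator_def)
    qed (intro Bochner_Integration.integrable_add i)
    also have "\<dots> = (LINT x|lborel. indicator A x * \<bar>U (x + 0 + s *\<^sub>R e) - U (x + 0)\<bar>) + (LINT x|lborel. indicator A x * \<bar>U (x + s *\<^sub>R e + h) - U (x + s *\<^sub>R e)\<bar>)
         + (LINT x|lborel. indicator A x * \<bar>U (x + h + s *\<^sub>R e) - U (x + h)\<bar>)"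
      by (subst Bochner_Integration.integral_add[OF Bochner_Integration.integrable_add[OF i i] i],
          subst Bochner_Integration.integral_add[OF i i]) simp
    also have "\<dots> \<le> norm (s *\<^sub>R e) * mass W + norm h * mass W + norm (s *\<^sub>R e) * mass W"
      using 1 2 3 by (intro add_mono)
    also have "norm (s *\<^sub>R e) = s" using e s0 by simp
    also have "s * mass W + norm h * mass W + s * mass W = (3 + 2 * L) * norm h * mass W"
      by (simp add: s_def algebra_simps)
    also have "\<dots> \<le> C * norm h * mass W"
      unfolding C_def by (intro mult_right_mono mass_nonneg) auto
    finally show "(LINT x|lborel. indicator (near_frontier \<Omega> (2 * norm h) \<inter> overlap h \<inter> ball z r) x * \<bar>U (x + h) - U x\<bar>)
      \<le> C * norm h * mass (near_frontier \<Omega> (C * norm h))" unfolding A_def W_def .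
  qed (rule r)
qed

lemma boundary_difference_small:
  assumes sm: "smooth_boundary \<Omega>" and cp: "compact (frontier \<Omega>)" and "\<eta> > 0"
  obtains \<delta> where "\<delta> > 0" "\<And>h. h \<noteq> 0 \<Longrightarrow> norm h < \<delta> \<Longrightarrow>
      (LINT x|lborel. indicator (near_frontier \<Omega> (2 * norm h) \<inter> overlap h) x * \<bar>U (x + h) - U x\<bar>) \<le> \<eta> * norm h"
proof -
  define I where "I V h = (LINT x|lborel. indicator (near_frontier \<Omega> (2 * norm h) \<inter> overlap h \<inter> V) x * \<bar>U (x + h) - U x\<bar>)"
    for V h
  have "\<exists>r C. r > 0 \<and> C \<ge> 0 \<and> (\<forall>h. h \<noteq> 0 \<longrightarrow> norm h < r \<longrightarrow>
      I (ball z r) h \<le> C * norm h * mass (near_frontier \<Omega> (C * norm h)))" if zF: "z \<in> frontier \<Omega>" for z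
  proof -
    obtain r C where "r > 0" "C \<ge> 0" "\<And>h. h \<noteq> 0 \<Longrightarrow> norm h < r \<Longrightarrow>
      I (ball z r) h \<le> C * norm h * mass (near_frontier \<Omega> (C * norm h))"
      unfolding I_def by (rule local_boundary_difference_bound[OF sm zF]) blast
    then show ?thesis by blast
  qed
  then obtain r C where r: "\<And>z. z \<in> frontier \<Omega> \<Longrightarrow> r z > 0" and C: "\<And>z. z \<in> frontier \<Omega> \<Longrightarrow> C z \<ge> 0"
    and loc0: "\<And>z h. z \<in> frontier \<Omega> \<Longrightarrow> h \<noteq> 0 \<Longrightarrow> norm h < r z \<Longrightarrow>
      I (ball z (r z)) h \<le> C z * norm h * mass (near_frontier \<Omega> (C z * norm h))" by metis
  note loc = loc0[unfolded I_def]
  obtain T where T: "T \<subseteq> frontier \<Omega>" "finite T" "frontier \<Omega> \<subseteq> (\<Union>z\<in>T. ball z (r z / 2))"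
  proof (rule compactE_image[OF cp, of "frontier \<Omega>" "\<lambda>z. ball z (r z / 2)"])
    show "frontier \<Omega> \<subseteq> (\<Union>z\<in>frontier \<Omega>. ball z (r z / 2))" using r by (meson UN_I centre_in_ball half_gt_zero subsetI)
  qed auto
  define D where "D = (\<Sum>z\<in>T. C z) + 1"
  have D0: "(\<Sum>z\<in>T. C z) \<ge> 0" using T C by (intro sum_nonneg) auto
  have D: "D > 0" "(\<Sum>z\<in>T. C z) \<le> D" using D0 by (auto simp: D_def)
  have CD: "C z \<le> D" if "z \<in> T" for z
  proof -
    have "C z \<le> (\<Sum>z\<in>T. C z)" using that T C by (intro member_le_sum) auto
    then show ?thesis using D by simp
  qed
  obtain c where c: "c > 0" "mass (near_frontier \<Omega> c) < \<eta> / D"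
    using mass_near_frontier_small[of "\<eta> / D"] D \<open>\<eta> > 0\<close> by auto
  define \<delta> where "\<delta> = Min (insert (c / D) ((\<lambda>z. r z / 4) ` T))"
  show ?thesis
  proof (rule that[of \<delta>])
    show "\<delta> > 0" unfolding \<delta>_def using T r c D by (subst Min_gr_iff) auto
    fix h :: 'a assume h: "h \<noteq> 0" "norm h < \<delta>"
    have hT: "norm h < r z / 4" if "z \<in> T" for z
      using h(2) that T unfolding \<delta>_def by (subst (asm) Min_gr_iff) auto
    have hc: "D * norm h \<le> c"
    proof -
      have "norm h < c / D" using h(2) T unfolding \<delta>_def by (subst (asm) Min_gr_iff) auto
      then show ?thesis using D by (simp add: field_simps)
    qed
    let ?N = "near_frontier \<Omega> (2 * norm h) \<inter> overlap h"
    have Nb: "open ?N" using open_near_frontier[OF open_\<Omega>] open_overlap by auto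
    have cover: "indicator ?N x \<le> (\<Sum>z\<in>T. indicator (?N \<inter> ball z (r z)) x :: real)" for x
    proof (cases "x \<in> ?N")
      case True
      then obtain y where y: "y \<in> frontier \<Omega>" "dist y x < 2 * norm h" by (auto simp: near_frontier_def)
      obtain z where z: "z \<in> T" "dist z y < r z / 2" using T(3) y(1) by auto
      have "dist z x < r z" using dist_triangle[of z x y] y(2) z(2) hT[OF z(1)] by simp
      then have "indicator (?N \<inter> ball z (r z)) x = (1::real)" using True by simp
      then have "1 \<le> (\<Sum>z\<in>T. indicator (?N \<inter> ball z (r z)) x :: real)"
        using member_le_sum[OF z(1), of "\<lambda>z. indicator (?N \<inter> ball z (r z)) x :: real"] T(2) by auto
      then show ?thesis using True by simp
    qed (simp add: sum_nonneg)
    have i: "integrable lborel (\<lambda>x. U (x + h) - U x)" using integrable_shift_U integrable_U by simp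
    have iz: "integrable lborel (\<lambda>x. indicator (?N \<inter> ball z (r z)) x * \<bar>U (x + h) - U x\<bar>)" for z
      using Nb by (intro integrable_indicator_abs[OF i]) auto
    have "(LINT x|lborel. indicator ?N x * \<bar>U (x + h) - U x\<bar>) \<le>
      (LINT x|lborel. (\<Sum>z\<in>T. indicator (?N \<inter> ball z (r z)) x * \<bar>U (x + h) - U x\<bar>))"
    proof (rule integral_mono)
      show "integrable lborel (\<lambda>x. indicator ?N x * \<bar>U (x + h) - U x\<bar>)"
        using Nb by (intro integrable_indicator_abs[OF i]) auto
      show "indicator ?N x * \<bar>U (x + h) - U x\<bar> \<le> (\<Sum>z\<in>T. indicator (?N \<inter> ball z (r z)) x * \<bar>U (x + h) - U x\<bar>)" for x
        unfolding sum_distrib_right[symmetric] by (intro mult_right_mono cover) simp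
    qed (use iz in auto)
    also have "\<dots> = (\<Sum>z\<in>T. (LINT x|lborel. indicator (?N \<inter> ball z (r z)) x * \<bar>U (x + h) - U x\<bar>))"
      using iz by (intro Bochner_Integration.integral_sum)
    also have "\<dots> \<le> (\<Sum>z\<in>T. C z * norm h * mass (near_frontier \<Omega> c))"
    proof (rule sum_mono)
      fix z assume z: "z \<in> T"
      have "norm h < r z" using hT[OF z] norm_ge_zero[of h] by linarith
      then have "(LINT x|lborel. indicator (?N \<inter> ball z (r z)) x * \<bar>U (x + h) - U x\<bar>)
          \<le> C z * norm h * mass (near_frontier \<Omega> (C z * norm h))" using loc[of z h] z T h by blast
      also have "\<dots> \<le> C z * norm h * mass (near_frontier \<Omega> c)"
      proof (intro mult_left_mono mass_mono near_frontier_mono)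
        have "C z * norm h \<le> D * norm h" using CD[OF z] by (intro mult_right_mono) auto
        then show "C z * norm h \<le> c" using hc by linarith
        show "0 \<le> C z * norm h" using C z T by auto
      qed (use open_near_frontier[OF open_\<Omega>] in auto)
      finally show "(LINT x|lborel. indicator (?N \<inter> ball z (r z)) x * \<bar>U (x + h) - U x\<bar>)
        \<le> C z * norm h * mass (near_frontier \<Omega> c)" .
    qed
    also have "\<dots> = (\<Sum>z\<in>T. C z) * (norm h * mass (near_frontier \<Omega> c))" by (simp add: sum_distrib_right mult.assoc)
    also have "\<dots> \<le> D * (norm h * (\<eta> / D))"
      using D c mass_nonneg[of "near_frontier \<Omega> c"] D0 by (intro mult_mono) auto
    also have "\<dots> = \<eta> * norm h" using D by simp
    finally show "(LINT x|lborel. indicator ?N x * \<bar>U (x + h) - U x\<bar>) \<le> \<eta> * norm h" .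
  qed
qed

text \<open>The points at distance more than \<open>|h|\<close> from the frontier are covered by \<open>interior_remainder_bound\<close>, because
  a segment of length \<open>|h|\<close> starting there cannot leave \<open>\<Omega>\<close>.  The remaining points lie in the boundary
  layer.\<close>

lemma remainder_upper:
  assumes sm: "smooth_boundary \<Omega>" and cp: "compact (frontier \<Omega>)" and "\<eta> > 0"
  obtains \<delta> where "\<delta> > 0" "\<And>h. h \<noteq> 0 \<Longrightarrow> norm h < \<delta> \<Longrightarrow>
      (LINT x|lborel. indicator (overlap h) x * \<bar>remainder h x\<bar>) \<le> (LINT x|M. \<bar>\<zeta> x \<bullet> h\<bar>) + \<eta> * norm h"
proof -
  have \<eta>3: "\<eta> / 3 > 0" using assms by simp
  obtain d1 where d1: "d1 > 0" "\<And>h. h \<noteq> 0 \<Longrightarrow> norm h < d1 \<Longrightarrow>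
      (LINT x|lborel. indicator (near_frontier \<Omega> (2 * norm h) \<inter> overlap h) x * \<bar>U (x + h) - U x\<bar>) \<le> \<eta> / 3 * norm h"
    by (rule boundary_difference_small[OF sm cp \<eta>3]) blast
  obtain d2 where d2: "d2 > 0" "\<And>k. norm k < d2 \<Longrightarrow> (LINT x|lborel. norm (g (x + k) - g x)) \<le> \<eta> / 3"
    by (rule g_modulus[OF \<eta>3]) blast
  obtain c where c: "c > 0" "mass (near_frontier \<Omega> c) < \<eta> / 3"
    by (rule mass_near_frontier_small[OF \<eta>3]) blast
  show ?thesis
  proof (rule that[of "min (min d1 d2) (c / 2)"])
    show "min (min d1 d2) (c / 2) > 0" using d1 d2 c by simp
    fix h :: 'a assume h: "h \<noteq> 0" "norm h < min (min d1 d2) (c / 2)"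
    define A where "A = \<Omega> - (\<Union>y\<in>frontier \<Omega>. cball y (norm h))"
    define N where "N = near_frontier \<Omega> (2 * norm h)"
    have A: "open A" unfolding A_def
      using compact_imp_closed[OF compact_minkowski_sum_cball[OF cp, of "norm h"]] open_\<Omega> by auto
    have N: "open N" unfolding N_def by (rule open_near_frontier[OF open_\<Omega>])
    have cov: "\<Omega> \<subseteq> A \<union> N"
    proof
      fix x assume x: "x \<in> \<Omega>"
      show "x \<in> A \<union> N"
      proof (cases "x \<in> A")
        case False
        then obtain y where "y \<in> frontier \<Omega>" "dist y x \<le> norm h" using x by (auto simp: A_def)
        moreover have "norm h < 2 * norm h" using h by simp
        ultimately have "\<exists>y\<in>frontier \<Omega>. dist y x < 2 * norm h" by (meson le_less_trans)
        then show ?thesis using x by (simp add: N_def near_frontier_def)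
      qed simp
    qed
    have seg: "x + t *\<^sub>R h \<in> \<Omega>" if x: "x \<in> A" "0 \<le> t" "t \<le> 1" for x t
    proof (rule ccontr)
      assume out: "x + t *\<^sub>R h \<notin> \<Omega>"
      let ?S = "closed_segment x (x + t *\<^sub>R h)"
      have "?S \<inter> frontier \<Omega> \<noteq> {}"
        by (rule connected_Int_frontier) (use x out in \<open>auto simp: A_def\<close>)
      then obtain y where y: "y \<in> ?S" "y \<in> frontier \<Omega>" by auto
      have "dist y x \<le> dist (x + t *\<^sub>R h) x"
        using segment_bound(1)[OF y(1)] by (simp add: dist_norm norm_minus_commute)
      also have "\<dots> \<le> norm h" using x by (simp add: dist_norm mult_left_le_one_le)
      finally show False using x y by (auto simp: A_def)
    qed
    have \<omega>: "(LINT x|lborel. norm (g (x + k) - g x)) \<le> \<eta> / 3" if "norm k \<le> norm h" for k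
      using d2(2) that h by simp
    have iR: "integrable lborel (\<lambda>x. indicator A x * \<bar>remainder h x\<bar>)"
      using A by (intro integrable_indicator_abs[OF integrable_remainder]) auto
    have iU: "integrable lborel (\<lambda>x. indicator (N \<inter> overlap h) x * \<bar>U (x + h) - U x\<bar>)"
      using N open_overlap integrable_U integrable_shift_U by (intro integrable_indicator_abs) auto
    have ig: "integrable lborel (\<lambda>x. norm h * (indicator N x * norm (g x)))"
      using integrable_indicator_norm(2)[of N] N by simp
    have "(LINT x|lborel. indicator (overlap h) x * \<bar>remainder h x\<bar>) \<le>
      (LINT x|lborel. indicator A x * \<bar>remainder h x\<bar> + (indicator (N \<inter> overlap h) x * \<bar>U (x + h) - U x\<bar> + norm h * (indicator N x * norm (g x))))"
    proof (rule integral_mono)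
      show "integrable lborel (\<lambda>x. indicator (overlap h) x * \<bar>remainder h x\<bar>)"
        using open_overlap by (intro integrable_indicator_abs[OF integrable_remainder]) auto
      fix x
      have "\<bar>remainder h x\<bar> \<le> \<bar>U (x + h) - U x\<bar> + norm h * norm (g x)"
        using Cauchy_Schwarz_ineq2[of "g x" h] by (simp add: mult.commute)
      then show "indicator (overlap h) x * \<bar>remainder h x\<bar> \<le> indicator A x * \<bar>remainder h x\<bar> + (indicator (N \<inter> overlap h) x * \<bar>U (x + h) - U x\<bar> + norm h * (indicator N x * norm (g x)))"
        using cov by (auto simp: indicator_def overlap_def)
    qed (intro Bochner_Integration.integrable_add iR iU ig)
    also have "\<dots> = (LINT x|lborel. indicator A x * \<bar>remainder h x\<bar>) +
      ((LINT x|lborel. indicator (N \<inter> overlap h) x * \<bar>U (x + h) - U x\<bar>) + (LINT x|lborel. norm h * (indicator N x * norm (g x))))"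
      by (subst Bochner_Integration.integral_add[OF iR Bochner_Integration.integrable_add[OF iU ig]],
          subst Bochner_Integration.integral_add[OF iU ig]) simp
    also have "\<dots> \<le> ((LINT x|M. \<bar>\<zeta> x \<bullet> h\<bar>) + norm h * (\<eta> / 3)) + (\<eta> / 3 * norm h + norm h * (\<eta> / 3))"
    proof (intro add_mono)
      show "(LINT x|lborel. indicator A x * \<bar>remainder h x\<bar>) \<le> (LINT x|M. \<bar>\<zeta> x \<bullet> h\<bar>) + norm h * (\<eta> / 3)"
        by (rule interior_remainder_bound[OF A seg \<omega>])
      show "(LINT x|lborel. indicator (N \<inter> overlap h) x * \<bar>U (x + h) - U x\<bar>) \<le> \<eta> / 3 * norm h"
        unfolding N_def using h by (intro d1(2)) auto
      have "(LINT x|lborel. indicator N x * norm (g x)) \<le> mass N" unfolding mass_def by simp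
      also have "\<dots> \<le> mass (near_frontier \<Omega> c)"
        unfolding N_def using h open_near_frontier[OF open_\<Omega>] by (intro mass_mono near_frontier_mono) auto
      also have "\<dots> \<le> \<eta> / 3" using c by simp
      finally show "(LINT x|lborel. norm h * (indicator N x * norm (g x))) \<le> norm h * (\<eta> / 3)"
        unfolding integral_mult_right_zero by (intro mult_left_mono) auto
    qed
    also have "\<dots> = (LINT x|M. \<bar>\<zeta> x \<bullet> h\<bar>) + \<eta> * norm h" by (simp add: algebra_simps)
    finally show "(LINT x|lborel. indicator (overlap h) x * \<bar>remainder h x\<bar>) \<le> (LINT x|M. \<bar>\<zeta> x \<bullet> h\<bar>) + \<eta> * norm h" .
  qed
qed

end

section \<open>Hausdorff measure of the unit sphere\<close>

definition hausdorff_weight :: "nat \<Rightarrow> 'a::metric_space set \<Rightarrow> ennreal" where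
  "hausdorff_weight k C = (if C = {} then 0 else ennreal (unit_ball_vol (real k) * (diameter C / 2) ^ k))"

definition hausdorff_covers :: "real \<Rightarrow> 'a::metric_space set \<Rightarrow> (nat \<Rightarrow> 'a set) set" where
  "hausdorff_covers \<delta> A = {C. A \<subseteq> (\<Union>i. C i) \<and> (\<forall>i. bounded (C i) \<and> diameter (C i) \<le> \<delta>)}"

text \<open>The set function from which the Hausdorff measure is built, on all sets.  The measure takes these values only
  once the set function is known to be countably additive on the Borel sets; otherwise
  \<^const>\<open>measure_of\<close> yields \<open>0\<close>.\<close>

definition hausdorff_outer :: "nat \<Rightarrow> 'a::metric_space set \<Rightarrow> ennreal" where
  "hausdorff_outer k A = (SUP \<delta>\<in>{0<..}. hausdorff_premeasure k \<delta> A)"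

lemma hausdorff_premeasure_alt:
  "hausdorff_premeasure k \<delta> A = (INF C\<in>hausdorff_covers \<delta> A. \<Sum>i. hausdorff_weight k (C i))"
  by (simp add: hausdorff_premeasure_def hausdorff_covers_def hausdorff_weight_def)

lemma hausdorff_premeasure_empty: "\<delta> > 0 \<Longrightarrow> hausdorff_premeasure k \<delta> ({} :: 'a::metric_space set) = 0"
proof -
  assume "\<delta> > 0"
  then have "(\<lambda>_. {}) \<in> hausdorff_covers \<delta> ({} :: 'a set)" by (simp add: hausdorff_covers_def)
  then have "hausdorff_premeasure k \<delta> ({} :: 'a set) \<le> (\<Sum>i. hausdorff_weight k ({} :: 'a set))"
    unfolding hausdorff_premeasure_alt
    using INF_lower[of "\<lambda>_. {}" "hausdorff_covers \<delta> ({} :: 'a set)" "\<lambda>C. \<Sum>i. hausdorff_weight k (C i)"] by simp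
  then show ?thesis by (simp add: hausdorff_weight_def)
qed

lemma hausdorff_premeasure_mono: "A \<subseteq> B \<Longrightarrow> hausdorff_premeasure k \<delta> A \<le> hausdorff_premeasure k \<delta> B"
  unfolding hausdorff_premeasure_alt by (rule INF_superset_mono) (auto simp: hausdorff_covers_def)

lemma hausdorff_premeasure_antimono: "\<delta> \<le> \<delta>' \<Longrightarrow> hausdorff_premeasure k \<delta>' A \<le> hausdorff_premeasure k \<delta> A"
  unfolding hausdorff_premeasure_alt by (rule INF_superset_mono) (auto simp: hausdorff_covers_def intro: order_trans)

lemma hausdorff_premeasure_le_outer: "\<delta> > 0 \<Longrightarrow> hausdorff_premeasure k \<delta> A \<le> hausdorff_outer k A"
  unfolding hausdorff_outer_def by (rule SUP_upper) simp

lemma hausdorff_outer_mono: "A \<subseteq> B \<Longrightarrow> hausdorff_outer k A \<le> hausdorff_outer k B"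
  unfolding hausdorff_outer_def by (rule SUP_mono) (auto intro: hausdorff_premeasure_mono)

lemma hausdorff_outer_empty: "hausdorff_outer k {} = 0"
  unfolding hausdorff_outer_def by (auto simp: hausdorff_premeasure_empty intro!: SUP_eqI)

lemma hausdorff_premeasure_countably_subadditive:
  "hausdorff_premeasure k \<delta> (\<Union>n. A n) \<le> (\<Sum>n. hausdorff_premeasure k \<delta> (A n))"
proof (cases "(\<Sum>n. hausdorff_premeasure k \<delta> (A n)) < top")
  case True
  show ?thesis
  proof (rule ennreal_le_epsilon)
    fix e :: real assume e: "e > 0"
    have fin: "hausdorff_premeasure k \<delta> (A n) \<noteq> top" for n
      using True by (auto simp: less_top dest: ennreal_suminf_lessD)
    have "\<exists>C\<in>hausdorff_covers \<delta> (A n). (\<Sum>i. hausdorff_weight k (C i)) < hausdorff_premeasure k \<delta> (A n) + ennreal (e * (1/2)^Suc n)" for n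
    proof (rule INF_approx_ennreal)
      show "hausdorff_premeasure k \<delta> (A n) = (INF C\<in>hausdorff_covers \<delta> (A n). \<Sum>i. hausdorff_weight k (C i))"
        by (rule hausdorff_premeasure_alt)
    qed (use e fin in auto)
    then obtain C where C: "\<And>n. C n \<in> hausdorff_covers \<delta> (A n)"
      "\<And>n. (\<Sum>i. hausdorff_weight k (C n i)) < hausdorff_premeasure k \<delta> (A n) + ennreal (e * (1/2)^Suc n)" by metis
    define D where "D j = case_prod C (prod_decode j)" for j
    have "D \<in> hausdorff_covers \<delta> (\<Union>n. A n)"
      unfolding hausdorff_covers_def
    proof (intro CollectI conjI allI)
      show "(\<Union>n. A n) \<subseteq> (\<Union>i. D i)"
      proof
        fix x assume "x \<in> (\<Union>n. A n)"
        then obtain n i where "x \<in> C n i" using C(1) by (fastforce simp: hausdorff_covers_def)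
        then show "x \<in> (\<Union>i. D i)" by (auto simp: D_def intro!: exI[of _ "prod_encode (n, i)"])
      qed
      show "bounded (D i)" "diameter (D i) \<le> \<delta>" for i
        using C(1) by (auto simp: D_def hausdorff_covers_def split: prod.split)
    qed
    then have "hausdorff_premeasure k \<delta> (\<Union>n. A n) \<le> (\<Sum>j. hausdorff_weight k (D j))"
      unfolding hausdorff_premeasure_alt by (rule INF_lower)
    also have "\<dots> = (\<Sum>j. case_prod (\<lambda>n i. hausdorff_weight k (C n i)) (prod_decode j))"
      by (simp add: D_def case_prod_beta)
    also have "\<dots> = (\<Sum>n. \<Sum>i. hausdorff_weight k (C n i))"
      by (rule suminf_ennreal_2dimen) simp
    also have "\<dots> \<le> (\<Sum>n. hausdorff_premeasure k \<delta> (A n) + ennreal (e * (1/2)^Suc n))"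
      using C(2) by (intro suminf_le) (auto intro: less_imp_le)
    also have "\<dots> = (\<Sum>n. hausdorff_premeasure k \<delta> (A n)) + (\<Sum>n. ennreal (e * (1/2)^Suc n))"
      by (rule suminf_add[symmetric]) auto
    also have "(\<Sum>n. ennreal (e * (1/2)^Suc n)) = ennreal e"
      using sums_mult[OF power_half_series, of e] e by (intro suminf_ennreal_eq) auto
    finally show "hausdorff_premeasure k \<delta> (\<Union>n. A n) \<le> (\<Sum>n. hausdorff_premeasure k \<delta> (A n)) + ennreal e" .
  qed
next
  case False
  then show ?thesis using top.not_eq_extremum top_greatest by metis
qed

lemma hausdorff_outer_countably_subadditive: "hausdorff_outer k (\<Union>n. A n) \<le> (\<Sum>n. hausdorff_outer k (A n))"
  unfolding hausdorff_outer_def[of k "\<Union>n. A n"]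
proof (rule SUP_least)
  fix \<delta> :: real assume "\<delta> \<in> {0<..}"
  then show "hausdorff_premeasure k \<delta> (\<Union>n. A n) \<le> (\<Sum>n. hausdorff_outer k (A n))"
    by (intro order_trans[OF hausdorff_premeasure_countably_subadditive] suminf_le hausdorff_premeasure_le_outer) auto
qed

lemma outer_measure_space_hausdorff: "outer_measure_space (Pow UNIV) (hausdorff_outer k)"
  by (auto simp: outer_measure_space_def positive_def increasing_def countably_subadditive_def
      hausdorff_outer_empty hausdorff_outer_mono hausdorff_outer_countably_subadditive)

lemma hausdorff_outer_Un: "hausdorff_outer k (A \<union> B) \<le> hausdorff_outer k A + hausdorff_outer k B"
proof -
  have "hausdorff_outer k (\<Union>n. binaryset A B n) \<le> (\<Sum>n. hausdorff_outer k (binaryset A B n))"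
    by (rule hausdorff_outer_countably_subadditive)
  also have "\<dots> = hausdorff_outer k A + hausdorff_outer k B"
    by (rule suminf_binaryset_eq) (rule hausdorff_outer_empty)
  finally show ?thesis by (simp add: UN_binaryset_eq)
qed

text \<open>A set of diameter less than the distance between \<open>A\<close> and \<open>B\<close> meets at most one of them, so a fine cover
  of the union splits into covers of the two sets.\<close>

lemma hausdorff_outer_separated:
  assumes s: "s > 0" and sep: "\<And>a b. a \<in> A \<Longrightarrow> b \<in> B \<Longrightarrow> dist a b \<ge> s"
  shows "hausdorff_outer k A + hausdorff_outer k B \<le> hausdorff_outer k (A \<union> B)"
proof -
  have small: "hausdorff_premeasure k \<delta> A + hausdorff_premeasure k \<delta> B \<le> hausdorff_premeasure k \<delta> (A \<union> B)"
    if "\<delta> > 0" "\<delta> < s" for \<delta>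
    unfolding hausdorff_premeasure_alt[of k \<delta> "A \<union> B"]
  proof (rule INF_greatest)
    fix C assume C: "C \<in> hausdorff_covers \<delta> (A \<union> B)"
    define CA where "CA i = (if C i \<inter> A \<noteq> {} then C i else {})" for i
    define CB where "CB i = (if C i \<inter> B \<noteq> {} then C i else {})" for i
    have "CA \<in> hausdorff_covers \<delta> A" "CB \<in> hausdorff_covers \<delta> B"
      using C that by (force simp: hausdorff_covers_def CA_def CB_def)+
    then have "hausdorff_premeasure k \<delta> A \<le> (\<Sum>i. hausdorff_weight k (CA i))"
      "hausdorff_premeasure k \<delta> B \<le> (\<Sum>i. hausdorff_weight k (CB i))"
      unfolding hausdorff_premeasure_alt by (auto intro: INF_lower)
    then have "hausdorff_premeasure k \<delta> A + hausdorff_premeasure k \<delta> B \<le>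
      (\<Sum>i. hausdorff_weight k (CA i)) + (\<Sum>i. hausdorff_weight k (CB i))" by (rule add_mono)
    also have "\<dots> = (\<Sum>i. hausdorff_weight k (CA i) + hausdorff_weight k (CB i))"
      by (rule suminf_add) auto
    also have "\<dots> \<le> (\<Sum>i. hausdorff_weight k (C i))"
    proof (intro suminf_le)
      fix i
      have "CA i = {} \<or> CB i = {}"
      proof (rule ccontr)
        assume "\<not> ?thesis"
        then obtain a b where ab: "a \<in> C i" "a \<in> A" "b \<in> C i" "b \<in> B" by (auto simp: CA_def CB_def split: if_splits)
        have "dist a b \<le> diameter (C i)" using C ab by (intro diameter_bounded_bound) (auto simp: hausdorff_covers_def)
        also have "\<dots> \<le> \<delta>" using C by (auto simp: hausdorff_covers_def)
        finally show False using sep[of a b] ab that by simp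
      qed
      show "hausdorff_weight k (CA i) + hausdorff_weight k (CB i) \<le> hausdorff_weight k (C i)"
      proof -
        have "hausdorff_weight k (CA i) \<le> hausdorff_weight k (C i)" "hausdorff_weight k (CB i) \<le> hausdorff_weight k (C i)"
          by (simp_all add: CA_def CB_def hausdorff_weight_def)
        moreover have "hausdorff_weight k (CA i) = 0 \<or> hausdorff_weight k (CB i) = 0"
          using \<open>CA i = {} \<or> CB i = {}\<close> by (auto simp: hausdorff_weight_def)
        ultimately show ?thesis by auto
      qed
    qed auto
    finally show "hausdorff_premeasure k \<delta> A + hausdorff_premeasure k \<delta> B \<le> (\<Sum>i. hausdorff_weight k (C i))" .
  qed
  have "hausdorff_outer k A + hausdorff_outer k B = (SUP \<delta>\<in>{0<..}. hausdorff_premeasure k \<delta> A + hausdorff_premeasure k \<delta> B)"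
    unfolding hausdorff_outer_def
  proof (rule SUP_add_directed_ennreal[symmetric])
    fix i j :: real assume "i \<in> {0<..}" "j \<in> {0<..}"
    then show "\<exists>l\<in>{0<..}. hausdorff_premeasure k i A + hausdorff_premeasure k j B \<le> hausdorff_premeasure k l A + hausdorff_premeasure k l B"
      by (intro bexI[of _ "min i j"] add_mono hausdorff_premeasure_antimono) auto
  qed
  also have "\<dots> \<le> hausdorff_outer k (A \<union> B)"
  proof (rule SUP_least)
    fix \<delta> :: real assume "\<delta> \<in> {0<..}"
    then have m: "min \<delta> (s / 2) > 0" "min \<delta> (s / 2) < s" using s by auto
    have "hausdorff_premeasure k \<delta> A + hausdorff_premeasure k \<delta> B \<le>
      hausdorff_premeasure k (min \<delta> (s / 2)) A + hausdorff_premeasure k (min \<delta> (s / 2)) B"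
      by (intro add_mono hausdorff_premeasure_antimono) auto
    also have "\<dots> \<le> hausdorff_premeasure k (min \<delta> (s / 2)) (A \<union> B)" by (rule small[OF m])
    also have "\<dots> \<le> hausdorff_outer k (A \<union> B)" by (rule hausdorff_premeasure_le_outer[OF m(1)])
    finally show "hausdorff_premeasure k \<delta> A + hausdorff_premeasure k \<delta> B \<le> hausdorff_outer k (A \<union> B)" .
  qed
  finally show ?thesis .
qed

text \<open>The Caratheodory criterion: slice the part of \<open>A\<close> outside the closed set \<open>F\<close> into shells according
  to the distance from \<open>F\<close>.  Shells of equal parity are separated, so their measures add up to at most
  that of \<open>A\<close>, and the total measure of the shells close to \<open>F\<close> tends to \<open>0\<close>.\<close>

lemma hausdorff_outer_closed_split:
  fixes F :: "'a::metric_space set"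
  assumes F: "closed F" "F \<noteq> {}"
  shows "hausdorff_outer k (A \<inter> F) + hausdorff_outer k (A - F) \<le> hausdorff_outer k A"
proof (cases "hausdorff_outer k A = top")
  case False
  define E where "E n = {x \<in> A. infdist x F \<ge> inverse (real (Suc n))}" for n
  define B where "B n = {x \<in> A. inverse (real (Suc (Suc n))) \<le> infdist x F \<and> infdist x F < inverse (real (Suc n))}" for n
  have far: "dist x y \<ge> a - b" if "infdist x F \<ge> a" "infdist y F \<le> b" for x y a b
    using infdist_triangle[of x F y] that by simp
  have inv: "inverse (real (Suc n)) < inverse (real (Suc m))" if "m < n" for m n using that by simp
  have EA: "hausdorff_outer k (A \<inter> F) + hausdorff_outer k (E n) \<le> hausdorff_outer k A" for n
  proof -
    have "hausdorff_outer k (E n) + hausdorff_outer k (A \<inter> F) \<le> hausdorff_outer k (E n \<union> A \<inter> F)"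
      by (rule hausdorff_outer_separated[of "inverse (real (Suc n))"]) (use far[where b = 0] in \<open>force simp: E_def\<close>)+
    also have "\<dots> \<le> hausdorff_outer k A" by (rule hausdorff_outer_mono) (auto simp: E_def)
    finally show ?thesis by (simp add: add.commute)
  qed
  have shells: "(\<Sum>i<n. hausdorff_outer k (B (2 * i + j))) \<le> hausdorff_outer k (\<Union>i<n. B (2 * i + j))" for n j
  proof (induction n)
    case 0
    then show ?case by simp
  next
    case (Suc n)
    have "(\<Sum>i<Suc n. hausdorff_outer k (B (2 * i + j))) \<le> hausdorff_outer k (\<Union>i<n. B (2 * i + j)) + hausdorff_outer k (B (2 * n + j))"
      using Suc by (simp add: add_mono)
    also have "\<dots> \<le> hausdorff_outer k ((\<Union>i<n. B (2 * i + j)) \<union> B (2 * n + j))"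
    proof (rule hausdorff_outer_separated)
      show "inverse (real (Suc (2 * n + j) - 1)) * 0 + (if n = 0 then 1 else inverse (real (2 * n + j)) - inverse (real (Suc (2 * n + j)))) > 0"
        by (auto intro!: less_imp_inverse_less)
      fix a b assume a: "a \<in> (\<Union>i<n. B (2 * i + j))" and b: "b \<in> B (2 * n + j)"
      then obtain i where i: "i < n" "a \<in> B (2 * i + j)" by auto
      have "inverse (real (2 * n + j)) \<le> inverse (real (Suc (Suc (2 * i + j))))"
        using i by (intro le_imp_inverse_le) auto
      also have "\<dots> \<le> infdist a F" using i by (simp add: B_def)
      finally show "inverse (real (Suc (2 * n + j) - 1)) * 0 + (if n = 0 then 1 else inverse (real (2 * n + j)) - inverse (real (Suc (2 * n + j)))) \<le> dist a b"
        using far[of "inverse (real (2 * n + j))" a b "inverse (real (Suc (2 * n + j)))"] b i by (auto simp: B_def)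
    qed
    also have "(\<Union>i<n. B (2 * i + j)) \<union> B (2 * n + j) = (\<Union>i<Suc n. B (2 * i + j))"
      by (auto simp: less_Suc_eq)
    finally show ?case .
  qed
  have "(\<Sum>i<n. hausdorff_outer k (B i)) \<le> 2 * hausdorff_outer k A" for n
  proof -
    have "(\<Sum>i<n. hausdorff_outer k (B i)) \<le> (\<Sum>i<2 * n. hausdorff_outer k (B i))"
      by (rule sum_mono2) auto
    also have "\<dots> = (\<Sum>i<n. hausdorff_outer k (B (2 * i + 0))) + (\<Sum>i<n. hausdorff_outer k (B (2 * i + 1)))"
      by (induction n) (simp_all add: add_ac)
    also have "\<dots> \<le> hausdorff_outer k A + hausdorff_outer k A"
      by (intro add_mono order_trans[OF shells] hausdorff_outer_mono) (auto simp: B_def)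
    finally show ?thesis by (simp add: mult_2)
  qed
  then have "(\<Sum>i. hausdorff_outer k (B i)) \<le> 2 * hausdorff_outer k A"
    by (rule suminf_le_const[OF summableI])
  then have fin: "(\<Sum>i. hausdorff_outer k (B i)) \<noteq> top"
    using False by (auto simp: top_unique ennreal_mult_eq_top_iff)
  have tail: "(\<lambda>n. \<Sum>i. hausdorff_outer k (B (i + n))) \<longlonglongrightarrow> 0"
  proof -
    have finB: "hausdorff_outer k (B i) \<noteq> top" for i
      using fin by (auto simp: less_top dest: ennreal_suminf_lessD)
    define c where "c i = enn2real (hausdorff_outer k (B i))" for i
    have c: "hausdorff_outer k (B i) = ennreal (c i)" "c i \<ge> 0" for i using finB[of i] by (auto simp: c_def less_top)
    have "(\<Sum>i. ennreal (c i)) \<noteq> top" using fin unfolding c(1) .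
    then have sc: "summable c" using summable_suminf_not_top[of c] c(2) by blast
    have "(\<lambda>n. \<Sum>i. c (i + n)) \<longlonglongrightarrow> 0" using suminf_exist_split2[OF sc] .
    then have "(\<lambda>n. ennreal (\<Sum>i. c (i + n))) \<longlonglongrightarrow> ennreal 0" by (rule tendsto_ennrealI)
    moreover have "(\<Sum>i. hausdorff_outer k (B (i + n))) = ennreal (\<Sum>i. c (i + n))" for n
      unfolding c(1) using sc c(2) by (intro suminf_ennreal2) (auto simp: summable_iff_shift)
    ultimately show ?thesis by simp
  qed
  have "hausdorff_outer k (A \<inter> F) + hausdorff_outer k (A - F) \<le> hausdorff_outer k A + (\<Sum>i. hausdorff_outer k (B (i + n)))" for n
  proof -
    have "A - F \<subseteq> E n \<union> (\<Union>i. B (i + n))"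
    proof
      fix x assume x: "x \<in> A - F"
      then have pos: "infdist x F > 0" using F by (simp add: infdist_pos_not_in_closed)
      show "x \<in> E n \<union> (\<Union>i. B (i + n))"
      proof (cases "infdist x F \<ge> inverse (real (Suc n))")
        case True
        then show ?thesis using x by (simp add: E_def)
      next
        case False
        define m where "m = (LEAST m. inverse (real (Suc m)) \<le> infdist x F)"
        obtain m0 where "inverse (real (Suc m0)) \<le> infdist x F" using reals_Archimedean[OF pos] less_imp_le by blast
        then have m: "inverse (real (Suc m)) \<le> infdist x F" unfolding m_def by (rule LeastI)
        have mn: "m > n"
        proof (rule ccontr)
          assume "\<not> m > n"
          then have "inverse (real (Suc n)) \<le> inverse (real (Suc m))" by simp
          then show False using m False by linarith
        qed
        then obtain l where l: "m = Suc l" by (cases m) auto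
        have "\<not> inverse (real (Suc l)) \<le> infdist x F"
          using not_less_Least[of l "\<lambda>m. inverse (real (Suc m)) \<le> infdist x F"] l unfolding m_def[symmetric] by simp
        then have "x \<in> B l" using x m by (simp add: B_def l)
        then show ?thesis using mn l by (auto intro!: exI[of _ "l - n"])
      qed
    qed
    then have "hausdorff_outer k (A - F) \<le> hausdorff_outer k (E n) + hausdorff_outer k (\<Union>i. B (i + n))"
      using hausdorff_outer_mono hausdorff_outer_Un order_trans by blast
    also have "\<dots> \<le> hausdorff_outer k (E n) + (\<Sum>i. hausdorff_outer k (B (i + n)))"
      by (intro add_left_mono hausdorff_outer_countably_subadditive)
    finally have "hausdorff_outer k (A \<inter> F) + hausdorff_outer k (A - F) \<le>
      (hausdorff_outer k (A \<inter> F) + hausdorff_outer k (E n)) + (\<Sum>i. hausdorff_outer k (B (i + n)))"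
      by (simp add: add.assoc add_left_mono)
    also have "\<dots> \<le> hausdorff_outer k A + (\<Sum>i. hausdorff_outer k (B (i + n)))"
      by (intro add_right_mono EA)
    finally show ?thesis .
  qed
  moreover have "(\<lambda>n. hausdorff_outer k A + (\<Sum>i. hausdorff_outer k (B (i + n)))) \<longlonglongrightarrow> hausdorff_outer k A + 0"
    by (intro tendsto_add tendsto_const tail)
  ultimately show ?thesis
    using tendsto_lowerbound[of "\<lambda>n. hausdorff_outer k A + (\<Sum>i. hausdorff_outer k (B (i + n)))" "hausdorff_outer k A + 0" sequentially]
    by simp
qed simp

lemma emeasure_hausdorff_measure:
  fixes A :: "'a::metric_space set"
  assumes "A \<in> sets borel"
  shows "emeasure (hausdorff_measure k) A = hausdorff_outer k A"
proof -
  interpret P: sigma_algebra UNIV "Pow (UNIV :: 'a set)" by (rule sigma_algebra_Pow)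
  define L where "L = lambda_system UNIV (Pow (UNIV :: 'a set)) (hausdorff_outer k)"
  have ms: "measure_space UNIV L (hausdorff_outer k)"
    unfolding L_def by (rule P.caratheodory_lemma[OF outer_measure_space_hausdorff])
  interpret L: sigma_algebra UNIV L using ms by (simp add: measure_space_def)
  have closedL: "F \<in> L" if F: "closed F" for F
  proof -
    have "hausdorff_outer k (A \<inter> F) + hausdorff_outer k (A - F) = hausdorff_outer k A" for A
    proof (cases "F = {}")
      case False
      have "hausdorff_outer k A \<le> hausdorff_outer k (A \<inter> F) + hausdorff_outer k (A - F)"
        using hausdorff_outer_Un[of k "A \<inter> F" "A - F"] by (simp add: Int_Diff_Un)
      then show ?thesis using hausdorff_outer_closed_split[OF F False] by (intro antisym)
    qed (simp add: hausdorff_outer_empty)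
    then show ?thesis unfolding L_def P.lambda_system_eq by auto
  qed
  have bL: "sets borel \<subseteq> L"
    unfolding borel_eq_closed using closedL L.sigma_sets_subset[of "Collect closed"] by auto
  have sa: "sigma_algebra UNIV (sets (borel :: 'a measure))"
    using sets.sigma_algebra_axioms[of "borel :: 'a measure"] by simp
  have pos: "positive (sets (borel :: 'a measure)) (hausdorff_outer k)"
    by (simp add: positive_def hausdorff_outer_empty)
  have ca: "countably_additive (sets (borel :: 'a measure)) (hausdorff_outer k)"
    unfolding countably_additive_def
  proof (intro allI impI)
    fix A :: "nat \<Rightarrow> 'a set"
    assume A: "range A \<subseteq> sets borel" "disjoint_family A" "(\<Union>i. A i) \<in> sets borel"
    then have "range A \<subseteq> L" "(\<Union>i. A i) \<in> L" using bL by auto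
    then show "(\<Sum>i. hausdorff_outer k (A i)) = hausdorff_outer k (\<Union>i. A i)"
      using ms A(2) unfolding measure_space_def countably_additive_def by blast
  qed
  show ?thesis
    using emeasure_measure_of_sigma[OF sa pos ca assms]
    unfolding hausdorff_measure_def hausdorff_outer_def[abs_def] .
qed

lemma sets_hausdorff_measure [simp, measurable_cong]: "sets (hausdorff_measure k :: 'a::metric_space measure) = sets borel"
  using sets.sigma_sets_eq[of "borel :: 'a measure"] by (simp add: hausdorff_measure_def)

lemma space_hausdorff_measure [simp]: "space (hausdorff_measure k :: 'a::metric_space measure) = UNIV"
  by (simp add: hausdorff_measure_def space_measure_of_conv)

lemma diameter_isometric_image:
  assumes "\<And>x y. dist (T x) (T y) = dist x y"
  shows "diameter (T ` S) = diameter S"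
proof -
  have "(\<lambda>(x, y). dist x y) ` (T ` S \<times> T ` S) = (\<lambda>(x, y). dist x y) ` (S \<times> S)"
    using assms by (force simp: image_iff)
  then show ?thesis by (simp add: diameter_def)
qed

lemma hausdorff_outer_isometric_image_le:
  assumes T: "\<And>x y. dist (T x) (T y) = dist x y"
  shows "hausdorff_outer k (T ` A) \<le> hausdorff_outer k A"
  unfolding hausdorff_outer_def
proof (rule SUP_mono, rule bexI)
  fix \<delta> :: real assume "\<delta> \<in> {0<..}"
  show "hausdorff_premeasure k \<delta> (T ` A) \<le> hausdorff_premeasure k \<delta> A"
    unfolding hausdorff_premeasure_alt
  proof (rule INF_mono)
    fix C assume C: "C \<in> hausdorff_covers \<delta> A"
    have bd: "bounded (T ` S)" if "bounded S" for S
      using that T unfolding bounded_def by (metis (no_types, lifting) imageE)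
    have w: "hausdorff_weight k (T ` S) = hausdorff_weight k S" for S
      by (cases "S = {}") (simp_all add: hausdorff_weight_def diameter_isometric_image[OF T])
    have "(\<lambda>i. T ` C i) \<in> hausdorff_covers \<delta> (T ` A)"
      using C by (auto simp: hausdorff_covers_def diameter_isometric_image[OF T] intro!: bd) blast
    then show "\<exists>D\<in>hausdorff_covers \<delta> (T ` A). (\<Sum>i. hausdorff_weight k (D i)) \<le> (\<Sum>i. hausdorff_weight k (C i))"
      by (rule bexI[rotated]) (simp add: w)
  qed
qed

lemma power_diff_le:
  fixes a b :: real
  assumes "0 \<le> b" "b \<le> a"
  shows "a ^ n - b ^ n \<le> real n * (a - b) * a ^ (n - 1)"
proof (induction n)
  case (Suc n)
  have "a ^ Suc n - b ^ Suc n = a * (a ^ n - b ^ n) + (a - b) * b ^ n" by (simp add: algebra_simps)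
  also have "\<dots> \<le> a * (real n * (a - b) * a ^ (n - 1)) + (a - b) * a ^ n"
    using Suc assms by (intro add_mono mult_left_mono power_mono) auto
  also have "\<dots> = real (Suc n) * (a - b) * a ^ (Suc n - 1)"
    by (cases n) (auto simp: algebra_simps)
  finally show ?case .
qed simp

lemma emeasure_lborel_ball_less_top: "emeasure lborel (ball (c::'a::euclidean_space) r) < top"
  using emeasure_lborel_ball_finite[of c r] by simp

text \<open>The balls of radius \<open>\<delta> / 4\<close> about the points are disjoint and lie in a spherical shell of thickness
  \<open>\<delta> / 2\<close>, whose volume is of order \<open>\<delta>\<close>.\<close>

lemma sphere_separated_card_bound:
  fixes T :: "'a::euclidean_space set"
  assumes T: "finite T" "T \<subseteq> sphere 0 1" "\<And>x y. x \<in> T \<Longrightarrow> y \<in> T \<Longrightarrow> x \<noteq> y \<Longrightarrow> dist x y \<ge> \<delta> / 2"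
    and \<delta>: "0 < \<delta>" "\<delta> \<le> 1"
  shows "real (card T) * \<delta> ^ (DIM('a) - 1) \<le> 8 ^ DIM('a) * real DIM('a)"
proof -
  let ?N = "DIM('a)"
  define V where "V = unit_ball_vol (real ?N)"
  have V: "V > 0" unfolding V_def by simp
  have vol: "measure lborel (ball (c::'a) r) = V * r ^ ?N" if "r \<ge> 0" for c r
    using content_ball[OF that, of c] by (simp add: V_def)
  have dj: "disjoint_family_on (\<lambda>t. ball t (\<delta> / 4)) T"
    unfolding disjoint_family_on_def
  proof (intro ballI impI)
    fix x y assume "x \<in> T" "y \<in> T" "x \<noteq> y"
    then have "dist x y \<ge> \<delta> / 2" by (rule T)
    then show "ball x (\<delta> / 4) \<inter> ball y (\<delta> / 4) = {}"
      using dist_triangle_half_r[of _ x \<delta> y] by (intro disjoint_ballI) simp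
  qed
  have "real (card T) * (V * (\<delta> / 4) ^ ?N) = (\<Sum>t\<in>T. measure lborel (ball t (\<delta> / 4)))"
    using \<delta> by (simp add: vol)
  also have "\<dots> = measure lborel (\<Union>t\<in>T. ball t (\<delta> / 4))"
    using dj T(1)
    by (intro measure_finite_Union[symmetric]) (auto simp: emeasure_lborel_ball_less_top[THEN less_imp_neq])
  also have "\<dots> \<le> measure lborel (ball (0::'a) (1 + \<delta> / 4) - ball 0 (1 - \<delta> / 4))"
  proof (rule measure_mono_fmeasurable)
    show "(\<Union>t\<in>T. ball t (\<delta> / 4)) \<subseteq> ball 0 (1 + \<delta> / 4) - ball 0 (1 - \<delta> / 4)"
    proof
      fix x assume "x \<in> (\<Union>t\<in>T. ball t (\<delta> / 4))"
      then obtain t where t: "t \<in> T" "dist t x < \<delta> / 4" by auto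
      have "norm t = 1" using t T by auto
      moreover have "\<bar>norm x - norm t\<bar> \<le> dist t x" by (metis dist_norm norm_minus_commute norm_triangle_ineq3)
      ultimately show "x \<in> ball 0 (1 + \<delta> / 4) - ball 0 (1 - \<delta> / 4)" using t by auto
    qed
    show "ball (0::'a) (1 + \<delta> / 4) - ball 0 (1 - \<delta> / 4) \<in> fmeasurable lborel"
      by (intro fmeasurable.Diff fmeasurableI) (auto simp: emeasure_lborel_ball_less_top)
  qed (auto intro!: borel_open open_UN)
  also have "\<dots> = V * (1 + \<delta> / 4) ^ ?N - V * (1 - \<delta> / 4) ^ ?N"
    using \<delta> by (subst measure_Diff) (auto simp: vol emeasure_lborel_ball_less_top[THEN less_imp_neq] subset_ball)
  also have "\<dots> = V * ((1 + \<delta> / 4) ^ ?N - (1 - \<delta> / 4) ^ ?N)" by (rule right_diff_distrib[symmetric])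
  also have "\<dots> \<le> V * (real ?N * ((1 + \<delta> / 4) - (1 - \<delta> / 4)) * (1 + \<delta> / 4) ^ (?N - 1))"
    using \<delta> V by (intro mult_left_mono power_diff_le) auto
  also have "\<dots> \<le> V * (real ?N * (\<delta> / 2) * 2 ^ (?N - 1))"
    using \<delta> V by (intro mult_left_mono mult_mono power_mono) auto
  finally have "real (card T) * (\<delta> / 4) ^ ?N \<le> real ?N * (\<delta> / 2) * 2 ^ (?N - 1)"
    using V by (simp add: mult.left_commute[of _ V])
  then have "4 ^ ?N * (real (card T) * (\<delta> / 4) ^ ?N) \<le> 4 ^ ?N * (real ?N * (\<delta> / 2) * 2 ^ (?N - 1))"
    by (intro mult_left_mono) auto
  then have "real (card T) * \<delta> ^ ?N \<le> \<delta> * (4 ^ ?N * real ?N * 2 ^ (?N - 1) / 2)"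
    by (simp add: power_divide mult_ac)
  moreover have "\<delta> ^ ?N = \<delta> * \<delta> ^ (?N - 1)"
    using DIM_positive[where 'a = 'a] by (metis Suc_diff_1 power_Suc)
  ultimately have "real (card T) * \<delta> ^ (?N - 1) \<le> 4 ^ ?N * real ?N * 2 ^ (?N - 1) / 2"
    using \<delta> by (simp add: mult.left_commute[of _ \<delta>])
  also have "\<dots> \<le> 4 ^ ?N * real ?N * 2 ^ ?N"
  proof -
    have "(2::real) ^ (?N - 1) / 2 \<le> 2 ^ ?N"
    proof -
      have "(2::real) ^ (?N - 1) \<le> 2 ^ ?N" by (rule power_increasing) auto
      moreover have "(2::real) ^ (?N - 1) \<ge> 0" by simp
      ultimately show ?thesis by linarith
    qed
    then have "4 ^ ?N * real ?N * (2 ^ (?N - 1) / 2) \<le> 4 ^ ?N * real ?N * 2 ^ ?N" by (intro mult_left_mono) auto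
    then show ?thesis by simp
  qed
  also have "\<dots> = 8 ^ ?N * real ?N" by (simp flip: power_mult_distrib)
  finally show ?thesis .
qed

text \<open>The balls of radius \<open>\<delta> / 2\<close> about a maximal separated subset cover the sphere, and by the bound on its
  cardinality their total weight is bounded independently of \<open>\<delta>\<close>.\<close>

lemma hausdorff_outer_sphere_finite: "hausdorff_outer (DIM('a) - 1) (sphere (0::'a::euclidean_space) 1) < top"
proof -
  let ?N = "DIM('a)"
  define K where "K = unit_ball_vol (real (?N - 1)) * (8 ^ ?N * real ?N)"
  have pre: "hausdorff_premeasure (?N - 1) \<delta> (sphere (0::'a) 1) \<le> ennreal K" if \<delta>: "0 < \<delta>" "\<delta> \<le> 1" for \<delta>
  proof -
    define P where "P T \<longleftrightarrow> finite T \<and> T \<subseteq> sphere (0::'a) 1 \<and> (\<forall>x\<in>T. \<forall>y\<in>T. x \<noteq> y \<longrightarrow> dist x y \<ge> \<delta> / 2)" for T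
    have bound: "real (card T) * \<delta> ^ (?N - 1) \<le> 8 ^ ?N * real ?N" if "P T" for T
      using that \<delta> by (intro sphere_separated_card_bound) (auto simp: P_def)
    define b where "b = nat \<lceil>8 ^ ?N * real ?N / \<delta> ^ (?N - 1)\<rceil>"
    have cb: "card T \<le> b" if "P T" for T
    proof -
      have "real (card T) \<le> 8 ^ ?N * real ?N / \<delta> ^ (?N - 1)"
        using bound[OF that] \<delta> by (simp add: field_simps)
      then show ?thesis unfolding b_def by linarith
    qed
    have "\<exists>T. P T \<and> (\<forall>S. P S \<longrightarrow> card S \<le> card T)"
    proof (rule ex_has_greatest_nat)
      show "P {}" by (simp add: P_def)
      show "\<forall>y. P y \<longrightarrow> card y < Suc b" using cb by (simp add: less_Suc_eq_le)
    qed
    then obtain T where T: "P T" "\<And>S. P S \<Longrightarrow> card S \<le> card T" by blast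
    have cover: "\<exists>t\<in>T. dist t x < \<delta> / 2" if x: "x \<in> sphere 0 1" for x
    proof (rule ccontr)
      assume no: "\<not> (\<exists>t\<in>T. dist t x < \<delta> / 2)"
      then have "x \<notin> T" using \<delta> by auto
      moreover have "P (insert x T)" using T(1) x no by (auto simp: P_def dist_commute not_less)
      ultimately show False using T(2)[of "insert x T"] T(1) by (auto simp: P_def)
    qed
    obtain f where f: "bij_betw f {0..<card T} T" using T(1) ex_bij_betw_nat_finite unfolding P_def by blast
    define C where "C i = (if i < card T then ball (f i) (\<delta> / 2) else {})" for i
    have C: "C \<in> hausdorff_covers \<delta> (sphere 0 1)"
      unfolding hausdorff_covers_def
    proof (intro CollectI conjI allI subsetI)
      fix x :: 'a assume "x \<in> sphere 0 1"
      then obtain t where t: "t \<in> T" "dist t x < \<delta> / 2" using cover by blast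
      have "t \<in> f ` {0..<card T}" using bij_betw_imp_surj_on[OF f] t(1) by simp
      then obtain i where "i < card T" "f i = t" by auto
      then show "x \<in> (\<Union>i. C i)" using t by (auto simp: C_def intro!: exI[of _ i])
    next
      fix i show "bounded (C i)" by (simp add: C_def)
      show "diameter (C i) \<le> \<delta>" using \<delta> by (simp add: C_def)
    qed
    have "hausdorff_premeasure (?N - 1) \<delta> (sphere (0::'a) 1) \<le> (\<Sum>i. hausdorff_weight (?N - 1) (C i))"
      unfolding hausdorff_premeasure_alt by (rule INF_lower[OF C])
    also have "\<dots> = (\<Sum>i<card T. hausdorff_weight (?N - 1) (C i))"
      by (rule suminf_finite) (auto simp: C_def hausdorff_weight_def)
    also have "\<dots> \<le> (\<Sum>i<card T. ennreal (unit_ball_vol (real (?N - 1)) * (\<delta> / 2) ^ (?N - 1)))"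
      using \<delta> by (intro sum_mono) (auto simp: C_def hausdorff_weight_def)
    also have "\<dots> = ennreal (real (card T) * (unit_ball_vol (real (?N - 1)) * (\<delta> / 2) ^ (?N - 1)))"
      using \<delta> by (simp add: ennreal_mult ennreal_of_nat_eq_real_of_nat)
    also have "\<dots> \<le> ennreal K"
    proof (rule ennreal_leI)
      have "real (card T) * (\<delta> / 2) ^ (?N - 1) \<le> real (card T) * \<delta> ^ (?N - 1)"
        using \<delta> by (intro mult_left_mono power_mono) auto
      also have "\<dots> \<le> 8 ^ ?N * real ?N" by (rule bound[OF T(1)])
      finally have "unit_ball_vol (real (?N - 1)) * (real (card T) * (\<delta> / 2) ^ (?N - 1)) \<le> K"
        unfolding K_def by (intro mult_left_mono) auto
      then show "real (card T) * (unit_ball_vol (real (?N - 1)) * (\<delta> / 2) ^ (?N - 1)) \<le> K"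
        by (simp only: mult_ac)
    qed
    finally show ?thesis .
  qed
  have "hausdorff_outer (?N - 1) (sphere (0::'a) 1) \<le> ennreal K"
    unfolding hausdorff_outer_def
  proof (rule SUP_least)
    fix \<delta> :: real assume "\<delta> \<in> {0<..}"
    then have "hausdorff_premeasure (?N - 1) (min \<delta> 1) (sphere (0::'a) 1) \<le> ennreal K" by (intro pre) auto
    then show "hausdorff_premeasure (?N - 1) \<delta> (sphere (0::'a) 1) \<le> ennreal K"
      using hausdorff_premeasure_antimono[of "min \<delta> 1" \<delta>] order_trans by (metis min.cobounded1)
  qed
  then show ?thesis using ennreal_less_top le_less_trans by blast
qed

text \<open>The cone over a set of diameter \<open>d > 0\<close> is covered by about \<open>1 / d\<close> balls of radius \<open>2 d\<close>.\<close>

lemma cone_volume_bound: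
  fixes C :: "'a::euclidean_space set"
  assumes C: "bounded C" "diameter C \<le> 1 / 2" "C \<subseteq> sphere 0 1" "C \<noteq> {}"
  shows "emeasure lborel (closure {t *\<^sub>R v | t v. 0 \<le> t \<and> t \<le> 1 \<and> v \<in> C}) \<le>
    ennreal (2 ^ Suc DIM('a) * unit_ball_vol (real DIM('a)) * diameter C ^ (DIM('a) - 1))"
proof -
  let ?N = "DIM('a)"
  define V where "V = unit_ball_vol (real ?N)"
  define B where "B = closure {t *\<^sub>R v | t v. 0 \<le> t \<and> t \<le> 1 \<and> v \<in> C}"
  define d where "d = diameter C"
  have V: "V > 0" unfolding V_def by simp
  have d: "0 \<le> d" "d \<le> 1 / 2" using C by (auto simp: d_def diameter_ge_0)
  obtain v0 where v0: "v0 \<in> C" using C by auto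
  have main: "emeasure lborel B \<le> ennreal (2 ^ Suc ?N * V * r ^ (?N - 1))" if r: "d < r" "r \<le> 1" for r
  proof -
    have r0: "r > 0" using d r by simp
    define n where "n = nat \<lfloor>1 / r\<rfloor>"
    have n: "real n \<le> 1 / r" using r0 by (simp add: n_def)
    let ?U = "\<Union>j\<in>{0..n}. cball ((real j * r) *\<^sub>R v0) (2 * r)"
    have sub: "B \<subseteq> ?U" unfolding B_def
    proof (rule closure_minimal)
      show "closed ?U" by (intro closed_UN) auto
      show "{t *\<^sub>R v | t v. 0 \<le> t \<and> t \<le> 1 \<and> v \<in> C} \<subseteq> ?U"
      proof
        fix x assume "x \<in> {t *\<^sub>R v | t v. 0 \<le> t \<and> t \<le> 1 \<and> v \<in> C}"
        then obtain t v where x: "x = t *\<^sub>R v" "0 \<le> t" "t \<le> 1" "v \<in> C" by auto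
        define j where "j = nat \<lfloor>t / r\<rfloor>"
        have tr: "t / r \<ge> 0" using x r0 by simp
        have jt: "real j \<le> t / r" "t / r < real j + 1" using tr unfolding j_def by linarith+
        have j1: "real j * r \<le> t" "t < real j * r + r" using jt r0 by (auto simp: field_simps)
        have "t / r \<le> 1 / r" using x r0 by (simp add: divide_right_mono)
        then have "j \<le> n" unfolding j_def n_def by (intro nat_mono floor_mono)
        moreover have "dist ((real j * r) *\<^sub>R v0) x \<le> 2 * r"
        proof -
          have "dist v v0 \<le> d" unfolding d_def using C(1) x(4) v0 by (rule diameter_bounded_bound)
          have "(real j * r) *\<^sub>R v0 - x = (real j * r) *\<^sub>R (v0 - v) + (real j * r - t) *\<^sub>R v"
            by (simp add: x algebra_simps)
          then have "norm ((real j * r) *\<^sub>R v0 - x) \<le> norm ((real j * r) *\<^sub>R (v0 - v)) + norm ((real j * r - t) *\<^sub>R v)"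
            by (metis norm_triangle_ineq)
          also have "\<dots> = real j * r * dist v v0 + \<bar>real j * r - t\<bar> * norm v"
            using r0 by (simp add: dist_norm norm_minus_commute)
          also have "\<dots> \<le> 1 * d + r * 1"
            using j1 x C(3) \<open>dist v v0 \<le> d\<close> r0 by (intro add_mono mult_mono) auto
          finally show ?thesis using r by (simp add: dist_norm)
        qed
        ultimately show "x \<in> ?U" by auto
      qed
    qed
    have "emeasure lborel B \<le> emeasure lborel ?U"
      by (rule emeasure_mono[OF sub]) (auto intro!: borel_closed closed_UN)
    also have "\<dots> \<le> (\<Sum>j\<in>{0..n}. emeasure lborel (cball ((real j * r) *\<^sub>R v0) (2 * r)))"
      by (rule emeasure_subadditive_finite) auto
    also have "\<dots> = (\<Sum>j\<in>{0..n}. ennreal (V * (2 * r) ^ ?N))"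
      using r0 by (intro sum.cong refl) (simp add: emeasure_cball V_def)
    also have "\<dots> = ennreal (real (Suc n) * (V * (2 * r) ^ ?N))"
      using r0 V by (simp add: ennreal_mult ennreal_of_nat_eq_real_of_nat)
    also have "\<dots> \<le> ennreal (2 / r * (V * (2 * r) ^ ?N))"
    proof (intro ennreal_leI mult_right_mono)
      have "1 \<le> 1 / r" using r r0 by simp
      then show "real (Suc n) \<le> 2 / r" using n by simp
    qed (use r0 V in auto)
    also have "2 / r * (V * (2 * r) ^ ?N) = 2 ^ Suc ?N * V * r ^ (?N - 1)"
    proof -
      have "r ^ ?N = r * r ^ (?N - 1)" using DIM_positive[where 'a = 'a] by (metis Suc_diff_1 power_Suc)
      then show ?thesis using r0 by (simp add: power_mult_distrib)
    qed
    finally show ?thesis .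
  qed
  have "((\<lambda>r. ennreal (2 ^ Suc ?N * V * r ^ (?N - 1))) \<longlongrightarrow> ennreal (2 ^ Suc ?N * V * d ^ (?N - 1))) (at_right d)"
    by (intro tendsto_ennrealI tendsto_intros)
  then have "emeasure lborel B \<le> ennreal (2 ^ Suc ?N * V * d ^ (?N - 1))"
  proof (rule tendsto_lowerbound)
    show "\<forall>\<^sub>F r in at_right d. emeasure lborel B \<le> ennreal (2 ^ Suc ?N * V * r ^ (?N - 1))"
    proof (rule eventually_mono)
      show "\<forall>\<^sub>F r in at_right d. r \<in> {d<..<1}" using d by (intro eventually_at_right_real) auto
      fix r assume "r \<in> {d<..<1}"
      then show "emeasure lborel B \<le> ennreal (2 ^ Suc ?N * V * r ^ (?N - 1))" by (intro main) auto
    qed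
  qed simp
  then show ?thesis by (simp add: B_def V_def d_def)
qed

text \<open>The cones over a cover of the sphere cover the unit ball, so \<open>cone_volume_bound\<close> bounds the volume of
  the ball by a multiple of the total weight of the cover.\<close>

lemma hausdorff_outer_sphere_pos: "hausdorff_outer (DIM('a) - 1) (sphere (0::'a::euclidean_space) 1) > 0"
proof -
  let ?N = "DIM('a)"
  define V where "V = unit_ball_vol (real ?N)"
  define W where "W = unit_ball_vol (real (?N - 1))"
  define K where "K = 2 ^ Suc ?N * V * 2 ^ (?N - 1) / W"
  have VW: "V > 0" "W > 0" unfolding V_def W_def by auto
  have K: "K > 0" using VW by (simp add: K_def)
  have "ennreal V * ennreal (1 / K) \<le> hausdorff_premeasure (?N - 1) (1 / 2) (sphere (0::'a) 1)"
    unfolding hausdorff_premeasure_alt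
  proof (rule INF_greatest)
    fix C assume C: "C \<in> hausdorff_covers (1 / 2) (sphere (0::'a) 1)"
    define D where "D i = C i \<inter> sphere 0 1" for i
    define B where "B i = closure {t *\<^sub>R v | t v. 0 \<le> t \<and> t \<le> 1 \<and> v \<in> D i}" for i
    have Bb: "B i \<in> sets borel" for i by (simp add: B_def)
    have Bw: "emeasure lborel (B i) * ennreal (1 / K) \<le> hausdorff_weight (?N - 1) (C i)" for i
    proof (cases "D i = {}")
      case True
      then show ?thesis by (simp add: B_def)
    next
      case False
      have bC: "bounded (C i)" "diameter (C i) \<le> 1 / 2" using C by (auto simp: hausdorff_covers_def)
      have dD: "diameter (D i) \<le> diameter (C i)" using bC by (intro diameter_subset) (auto simp: D_def)
      have "emeasure lborel (B i) \<le> ennreal (2 ^ Suc ?N * V * diameter (D i) ^ (?N - 1))"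
        unfolding B_def V_def using False bC dD
        by (intro cone_volume_bound) (auto simp: D_def intro: bounded_subset)
      also have "\<dots> \<le> ennreal (2 ^ Suc ?N * V * diameter (C i) ^ (?N - 1))"
        using VW dD bC by (intro ennreal_leI mult_left_mono power_mono diameter_ge_0) (auto simp: D_def intro: bounded_subset)
      also have "\<dots> = ennreal (K * (W * (diameter (C i) / 2) ^ (?N - 1)))"
        using VW by (simp add: K_def power_divide mult.assoc)
      finally have "emeasure lborel (B i) * ennreal (1 / K) \<le> ennreal (K * (W * (diameter (C i) / 2) ^ (?N - 1))) * ennreal (1 / K)"
        by (intro mult_right_mono) auto
      also have "\<dots> = ennreal (K * (W * (diameter (C i) / 2) ^ (?N - 1)) * (1 / K))"
        using K VW bC by (intro ennreal_mult[symmetric] mult_nonneg_nonneg zero_le_power divide_nonneg_nonneg diameter_ge_0) auto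
      also have "\<dots> = hausdorff_weight (?N - 1) (C i)"
        using K False by (auto simp: hausdorff_weight_def W_def D_def)
      finally show ?thesis .
    qed
    have "cball (0::'a) 1 \<subseteq> {0} \<union> (\<Union>i. B i)"
    proof
      fix x :: 'a assume x: "x \<in> cball 0 1"
      show "x \<in> {0} \<union> (\<Union>i. B i)"
      proof (cases "x = 0")
        case False
        define v where "v = x /\<^sub>R norm x"
        have v: "v \<in> sphere 0 1" "x = norm x *\<^sub>R v" using False by (auto simp: v_def)
        then obtain i where "v \<in> D i" using C by (auto simp: hausdorff_covers_def D_def)
        then have "x \<in> {t *\<^sub>R v | t v. 0 \<le> t \<and> t \<le> 1 \<and> v \<in> D i}"
          using v(2) x by (auto intro!: exI[of _ "norm x"] exI[of _ v])
        then have "x \<in> B i" unfolding B_def by (rule subsetD[OF closure_subset])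
        then show ?thesis by blast
      qed simp
    qed
    then have "emeasure lborel (cball (0::'a) 1) \<le> emeasure lborel ({0} \<union> (\<Union>i. B i))"
      by (rule emeasure_mono) (use Bb in auto)
    also have "\<dots> \<le> emeasure lborel {0::'a} + emeasure lborel (\<Union>i. B i)"
      by (rule emeasure_subadditive) (use Bb in auto)
    also have "\<dots> \<le> (\<Sum>i. emeasure lborel (B i))"
      using emeasure_subadditive_countably[of B lborel] Bb by auto
    finally have "ennreal V \<le> (\<Sum>i. emeasure lborel (B i))" by (simp add: emeasure_cball V_def)
    then have "ennreal V * ennreal (1 / K) \<le> (\<Sum>i. emeasure lborel (B i)) * ennreal (1 / K)"
      by (rule mult_right_mono) simp
    also have "\<dots> = (\<Sum>i. emeasure lborel (B i) * ennreal (1 / K))" by simp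
    also have "\<dots> \<le> (\<Sum>i. hausdorff_weight (?N - 1) (C i))"
      by (intro suminf_le Bw) auto
    finally show "ennreal V * ennreal (1 / K) \<le> (\<Sum>i. hausdorff_weight (?N - 1) (C i))" .
  qed
  also have "\<dots> \<le> hausdorff_outer (?N - 1) (sphere (0::'a) 1)"
    by (rule hausdorff_premeasure_le_outer) simp
  finally have "ennreal V * ennreal (1 / K) \<le> hausdorff_outer (?N - 1) (sphere (0::'a) 1)" .
  moreover have "ennreal V * ennreal (1 / K) > 0" using VW K by (simp add: ennreal_zero_less_mult_iff)
  ultimately show ?thesis by (rule less_le_trans[rotated])
qed

section \<open>Averaging over directions\<close>

definition reflection :: "'a::real_inner \<Rightarrow> 'a \<Rightarrow> 'a" where
  "reflection a x = x - (2 * (x \<bullet> a) / (a \<bullet> a)) *\<^sub>R a"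

lemma reflection_add: "reflection a (x + y) = reflection a x + reflection a y"
  by (simp add: reflection_def inner_add_left algebra_simps add_divide_distrib)

lemma reflection_diff: "reflection a (x - y) = reflection a x - reflection a y"
  by (simp add: reflection_def inner_diff_left algebra_simps diff_divide_distrib)

lemma reflection_reflection [simp]: "reflection a (reflection a x) = x"
proof (cases "a = 0")
  case False
  then have "(x - (2 * (x \<bullet> a) / (a \<bullet> a)) *\<^sub>R a) \<bullet> a = - (x \<bullet> a)" by (simp add: inner_diff_left)
  then show ?thesis by (simp add: reflection_def)
qed (simp add: reflection_def)

lemma inner_reflection_commute: "reflection a x \<bullet> y = x \<bullet> reflection a y"
  by (simp add: reflection_def inner_diff_left inner_diff_right inner_commute)

lemma inner_reflection_reflection: "reflection a x \<bullet> reflection a y = x \<bullet> y"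
  by (simp add: inner_reflection_commute)

lemma norm_reflection [simp]: "norm (reflection a x) = norm x"
  by (simp add: norm_eq_sqrt_inner inner_reflection_reflection)

lemma dist_reflection: "dist (reflection a x) (reflection a y) = dist x y"
  by (simp add: dist_norm flip: reflection_diff)

lemma continuous_on_reflection: "continuous_on A (reflection a)"
  unfolding reflection_def[abs_def] divide_inverse by (intro continuous_intros)

lemma borel_measurable_reflection [measurable]: "reflection (a::'a::euclidean_space) \<in> borel_measurable borel"
  by (rule borel_measurable_continuous_onI[OF continuous_on_reflection])

lemma reflection_between_unit_vectors:
  assumes "norm e = 1" "norm e' = 1"
  shows "reflection (e - e') e = e'"
proof (cases "e = e'")
  case False
  have 1: "e \<bullet> e = 1" "e' \<bullet> e' = 1" using assms by (simp_all add: norm_eq_1)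
  have "(e - e') \<bullet> (e - e') = 2 * (e \<bullet> (e - e'))"
    by (simp add: inner_diff_left inner_diff_right 1 inner_commute)
  moreover have "(e - e') \<bullet> (e - e') \<noteq> 0" using False by simp
  ultimately have eq: "2 * (e \<bullet> (e - e')) / ((e - e') \<bullet> (e - e')) = 1" by simp
  show ?thesis unfolding reflection_def eq by simp
qed (simp add: reflection_def)

lemma nn_integral_lborel_translate:
  fixes f :: "'a::euclidean_space \<Rightarrow> ennreal"
  assumes "f \<in> borel_measurable borel"
  shows "(\<integral>\<^sup>+x. f (x + c) \<partial>lborel) = (\<integral>\<^sup>+x. f x \<partial>lborel)"
proof -
  have "(\<integral>\<^sup>+x. f x \<partial>lborel) = (\<integral>\<^sup>+x. f x \<partial>distr lborel borel ((+) c))" by (simp add: lborel_distr_plus)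
  also have "\<dots> = (\<integral>\<^sup>+x. f (c + x) \<partial>lborel)" using assms by (subst nn_integral_distr) auto
  finally show ?thesis by (simp add: add.commute)
qed

text \<open>A special case of the uniqueness of Haar measure: the image of Lebesgue measure under a
  reflection is translation invariant, hence a multiple of Lebesgue measure, and it agrees with Lebesgue
  measure on the unit ball.  The computation evaluates the integral of \<open>f (R x) g (y - R x)\<close> over
  \<open>(x, y)\<close> in two ways.\<close>

lemma nn_integral_lborel_reflection:
  fixes f :: "'a::euclidean_space \<Rightarrow> ennreal"
  assumes [measurable]: "f \<in> borel_measurable borel"
  shows "(\<integral>\<^sup>+x. f (reflection a x) \<partial>lborel) = (\<integral>\<^sup>+x. f x \<partial>lborel)"
proof -
  define g where "g = (indicator (ball 0 1) :: 'a \<Rightarrow> ennreal)"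
  have [measurable]: "g \<in> borel_measurable borel" unfolding g_def by (intro borel_measurable_indicator) simp
  let ?R = "reflection a"
  define G where "G = (\<integral>\<^sup>+x. g x \<partial>lborel)"
  have G: "G = emeasure lborel (ball (0::'a) 1)" by (simp add: G_def g_def)
  have gR: "g (- ?R x) = g x" for x by (simp add: g_def indicator_def)
  have "(\<integral>\<^sup>+x. f (?R x) \<partial>lborel) * G = (\<integral>\<^sup>+x. f (?R x) * G \<partial>lborel)"
    by (subst nn_integral_multc) auto
  also have "\<dots> = (\<integral>\<^sup>+x. (\<integral>\<^sup>+y. f (?R x) * g (y - ?R x) \<partial>lborel) \<partial>lborel)"
  proof (rule nn_integral_cong)
    fix x
    have "G = (\<integral>\<^sup>+y. g (y + - ?R x) \<partial>lborel)"
      unfolding G_def by (rule nn_integral_lborel_translate[symmetric]) measurable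
    then show "f (?R x) * G = (\<integral>\<^sup>+y. f (?R x) * g (y - ?R x) \<partial>lborel)"
      by (subst nn_integral_cmult) auto
  qed
  also have "\<dots> = (\<integral>\<^sup>+y. (\<integral>\<^sup>+x. f (?R x) * g (y - ?R x) \<partial>lborel) \<partial>lborel)"
    by (rule lborel_pair.Fubini') measurable
  also have "\<dots> = (\<integral>\<^sup>+y. (\<integral>\<^sup>+x. f (?R x + y) * g x \<partial>lborel) \<partial>lborel)"
  proof (rule nn_integral_cong)
    fix y
    have "(\<integral>\<^sup>+x. f (?R x) * g (y - ?R x) \<partial>lborel) = (\<integral>\<^sup>+x. f (?R (x + ?R y)) * g (y - ?R (x + ?R y)) \<partial>lborel)"
      by (rule nn_integral_lborel_translate[symmetric]) measurable
    then show "(\<integral>\<^sup>+x. f (?R x) * g (y - ?R x) \<partial>lborel) = (\<integral>\<^sup>+x. f (?R x + y) * g x \<partial>lborel)"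
      by (simp add: reflection_add gR)
  qed
  also have "\<dots> = (\<integral>\<^sup>+x. (\<integral>\<^sup>+y. f (?R x + y) * g x \<partial>lborel) \<partial>lborel)"
    by (rule lborel_pair.Fubini'[symmetric]) measurable
  also have "\<dots> = (\<integral>\<^sup>+x. (\<integral>\<^sup>+y. f y \<partial>lborel) * g x \<partial>lborel)"
  proof (rule nn_integral_cong)
    fix x
    have "(\<integral>\<^sup>+y. f (?R x + y) * g x \<partial>lborel) = (\<integral>\<^sup>+y. f (y + ?R x) \<partial>lborel) * g x"
      by (subst nn_integral_multc) (auto simp: add.commute)
    then show "(\<integral>\<^sup>+y. f (?R x + y) * g x \<partial>lborel) = (\<integral>\<^sup>+y. f y \<partial>lborel) * g x"
      by (simp add: nn_integral_lborel_translate)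
  qed
  also have "\<dots> = (\<integral>\<^sup>+y. f y \<partial>lborel) * G" unfolding G_def by (rule nn_integral_cmult) measurable
  finally have eq: "(\<integral>\<^sup>+x. f (?R x) \<partial>lborel) * G = (\<integral>\<^sup>+y. f y \<partial>lborel) * G" .
  have Gv: "G = ennreal (unit_ball_vol (real DIM('a)))" by (simp add: G emeasure_ball)
  have "0 < G" unfolding Gv ennreal_less_zero_iff by simp
  moreover have "G \<noteq> top" unfolding Gv by simp
  ultimately have "G \<noteq> 0" "G \<noteq> top" by auto
  then show ?thesis using eq by (simp add: mult.commute[of _ G] ennreal_mult_cancel_left)
qed

lemma AE_lborel_measure_preserving:
  fixes T :: "'a::euclidean_space \<Rightarrow> 'a"
  assumes T: "T \<in> borel_measurable borel"
    and mp: "\<And>f :: 'a \<Rightarrow> ennreal. f \<in> borel_measurable borel \<Longrightarrow> (\<integral>\<^sup>+x. f (T x) \<partial>lborel) = (\<integral>\<^sup>+x. f x \<partial>lborel)"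
    and P: "AE x in lborel. P x"
  shows "AE x in lborel. P (T x)"
proof -
  obtain N where N: "N \<in> null_sets lborel" "{x. \<not> P x} \<subseteq> N"
    using P by (auto elim!: AE_E simp: null_sets_def)
  have Nb: "N \<in> sets borel" using N by auto
  define N' where "N' = T -` N"
  have N'b: "N' \<in> sets borel"
    using measurable_sets[OF T Nb] by (simp add: N'_def)
  have "emeasure lborel N' = (\<integral>\<^sup>+x. indicator N (T x) \<partial>lborel)"
    using N'b by (simp add: N'_def flip: nn_integral_indicator) (simp add: indicator_def vimage_def)
  also have "\<dots> = (\<integral>\<^sup>+x. indicator N x \<partial>lborel)"
    using Nb by (intro mp) auto
  also have "\<dots> = 0" using N(1) Nb by (subst nn_integral_indicator) auto
  finally have "N' \<in> null_sets lborel" using N'b by auto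
  then show ?thesis by (rule AE_I') (use N in \<open>auto simp: N'_def\<close>)
qed

definition sphere_measure :: "'a::euclidean_space measure" where
  "sphere_measure = density (hausdorff_measure (DIM('a) - 1)) (indicator (sphere 0 1))"

lemma sets_sphere_measure [simp, measurable_cong]: "sets (sphere_measure :: 'a::euclidean_space measure) = sets borel"
  by (simp add: sphere_measure_def)

lemma emeasure_sphere_measure:
  assumes "A \<in> sets borel"
  shows "emeasure (sphere_measure :: 'a::euclidean_space measure) A = hausdorff_outer (DIM('a) - 1) (A \<inter> sphere 0 1)"
proof -
  have "emeasure (sphere_measure :: 'a measure) A = (\<integral>\<^sup>+x. indicator (sphere 0 1) x * indicator A x \<partial>hausdorff_measure (DIM('a) - 1))"
    unfolding sphere_measure_def using assms
    by (intro emeasure_density borel_measurable_indicator) simp_all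
  also have "\<dots> = (\<integral>\<^sup>+x. indicator (A \<inter> sphere 0 1) x \<partial>hausdorff_measure (DIM('a) - 1))"
    by (intro nn_integral_cong) (auto simp: indicator_def)
  also have "\<dots> = emeasure (hausdorff_measure (DIM('a) - 1)) (A \<inter> sphere 0 1)"
    using assms by (intro nn_integral_indicator) simp
  finally show ?thesis using assms by (simp add: emeasure_hausdorff_measure)
qed

lemma space_sphere_measure [simp]: "space (sphere_measure :: 'a::euclidean_space measure) = UNIV"
  by (simp add: sphere_measure_def)

lemma finite_measure_sphere_measure: "finite_measure (sphere_measure :: 'a::euclidean_space measure)"
  by (rule finite_measureI)
    (use hausdorff_outer_sphere_finite[where 'a = 'a] in \<open>simp add: emeasure_sphere_measure\<close>)

lemma hausdorff_outer_reflection: "hausdorff_outer k (reflection a ` A) = hausdorff_outer k A"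
proof (rule antisym)
  show "hausdorff_outer k (reflection a ` A) \<le> hausdorff_outer k A"
    by (rule hausdorff_outer_isometric_image_le[OF dist_reflection])
  have "hausdorff_outer k (reflection a ` reflection a ` A) \<le> hausdorff_outer k (reflection a ` A)"
    by (rule hausdorff_outer_isometric_image_le[OF dist_reflection])
  then show "hausdorff_outer k A \<le> hausdorff_outer k (reflection a ` A)"
    by (simp add: image_image)
qed

lemma sphere_measure_reflection:
  "distr sphere_measure borel (reflection a) = (sphere_measure :: 'a::euclidean_space measure)"
proof (rule measure_eqI)
  fix A assume "A \<in> sets (distr sphere_measure borel (reflection a))"
  then have A: "A \<in> sets borel" by simp
  have vb: "reflection a -` A \<in> sets borel"
    using measurable_sets[OF borel_measurable_reflection A, of a] by simp
  have "reflection a -` A \<inter> sphere 0 1 = reflection a ` (A \<inter> sphere 0 1)"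
  proof
    show "reflection a -` A \<inter> sphere 0 1 \<subseteq> reflection a ` (A \<inter> sphere 0 1)"
    proof
      fix x assume "x \<in> reflection a -` A \<inter> sphere 0 1"
      then have "reflection a x \<in> A \<inter> sphere 0 1" by simp
      then have "reflection a (reflection a x) \<in> reflection a ` (A \<inter> sphere 0 1)" by (rule imageI)
      then show "x \<in> reflection a ` (A \<inter> sphere 0 1)" by simp
    qed
  qed auto
  then show "emeasure (distr sphere_measure borel (reflection a)) A = emeasure sphere_measure A"
    using A vb by (subst emeasure_distr) (auto simp: emeasure_sphere_measure hausdorff_outer_reflection)
qed simp

lemma C1_sphere_measure: "C1 e = (LINT v|sphere_measure. \<bar>e \<bullet> v\<bar>)"
proof -
  have "(LINT v|sphere_measure. \<bar>e \<bullet> v\<bar>) = (LINT v|density (hausdorff_measure (DIM('a) - 1)) (\<lambda>x. ennreal (indicator (sphere 0 1) x)). \<bar>e \<bullet> v\<bar>)"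
    by (simp add: sphere_measure_def ennreal_indicator)
  also have "\<dots> = (LINT v|hausdorff_measure (DIM('a) - 1). indicator (sphere 0 1) v *\<^sub>R \<bar>e \<bullet> v\<bar>)"
    by (intro integral_density borel_measurable_indicator AE_I2) simp_all
  finally show ?thesis by (simp add: C1_def set_lebesgue_integral_def)
qed

lemma measure_sphere_measure_UNIV:
  "measure (sphere_measure :: 'a::euclidean_space measure) UNIV = measure (hausdorff_measure (DIM('a) - 1)) (sphere (0::'a) 1)"
  unfolding measure_def by (simp add: emeasure_sphere_measure emeasure_hausdorff_measure)

lemma AE_sphere_measure: "AE v in sphere_measure. norm v = 1"
  unfolding sphere_measure_def
  by (subst AE_density, intro borel_measurable_indicator) (auto simp: indicator_def split: if_splits)

lemma integrable_sphere_measure_inner: "integrable sphere_measure (\<lambda>v. \<bar>e \<bullet> v\<bar>)"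
proof -
  interpret finite_measure "sphere_measure :: 'a measure" by (rule finite_measure_sphere_measure)
  show ?thesis
  proof (rule integrable_const_bound[of _ "norm e"])
    show "AE v in sphere_measure. norm \<bar>e \<bullet> v\<bar> \<le> norm e"
      using AE_sphere_measure
    proof eventually_elim
      case (elim v)
      then show ?case using Cauchy_Schwarz_ineq2[of e v] by simp
    qed
  qed measurable
qed

lemma C1_unit_vector:
  fixes e e' :: "'a::euclidean_space"
  assumes "norm e = 1" "norm e' = 1"
  shows "C1 e = C1 e'"
proof -
  define a where "a = e - e'"
  have "C1 e' = (LINT v|distr sphere_measure borel (reflection a). \<bar>e' \<bullet> v\<bar>)"
    unfolding C1_sphere_measure sphere_measure_reflection ..
  also have "\<dots> = (LINT v|sphere_measure. \<bar>e' \<bullet> reflection a v\<bar>)"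
    by (subst integral_distr) auto
  also have "\<dots> = (LINT v|sphere_measure. \<bar>e \<bullet> v\<bar>)"
    using reflection_between_unit_vectors[OF assms]
    by (metis a_def inner_reflection_commute reflection_reflection)
  finally show ?thesis by (simp add: C1_sphere_measure)
qed

lemma K1_nonneg: "K1 e \<ge> 0"
  unfolding K1_def C1_sphere_measure by (intro divide_nonneg_nonneg Bochner_Integration.integral_nonneg) auto

lemma nn_integral_sphere_measure_inner:
  fixes e h :: "'a::euclidean_space"
  assumes e: "norm e = 1"
  shows "(\<integral>\<^sup>+v. ennreal \<bar>v \<bullet> h\<bar> \<partial>sphere_measure) = ennreal (norm h) * ennreal (C1 e)"
proof (cases "h = 0")
  case False
  define w where "w = h /\<^sub>R norm h"
  have w: "norm w = 1" "h = norm h *\<^sub>R w" using False by (simp_all add: w_def)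
  have "\<bar>v \<bullet> h\<bar> = norm h * \<bar>w \<bullet> v\<bar>" for v
    by (subst w(2)) (simp add: abs_mult inner_commute)
  then have "(\<integral>\<^sup>+v. ennreal \<bar>v \<bullet> h\<bar> \<partial>sphere_measure) = (\<integral>\<^sup>+v. ennreal (norm h) * ennreal \<bar>w \<bullet> v\<bar> \<partial>sphere_measure)"
    by (simp add: ennreal_mult)
  also have "\<dots> = ennreal (norm h) * (\<integral>\<^sup>+v. ennreal \<bar>w \<bullet> v\<bar> \<partial>sphere_measure)"
    by (rule nn_integral_cmult) measurable
  also have "(\<integral>\<^sup>+v. ennreal \<bar>w \<bullet> v\<bar> \<partial>sphere_measure) = ennreal (C1 w)"
    unfolding C1_sphere_measure by (rule nn_integral_eq_integral[OF integrable_sphere_measure_inner]) simp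
  also have "C1 w = C1 e" by (rule C1_unit_vector[OF w(1) e])
  finally show ?thesis .
qed simp

text \<open>For a radial weight the integral of \<open>|w \<bullet> h| / |h|\<close> depends only on \<open>|w|\<close>.  Averaging it over
  \<open>w\<close> in the unit sphere and exchanging the integrals produces the constant, without polar coordinates.\<close>

lemma radial_direction_average:
  fixes r :: "'a::euclidean_space \<Rightarrow> ennreal" and e w :: 'a
  assumes [measurable]: "r \<in> borel_measurable borel"
    and inv: "\<And>a. AE h in lborel. r (reflection a h) = r h"
    and e: "norm e = 1"
  shows "(\<integral>\<^sup>+h. r h * ennreal (\<bar>w \<bullet> h\<bar> / norm h) \<partial>lborel) = ennreal (K1 e * norm w) * (\<integral>\<^sup>+h. r h \<partial>lborel)"
proof -
  define F where "F w = (\<integral>\<^sup>+h. r h * ennreal (\<bar>w \<bullet> h\<bar> / norm h) \<partial>lborel)" for w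
  have F_unit: "F v = F e" if v: "norm v = 1" for v
  proof -
    define a where "a = e - v"
    have "F v = (\<integral>\<^sup>+h. r (reflection a h) * ennreal (\<bar>v \<bullet> reflection a h\<bar> / norm (reflection a h)) \<partial>lborel)"
      unfolding F_def by (rule nn_integral_lborel_reflection[symmetric]) measurable
    also have "\<dots> = (\<integral>\<^sup>+h. r h * ennreal (\<bar>v \<bullet> reflection a h\<bar> / norm (reflection a h)) \<partial>lborel)"
    proof (rule nn_integral_cong_AE)
      show "AE h in lborel. r (reflection a h) * ennreal (\<bar>v \<bullet> reflection a h\<bar> / norm (reflection a h)) =
          r h * ennreal (\<bar>v \<bullet> reflection a h\<bar> / norm (reflection a h))"
        using inv[of a] by eventually_elim simp
    qed
    also have "\<dots> = F e"
    proof -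
      have "v \<bullet> reflection a h = e \<bullet> h" for h
        using reflection_between_unit_vectors[OF e v] inner_reflection_reflection[of a e h] by (simp add: a_def)
      then show ?thesis by (simp add: F_def)
    qed
    finally show ?thesis .
  qed
  interpret S: finite_measure "sphere_measure :: 'a measure" by (rule finite_measure_sphere_measure)
  interpret P: pair_sigma_finite "lborel :: 'a measure" "sphere_measure :: 'a measure" ..
  define m where "m = measure (sphere_measure :: 'a measure) UNIV"
  have m: "m > 0"
  proof -
    have "emeasure (sphere_measure :: 'a measure) UNIV > 0"
      using hausdorff_outer_sphere_pos[where 'a = 'a] by (simp add: emeasure_sphere_measure)
    then show ?thesis unfolding m_def S.emeasure_eq_measure by simp
  qed
  have "F e * ennreal m = (\<integral>\<^sup>+v. F e \<partial>(sphere_measure :: 'a measure))"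
    by (simp add: m_def S.emeasure_eq_measure)
  also have "\<dots> = (\<integral>\<^sup>+v. F v \<partial>sphere_measure)"
  proof (rule nn_integral_cong_AE)
    show "AE v in sphere_measure. F e = F v"
      using AE_sphere_measure by eventually_elim (simp add: F_unit)
  qed
  also have "\<dots> = (\<integral>\<^sup>+h. (\<integral>\<^sup>+v. r h * ennreal (\<bar>v \<bullet> h\<bar> / norm h) \<partial>sphere_measure) \<partial>lborel)"
    unfolding F_def by (rule P.Fubini') measurable
  also have "\<dots> = (\<integral>\<^sup>+h. r h * ennreal (C1 e) \<partial>lborel)"
  proof (rule nn_integral_cong_AE)
    have "AE h in lborel. h \<noteq> (0::'a)" by (rule AE_lborel_singleton)
    then show "AE h in lborel. (\<integral>\<^sup>+v. r h * ennreal (\<bar>v \<bullet> h\<bar> / norm h) \<partial>sphere_measure) = r h * ennreal (C1 e)"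
    proof eventually_elim
      case (elim h)
      have "(\<integral>\<^sup>+v. r h * ennreal (\<bar>v \<bullet> h\<bar> / norm h) \<partial>sphere_measure) =
        (\<integral>\<^sup>+v. (r h * ennreal (1 / norm h)) * ennreal \<bar>v \<bullet> h\<bar> \<partial>sphere_measure)"
        by (simp add: mult.assoc ennreal_mult[symmetric])
      also have "\<dots> = (r h * ennreal (1 / norm h)) * (ennreal (norm h) * ennreal (C1 e))"
        by (subst nn_integral_cmult) (auto simp: nn_integral_sphere_measure_inner[OF e])
      also have "\<dots> = r h * (ennreal (1 / norm h) * ennreal (norm h)) * ennreal (C1 e)" by (simp add: mult_ac)
      also have "ennreal (1 / norm h) * ennreal (norm h) = 1"
        using elim by (simp add: ennreal_mult[symmetric] flip: ennreal_1)
      finally show ?case by simp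
    qed
  qed
  also have "\<dots> = (\<integral>\<^sup>+h. r h \<partial>lborel) * ennreal (C1 e)" by (rule nn_integral_multc) measurable
  finally have eq: "F e * ennreal m = (\<integral>\<^sup>+h. r h \<partial>lborel) * ennreal (C1 e)" .
  have "F e = F e * ennreal m * ennreal (1 / m)"
    using m by (simp add: mult.assoc ennreal_mult[symmetric])
  also have "\<dots> = (\<integral>\<^sup>+h. r h \<partial>lborel) * (ennreal (C1 e) * ennreal (1 / m))" unfolding eq by (simp add: mult.assoc)
  also have "ennreal (C1 e) * ennreal (1 / m) = ennreal (C1 e * (1 / m))"
    using m by (intro ennreal_mult[symmetric]) (simp_all add: C1_sphere_measure)
  also have "C1 e * (1 / m) = K1 e"
    by (simp add: K1_def m_def measure_sphere_measure_UNIV)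
  finally have Fe: "F e = (\<integral>\<^sup>+h. r h \<partial>lborel) * ennreal (K1 e)" .
  show ?thesis
  proof (cases "w = 0")
    case False
    define v where "v = w /\<^sub>R norm w"
    have v: "norm v = 1" "w = norm w *\<^sub>R v" using False by (simp_all add: v_def)
    have "\<bar>w \<bullet> h\<bar> = norm w * \<bar>v \<bullet> h\<bar>" for h by (subst v(2)) (simp add: abs_mult)
    then have "F w = (\<integral>\<^sup>+h. ennreal (norm w) * (r h * ennreal (\<bar>v \<bullet> h\<bar> / norm h)) \<partial>lborel)"
      unfolding F_def by (simp add: ennreal_mult mult.left_commute flip: times_divide_eq_right)
    also have "\<dots> = ennreal (norm w) * F v" unfolding F_def by (rule nn_integral_cmult) measurable
    also have "\<dots> = ennreal (K1 e * norm w) * (\<integral>\<^sup>+h. r h \<partial>lborel)"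
      unfolding F_unit[OF v(1)] Fe by (simp add: ennreal_mult K1_nonneg mult_ac)
    finally show ?thesis by (simp add: F_def)
  qed simp
qed

section \<open>Densities of vector measures\<close>

text \<open>Equality of signed measures \<open>P - Q = P' - Q'\<close>, written without subtraction so that it passes to suprema of
  increasing sequences.\<close>

lemma nn_integral_sum_measures_eq:
  fixes f :: "'a \<Rightarrow> ennreal"
  assumes f: "f \<in> borel_measurable B"
    and sets: "sets P = sets B" "sets Q = sets B" "sets P' = sets B" "sets Q' = sets B"
    and eq: "\<And>A. A \<in> sets B \<Longrightarrow> emeasure P A + emeasure Q' A = emeasure P' A + emeasure Q A"
  shows "(\<integral>\<^sup>+x. f x \<partial>P) + (\<integral>\<^sup>+x. f x \<partial>Q') = (\<integral>\<^sup>+x. f x \<partial>P') + (\<integral>\<^sup>+x. f x \<partial>Q)"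
proof -
  have m: "borel_measurable P = (borel_measurable B :: ('a \<Rightarrow> ennreal) set)" "borel_measurable Q = (borel_measurable B :: ('a \<Rightarrow> ennreal) set)"
    "borel_measurable P' = (borel_measurable B :: ('a \<Rightarrow> ennreal) set)" "borel_measurable Q' = (borel_measurable B :: ('a \<Rightarrow> ennreal) set)"
    using sets by (auto intro!: measurable_cong_sets)
  have sp: "space P = space B" "space Q = space B" "space P' = space B" "space Q' = space B"
    using sets by (auto dest!: sets_eq_imp_space_eq)
  show ?thesis using f
  proof (induction rule: borel_measurable_induct)
    case (cong f g)
    have "(\<integral>\<^sup>+x. f x \<partial>N) = (\<integral>\<^sup>+x. g x \<partial>N)" if "space N = space B" for N
      using cong.hyps(3) that by (intro nn_integral_cong) auto
    then show ?case using cong.IH sp by simp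
  next
    case (set A)
    then show ?case using eq sets by simp
  next
    case (mult u c)
    then show ?case by (simp add: nn_integral_cmult m distrib_left[symmetric])
  next
    case (add u v)
    have "(\<integral>\<^sup>+x. v x + u x \<partial>N) = (\<integral>\<^sup>+x. v x \<partial>N) + (\<integral>\<^sup>+x. u x \<partial>N)" if "borel_measurable N = (borel_measurable B :: ('a \<Rightarrow> ennreal) set)" for N
      using add.hyps that by (intro nn_integral_add) auto
    then have "(\<integral>\<^sup>+x. v x + u x \<partial>P) + (\<integral>\<^sup>+x. v x + u x \<partial>Q') =
      ((\<integral>\<^sup>+x. v x \<partial>P) + (\<integral>\<^sup>+x. v x \<partial>Q')) + ((\<integral>\<^sup>+x. u x \<partial>P) + (\<integral>\<^sup>+x. u x \<partial>Q'))"
      "(\<integral>\<^sup>+x. v x + u x \<partial>P') + (\<integral>\<^sup>+x. v x + u x \<partial>Q) =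
      ((\<integral>\<^sup>+x. v x \<partial>P') + (\<integral>\<^sup>+x. v x \<partial>Q)) + ((\<integral>\<^sup>+x. u x \<partial>P') + (\<integral>\<^sup>+x. u x \<partial>Q))"
      using m by (simp_all add: add_ac)
    then show ?case using add.IH by simp
  next
    case (seq U)
    have lim: "(\<lambda>i. \<integral>\<^sup>+x. U i x \<partial>N) \<longlonglongrightarrow> (\<integral>\<^sup>+x. (SUP i. U i) x \<partial>N)"
      if "borel_measurable N = (borel_measurable B :: ('a \<Rightarrow> ennreal) set)" for N
    proof -
      have "(\<integral>\<^sup>+x. (SUP i. U i) x \<partial>N) = (SUP i. \<integral>\<^sup>+x. U i x \<partial>N)"
        using seq.hyps that nn_integral_monotone_convergence_SUP[of U N] by (simp add: image_comp)
      moreover have "incseq (\<lambda>i. \<integral>\<^sup>+x. U i x \<partial>N)"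
        using seq.hyps by (auto simp: incseq_def le_fun_def intro!: nn_integral_mono)
      ultimately show ?thesis using LIMSEQ_SUP by metis
    qed
    show ?case
    proof (rule LIMSEQ_unique)
      show "(\<lambda>i. (\<integral>\<^sup>+x. U i x \<partial>P) + (\<integral>\<^sup>+x. U i x \<partial>Q')) \<longlonglongrightarrow> (\<integral>\<^sup>+x. (SUP i. U i) x \<partial>P) + (\<integral>\<^sup>+x. (SUP i. U i) x \<partial>Q')"
        by (intro tendsto_add lim m)
      show "(\<lambda>i. (\<integral>\<^sup>+x. U i x \<partial>P) + (\<integral>\<^sup>+x. U i x \<partial>Q')) \<longlonglongrightarrow> (\<integral>\<^sup>+x. (SUP i. U i) x \<partial>P') + (\<integral>\<^sup>+x. (SUP i. U i) x \<partial>Q)"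
        unfolding seq.IH by (intro tendsto_add lim m)
    qed
  qed
qed

text \<open>The integral of a bounded function with respect to a signed measure does not depend on the representation
  as a difference.  Adding the constant \<open>C\<close> makes the integrand nonnegative.\<close>

lemma integral_difference_measures_eq:
  fixes f :: "'a \<Rightarrow> real"
  assumes fin: "finite_measure P" "finite_measure Q" "finite_measure P'" "finite_measure Q'"
    and sets: "sets P = sets B" "sets Q = sets B" "sets P' = sets B" "sets Q' = sets B"
    and eq: "\<And>A. A \<in> sets B \<Longrightarrow> measure P A - measure Q A = measure P' A - measure Q' A"
    and f: "f \<in> borel_measurable B" "\<And>x. \<bar>f x\<bar> \<le> C"
  shows "(LINT x|P. f x) - (LINT x|Q. f x) = (LINT x|P'. f x) - (LINT x|Q'. f x)"
proof -
  have sp: "space P = space B" "space Q = space B" "space P' = space B" "space Q' = space B"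
    using sets by (auto dest!: sets_eq_imp_space_eq)
  have I: "(\<integral>\<^sup>+x. ennreal (f x + C) \<partial>N) = ennreal ((LINT x|N. f x) + C * measure N (space N))"
    "(LINT x|N. f x) + C * measure N (space N) \<ge> 0"
    if "finite_measure N" "sets N = sets B" for N
  proof -
    interpret finite_measure N by fact
    have fm: "f \<in> borel_measurable N" using f(1) measurable_cong_sets[OF that(2) refl] by blast
    have i: "integrable N f" by (rule integrable_const_bound[of _ C]) (use f fm in auto)
    have nn: "0 \<le> f x + C" for x using f(2)[of x] by linarith
    have e: "(LINT x|N. f x + C) = (LINT x|N. f x) + C * measure N (space N)" using i by (simp add: mult.commute)
    have "(\<integral>\<^sup>+x. ennreal (f x + C) \<partial>N) = ennreal (LINT x|N. f x + C)"
      using i nn by (intro nn_integral_eq_integral) auto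
    then show "(\<integral>\<^sup>+x. ennreal (f x + C) \<partial>N) = ennreal ((LINT x|N. f x) + C * measure N (space N))" unfolding e .
    have "(LINT x|N. f x + C) \<ge> 0" using nn by simp
    then show "(LINT x|N. f x) + C * measure N (space N) \<ge> 0" unfolding e .
  qed
  have em: "emeasure N A = ennreal (measure N A)" if "finite_measure N" for N :: "'a measure" and A
    using that by (rule finite_measure.emeasure_eq_measure)
  have "(\<integral>\<^sup>+x. ennreal (f x + C) \<partial>P) + (\<integral>\<^sup>+x. ennreal (f x + C) \<partial>Q') =
      (\<integral>\<^sup>+x. ennreal (f x + C) \<partial>P') + (\<integral>\<^sup>+x. ennreal (f x + C) \<partial>Q)"
  proof (rule nn_integral_sum_measures_eq[OF _ sets])
    show "(\<lambda>x. ennreal (f x + C)) \<in> borel_measurable B" using f(1) by measurable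
    fix A assume "A \<in> sets B"
    then show "emeasure P A + emeasure Q' A = emeasure P' A + emeasure Q A"
      using eq[of A] fin by (simp add: em ennreal_plus[symmetric] del: ennreal_plus)
  qed
  then have "(LINT x|P. f x) + C * measure P (space B) + ((LINT x|Q'. f x) + C * measure Q' (space B)) =
    (LINT x|P'. f x) + C * measure P' (space B) + ((LINT x|Q. f x) + C * measure Q (space B))"
    using I(2)[OF fin(1) sets(1)] I(2)[OF fin(2) sets(2)] I(2)[OF fin(3) sets(3)] I(2)[OF fin(4) sets(4)]
    by (simp add: I(1)[OF fin(1) sets(1)] I(1)[OF fin(2) sets(2)] I(1)[OF fin(3) sets(3)] I(1)[OF fin(4) sets(4)] sp
       ennreal_plus[symmetric] del: ennreal_plus)
  moreover have "C * (measure P (space B) - measure Q (space B)) = C * (measure P' (space B) - measure Q' (space B))"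
    using eq[of "space B"] by simp
  ultimately show ?thesis by (simp add: algebra_simps)
qed

lemma finite_sum_measure:
  assumes I: "finite I" and N: "\<And>i. i \<in> I \<Longrightarrow> finite_measure (N i)" "\<And>i. i \<in> I \<Longrightarrow> sets (N i) = sets B"
  obtains M where "finite_measure M" "sets M = sets B"
    "\<And>A. A \<in> sets B \<Longrightarrow> emeasure M A = (\<Sum>i\<in>I. emeasure (N i) A)"
proof -
  define M where "M = measure_of (space B) (sets B) (\<lambda>A. \<Sum>i\<in>I. emeasure (N i) A)"
  have sM: "sets M = sets B" unfolding M_def by (simp add: sets.space_closed sets.sigma_sets_eq)
  have eM: "emeasure M A = (\<Sum>i\<in>I. emeasure (N i) A)" if A: "A \<in> sets B" for A
    unfolding M_def
  proof (rule emeasure_measure_of_sigma)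
    show "sigma_algebra (space B) (sets B)" by (rule sets.sigma_algebra_axioms)
    show "positive (sets B) (\<lambda>A. \<Sum>i\<in>I. emeasure (N i) A)" by (simp add: positive_def)
    show "countably_additive (sets B) (\<lambda>A. \<Sum>i\<in>I. emeasure (N i) A)"
      unfolding countably_additive_def
    proof (intro allI impI)
      fix A :: "nat \<Rightarrow> _" assume A: "range A \<subseteq> sets B" "disjoint_family A" "(\<Union>i. A i) \<in> sets B"
      have "(\<Sum>n. \<Sum>i\<in>I. emeasure (N i) (A n)) = (\<Sum>i\<in>I. \<Sum>n. emeasure (N i) (A n))"
        by (rule suminf_sum) auto
      also have "\<dots> = (\<Sum>i\<in>I. emeasure (N i) (\<Union>n. A n))"
        using A N(2) by (intro sum.cong refl suminf_emeasure) auto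
      finally show "(\<Sum>n. \<Sum>i\<in>I. emeasure (N i) (A n)) = (\<Sum>i\<in>I. emeasure (N i) (\<Union>n. A n))" .
    qed
  qed (rule A)
  have "finite_measure M"
  proof (rule finite_measureI)
    have "space M = space B" using sM by (rule sets_eq_imp_space_eq)
    then have "emeasure M (space M) = (\<Sum>i\<in>I. emeasure (N i) (space B))" using eM[of "space B"] by simp
    also have "\<dots> \<noteq> \<infinity>"
      using I N(1) finite_measure.emeasure_finite by auto
    finally show "emeasure M (space M) \<noteq> \<infinity>" .
  qed
  then show ?thesis using that sM eM by blast
qed

lemma finite_measure_real_density:
  assumes sf: "sigma_finite_measure M" and fin: "finite_measure N" and sets: "sets N = sets M"
    and ac: "absolutely_continuous M N"
  obtains p :: "'a \<Rightarrow> real" where "integrable M p" "\<And>x. 0 \<le> p x" "N = density M (\<lambda>x. ennreal (p x))"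
proof -
  interpret sigma_finite_measure M by fact
  obtain f where f: "f \<in> borel_measurable M" "density M f = N"
    using Radon_Nikodym[OF ac sets] by auto
  have sp: "space N = space M" using sets by (rule sets_eq_imp_space_eq)
  have "(\<integral>\<^sup>+x. f x \<partial>M) = emeasure N (space M)"
    unfolding f(2)[symmetric] using f(1) by (subst emeasure_density) (auto intro!: nn_integral_cong)
  then have fi: "(\<integral>\<^sup>+x. f x \<partial>M) \<noteq> \<infinity>" using finite_measure.emeasure_finite[OF fin] by simp
  have ae: "AE x in M. ennreal (enn2real (f x)) = f x"
    using nn_integral_PInf_AE[OF f(1) fi] by eventually_elim (simp add: less_top)
  show ?thesis
  proof (rule that[of "\<lambda>x. enn2real (f x)"])
    have "(\<integral>\<^sup>+x. ennreal (norm (enn2real (f x))) \<partial>M) = (\<integral>\<^sup>+x. f x \<partial>M)"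
      by (rule nn_integral_cong_AE) (use ae in eventually_elim, simp)
    then show "integrable M (\<lambda>x. enn2real (f x))"
      using fi f(1) by (auto simp: integrable_iff_bounded less_top)
    have "density M f = density M (\<lambda>x. ennreal (enn2real (f x)))"
      by (rule density_cong) (use f ae in auto)
    then show "N = density M (\<lambda>x. ennreal (enn2real (f x)))" using f(2) by simp
  qed simp
qed

text \<open>The Lebesgue decomposition of \<open>M\<close>.  Let \<open>L\<close> be a finite measure with the same null sets as Lebesgue measure;
  then \<open>Z\<close> is the zero set of the density of \<open>L\<close> with respect to \<open>M + L\<close>.\<close>

lemma singular_carrier:
  fixes M :: "'a::euclidean_space measure"
  assumes fin: "finite_measure M" and sets: "sets M = sets borel"
  obtains Z where "Z \<in> null_sets lborel" "\<And>A. A \<in> null_sets lborel \<Longrightarrow> A - Z \<in> null_sets M"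
proof -
  obtain h where h: "h \<in> borel_measurable lborel" "integral\<^sup>N lborel h \<noteq> \<infinity>" "\<And>x::'a. 0 < h x"
    using sigma_finite_measure.Ex_finite_integrable_function[OF sigma_finite_lborel] by auto
  define L where "L = density lborel h"
  have L: "finite_measure L"
    by (rule finite_measureI) (use h in \<open>simp add: L_def emeasure_density\<close>)
  have nullL: "A \<in> null_sets L \<longleftrightarrow> A \<in> null_sets lborel" for A
  proof -
    have "h x \<noteq> 0" for x using h(3)[of x] by auto
    then have "A \<in> null_sets L \<longleftrightarrow> A \<in> sets lborel \<and> (AE x in lborel. x \<notin> A)"
      unfolding L_def null_sets_density_iff[OF h(1)] by simp
    then show ?thesis using AE_iff_null_sets[of A lborel] null_setsD2[of A lborel] by blast
  qed
  obtain S where S: "finite_measure S" "sets S = sets (borel :: 'a measure)"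
    "\<And>A. A \<in> sets (borel :: 'a measure) \<Longrightarrow> emeasure S A = (\<Sum>i\<in>UNIV. emeasure (if i then M else L) A)"
    by (rule finite_sum_measure[of "UNIV :: bool set" "\<lambda>i. if i then M else L" "borel :: 'a measure"])
      (use fin L sets in \<open>auto simp: L_def split: if_splits\<close>)
  have S_sum: "emeasure S A = emeasure M A + emeasure L A" if "A \<in> sets borel" for A
    using S(3)[OF that] by (simp add: UNIV_bool add.commute)
  have ac: "absolutely_continuous S L"
    unfolding absolutely_continuous_def
  proof
    fix A assume "A \<in> null_sets S"
    then have "A \<in> sets borel" "emeasure S A = 0" using S(2) by auto
    then show "A \<in> null_sets L" using S_sum[of A] by (auto simp: null_sets_def L_def)
  qed
  have sfS: "sigma_finite_measure S" using S(1) by (simp add: finite_measure_def)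
  have LS: "sets L = sets S" using S(2) by (simp add: L_def)
  obtain f where f: "integrable S f" "\<And>x. 0 \<le> f x" "L = density S (\<lambda>x. ennreal (f x))"
    by (rule finite_measure_real_density[OF sfS L LS ac]) blast
  have fS: "(\<lambda>x. ennreal (f x)) \<in> borel_measurable S" using f(1) by auto
  define Z where "Z = {x. f x = 0}"
  have Zb: "Z \<in> sets borel"
  proof -
    have "f \<in> borel_measurable borel" using borel_measurable_integrable[OF f(1)] measurable_cong_sets[OF S(2) refl] by blast
    then show ?thesis unfolding Z_def by measurable
  qed
  have Z: "Z \<in> null_sets lborel"
    unfolding nullL[symmetric] f(3) null_sets_density_iff[OF fS] using Zb S(2) by (auto simp: Z_def)
  have "A - Z \<in> null_sets M" if "A \<in> null_sets lborel" for A
  proof -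
    have Ab: "A \<in> sets borel" using that by auto
    have "A \<in> null_sets L" using that nullL by simp
    then have "AE x in S. x \<in> A \<longrightarrow> ennreal (f x) = 0" unfolding f(3) null_sets_density_iff[OF fS] by simp
    then have "AE x in S. x \<notin> A - Z" by eventually_elim (use f(2) in \<open>auto simp: Z_def ennreal_eq_0_iff intro: antisym\<close>)
    then have "A - Z \<in> null_sets S" using Ab Zb S(2) by (subst AE_iff_null_sets) auto
    then show ?thesis using S_sum[of "A - Z"] Ab Zb sets by (auto simp: null_sets_def)
  qed
  then show ?thesis using Z that by blast
qed

lemma integral_indicator_density:
  fixes p :: "'a \<Rightarrow> real"
  assumes p: "integrable M p" "\<And>x. 0 \<le> p x" and A: "A \<in> sets M"
  shows "measure (density M (\<lambda>x. ennreal (p x))) A = (LINT x|M. indicator A x * p x)"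
proof -
  have i: "integrable M (\<lambda>x. indicator A x * p x)" using integrable_mult_indicator[OF A p(1)] by simp
  have "emeasure (density M (\<lambda>x. ennreal (p x))) A = (\<integral>\<^sup>+x. ennreal (indicator A x * p x) \<partial>M)"
    using p A by (subst emeasure_density) (auto intro!: nn_integral_cong simp: indicator_def)
  also have "\<dots> = ennreal (LINT x|M. indicator A x * p x)"
    by (rule nn_integral_eq_integral[OF i]) (use p in auto)
  finally show ?thesis using p(2) by (simp add: measure_def Bochner_Integration.integral_nonneg)
qed

text \<open>Partition by the values of \<open>\<zeta>\<close>: on a set where \<open>\<zeta>\<close> varies by less than \<open>\<eta>\<close> the norm of the integral
  is close to the integral of the norm.\<close>

lemma variation_density:
  fixes \<zeta> :: "'a::euclidean_space \<Rightarrow> 'a"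
  assumes fin: "finite_measure M" and sets: "sets M = sets borel" and \<zeta>: "integrable M \<zeta>"
    and \<Omega>: "\<Omega> \<in> sets borel"
    and \<sigma>: "\<And>A. A \<in> sets borel \<Longrightarrow> A \<subseteq> \<Omega> \<Longrightarrow> \<sigma> A = (LINT x|M. indicator A x *\<^sub>R \<zeta> x)"
  shows "variation \<sigma> \<Omega> = ennreal (LINT x|M. indicator \<Omega> x * norm (\<zeta> x))"
proof -
  interpret finite_measure M by fact
  define m where "m A = (LINT x|M. indicator A x * norm (\<zeta> x))" for A
  define D where "D = density M (\<lambda>x. ennreal (norm (\<zeta> x)))"
  have sD: "sets D = sets borel" by (simp add: D_def sets)
  have \<zeta>m: "\<zeta> \<in> borel_measurable borel" using borel_measurable_integrable[OF \<zeta>] measurable_cong_sets[OF sets refl] by blast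
  have spM: "space M = UNIV" using sets_eq_imp_space_eq[OF sets] by simp
  have iA: "integrable M (\<lambda>x. indicator A x * norm (\<zeta> x))" "integrable M (\<lambda>x. indicator A x *\<^sub>R \<zeta> x)" if "A \<in> sets borel" for A
    using integrable_mult_indicator[of A M "\<lambda>x. norm (\<zeta> x)"] integrable_mult_indicator[of A M \<zeta>] \<zeta> that sets by auto
  have m0: "m A \<ge> 0" for A unfolding m_def by (intro Bochner_Integration.integral_nonneg) auto
  have Dm: "emeasure D A = ennreal (m A)" if "A \<in> sets borel" for A
  proof -
    have "emeasure D A = (\<integral>\<^sup>+x. ennreal (indicator A x * norm (\<zeta> x)) \<partial>M)"
      unfolding D_def using \<zeta> that sets by (subst emeasure_density) (auto intro!: nn_integral_cong simp: indicator_def)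
    also have "\<dots> = ennreal (m A)" unfolding m_def by (rule nn_integral_eq_integral[OF iA(1)[OF that]]) simp
    finally show ?thesis .
  qed
  have \<sigma>m: "norm (\<sigma> A) \<le> m A" if "A \<in> sets borel" "A \<subseteq> \<Omega>" for A
  proof -
    have "norm (\<sigma> A) \<le> (LINT x|M. norm (indicator A x *\<^sub>R \<zeta> x))" unfolding \<sigma>[OF that] by (rule integral_norm_bound)
    then show ?thesis by (simp add: m_def)
  qed
  have "variation \<sigma> \<Omega> \<le> ennreal (m \<Omega>)"
    unfolding variation_def
  proof (rule SUP_least)
    fix A assume "A \<in> {A :: nat \<Rightarrow> 'a set. (\<forall>i. A i \<in> sets borel) \<and> disjoint_family A \<and> (\<Union>i. A i) = \<Omega>}"
    then have A: "\<And>i. A i \<in> sets borel" "disjoint_family A" "(\<Union>i. A i) = \<Omega>" by auto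
    have "(\<Sum>i. ennreal (norm (\<sigma> (A i)))) \<le> (\<Sum>i. emeasure D (A i))"
      using A \<sigma>m by (intro suminf_le) (auto simp: Dm intro!: ennreal_leI)
    also have "\<dots> = emeasure D (\<Union>i. A i)" using A sD by (intro suminf_emeasure) auto
    finally show "(\<Sum>i. ennreal (norm (\<sigma> (A i)))) \<le> ennreal (m \<Omega>)" using A \<Omega> by (simp add: Dm)
  qed
  moreover have "ennreal (m \<Omega>) \<le> variation \<sigma> \<Omega>"
  proof (rule ennreal_le_epsilon)
    fix e :: real assume e: "e > 0"
    define \<mu> where "\<mu> = measure M (space M)"
    define \<eta> where "\<eta> = e / (2 * (\<mu> + 1))"
    have \<mu>: "\<mu> \<ge> 0" by (simp add: \<mu>_def)
    have \<eta>: "\<eta> > 0" "2 * \<eta> * \<mu> \<le> e" using e \<mu> by (auto simp: \<eta>_def field_simps)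
    obtain E :: "'a set" where E: "countable E" "\<And>X. open X \<Longrightarrow> X \<noteq> {} \<Longrightarrow> \<exists>d\<in>E. d \<in> X"
      by (rule countable_dense_setE) blast
    have E0: "E \<noteq> {}" using E(2)[of UNIV] by auto
    define d where "d = from_nat_into E"
    define c where "c = disjointed (\<lambda>i. ball (d i) \<eta>)"
    define A where "A i = \<Omega> \<inter> \<zeta> -` c i" for i
    have "range c \<subseteq> sets borel" unfolding c_def by (rule sets.range_disjointed_sets) auto
    then have cb: "c i \<in> sets borel" for i by auto
    have Ab: "A i \<in> sets borel" "A i \<subseteq> \<Omega>" for i
      using measurable_sets[OF \<zeta>m cb[of i]] \<Omega> by (auto simp: A_def)
    have Ad: "disjoint_family A"
      using disjoint_family_disjointed[of "\<lambda>i. ball (d i) \<eta>"] by (auto simp: A_def c_def disjoint_family_on_def)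
    have "(\<Union>i. c i) = UNIV"
    proof -
      have "y \<in> (\<Union>i. ball (d i) \<eta>)" for y
      proof -
        obtain z where z: "z \<in> E" "z \<in> ball y \<eta>" using E(2)[of "ball y \<eta>"] \<eta> by auto
        obtain i where "d i = z" using from_nat_into_surj[OF E(1) z(1)] by (auto simp: d_def)
        then show ?thesis using z by (auto simp: dist_commute)
      qed
      then show ?thesis unfolding c_def UN_disjointed_eq by auto
    qed
    then have "\<exists>i. \<zeta> x \<in> c i" for x by blast
    then have Au: "(\<Union>i. A i) = \<Omega>" by (auto simp: A_def)
    have cell: "m (A i) \<le> norm (\<sigma> (A i)) + 2 * \<eta> * measure M (A i)" for i
    proof -
      have AiM: "A i \<in> sets M" using Ab sets by simp
      have near: "norm (\<zeta> x - d i) \<le> \<eta>" if "x \<in> A i" for x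
        using that disjointed_subset[of "\<lambda>i. ball (d i) \<eta>" i] by (auto simp: A_def c_def dist_norm norm_minus_commute subset_iff)
      have ic: "integrable M (\<lambda>x. indicator (A i) x *\<^sub>R v)" for v :: 'a
        using AiM by (intro integrable_mult_indicator) auto
      have ir: "integrable M (\<lambda>x. indicator (A i) x * (r::real))" for r
        using AiM by (auto intro!: integrable_mult_left integrable_real_indicator simp: emeasure_eq_measure)
      have "m (A i) \<le> (LINT x|M. indicator (A i) x * (norm (d i) + \<eta>))"
        unfolding m_def
      proof (rule integral_mono[OF iA(1)[OF Ab(1)] ir])
        fix x
        have "norm (\<zeta> x) \<le> norm (d i) + \<eta>" if "x \<in> A i"
          using near[OF that] norm_triangle_ineq2[of "\<zeta> x" "d i"] by linarith
        then show "indicator (A i) x * norm (\<zeta> x) \<le> indicator (A i) x * (norm (d i) + \<eta>)" by (auto simp: indicator_def)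
      qed
      also have "\<dots> = (LINT x|M. indicator (A i) x * norm (d i)) + (LINT x|M. indicator (A i) x * \<eta>)"
        unfolding distrib_left by (rule Bochner_Integration.integral_add[OF ir ir])
      also have "\<dots> = norm (d i) * measure M (A i) + \<eta> * measure M (A i)"
        using AiM by (simp add: mult.commute)
      also have "norm (d i) * measure M (A i) = norm (LINT x|M. indicator (A i) x *\<^sub>R d i)"
        using AiM by (simp add: emeasure_eq_measure mult.commute)
      also have "(LINT x|M. indicator (A i) x *\<^sub>R d i) = \<sigma> (A i) + (LINT x|M. indicator (A i) x *\<^sub>R (d i - \<zeta> x))"
        unfolding \<sigma>[OF Ab] using ic iA(2)[OF Ab(1)] by (simp add: scaleR_diff_right)
      also have "norm \<dots> \<le> norm (\<sigma> (A i)) + norm (LINT x|M. indicator (A i) x *\<^sub>R (d i - \<zeta> x))"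
        by (rule norm_triangle_ineq)
      also have "norm (LINT x|M. indicator (A i) x *\<^sub>R (d i - \<zeta> x)) \<le> (LINT x|M. indicator (A i) x * \<eta>)"
      proof (rule order_trans[OF integral_norm_bound integral_mono])
        show "integrable M (\<lambda>x. norm (indicator (A i) x *\<^sub>R (d i - \<zeta> x)))"
          using ic iA(2)[OF Ab(1)] by (intro integrable_norm) (simp add: scaleR_diff_right)
        show "norm (indicator (A i) x *\<^sub>R (d i - \<zeta> x)) \<le> indicator (A i) x * \<eta>" for x
          using near[of x] by (auto simp: indicator_def norm_minus_commute)
      qed (rule ir)
      also have "\<dots> = \<eta> * measure M (A i)" using AiM by (simp add: mult.commute)
      finally show ?thesis by (simp add: algebra_simps)
    qed
    have "ennreal (m \<Omega>) = (\<Sum>i. emeasure D (A i))"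
      using Ab Ad sD \<Omega> by (subst suminf_emeasure) (auto simp: Au Dm)
    also have "\<dots> \<le> (\<Sum>i. ennreal (norm (\<sigma> (A i))) + ennreal (2 * \<eta>) * emeasure M (A i))"
    proof (intro suminf_le)
      fix i
      show "emeasure D (A i) \<le> ennreal (norm (\<sigma> (A i))) + ennreal (2 * \<eta>) * emeasure M (A i)"
        using ennreal_leI[OF cell[of i]] \<eta>
        by (simp add: Dm[OF Ab(1)] emeasure_eq_measure ennreal_plus ennreal_mult)
    qed auto
    also have "\<dots> = (\<Sum>i. ennreal (norm (\<sigma> (A i)))) + (\<Sum>i. ennreal (2 * \<eta>) * emeasure M (A i))"
      by (rule suminf_add[symmetric]) auto
    also have "\<dots> \<le> variation \<sigma> \<Omega> + ennreal e"
    proof (rule add_mono)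
      show "(\<Sum>i. ennreal (norm (\<sigma> (A i)))) \<le> variation \<sigma> \<Omega>"
        unfolding variation_def by (rule SUP_upper) (use Ab Ad Au in auto)
      have "(\<Sum>i. ennreal (2 * \<eta>) * emeasure M (A i)) = ennreal (2 * \<eta>) * (\<Sum>i. emeasure M (A i))"
        by (rule ennreal_suminf_cmult)
      also have "(\<Sum>i. emeasure M (A i)) = emeasure M \<Omega>"
        using Ab Ad sets by (subst suminf_emeasure) (auto simp: Au)
      also have "emeasure M \<Omega> \<le> ennreal \<mu>"
        unfolding \<mu>_def emeasure_eq_measure using \<Omega> sets by (intro ennreal_leI finite_measure_mono) (auto simp: spM)
      then have "ennreal (2 * \<eta>) * emeasure M \<Omega> \<le> ennreal (2 * \<eta>) * ennreal \<mu>" by (rule mult_left_mono) simp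
      also have "\<dots> = ennreal (2 * \<eta> * \<mu>)" using \<eta> \<mu> by (intro ennreal_mult[symmetric]) auto
      also have "\<dots> \<le> ennreal e" by (rule ennreal_leI[OF \<eta>(2)])
      finally show "(\<Sum>i. ennreal (2 * \<eta>) * emeasure M (A i)) \<le> ennreal e" .
    qed
    finally show "ennreal (m \<Omega>) \<le> variation \<sigma> \<Omega> + ennreal e" .
  qed
  ultimately show ?thesis unfolding m_def[symmetric] by (rule antisym)
qed

section \<open>Splitting the distributional derivative\<close>

text \<open>Apply \<open>integral_difference_measures_eq\<close> to the measures whose densities are the positive and negative
  parts of \<open>F\<close> and \<open>G\<close>.\<close>

lemma integral_eq_of_set_integrals_eq:
  fixes F :: "'a \<Rightarrow> real" and G :: "'a \<Rightarrow> real"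
  assumes F: "integrable M F" and G: "integrable N G" and sets: "sets M = sets B" "sets N = sets B"
    and eq: "\<And>A. A \<in> sets B \<Longrightarrow> (LINT x|M. indicator A x * F x) = (LINT x|N. indicator A x * G x)"
    and \<phi>: "\<phi> \<in> borel_measurable B" "\<And>x. \<bar>\<phi> x\<bar> \<le> C"
  shows "(LINT x|M. \<phi> x * F x) = (LINT x|N. \<phi> x * G x)"
proof -
  have key: "finite_measure (density L (\<lambda>x. ennreal (max 0 (H x))))" "sets (density L (\<lambda>x. ennreal (max 0 (H x)))) = sets B"
    "\<And>A. A \<in> sets B \<Longrightarrow> measure (density L (\<lambda>x. ennreal (max 0 (H x)))) A = (LINT x|L. indicator A x * max 0 (H x))"
    "(LINT x|density L (\<lambda>x. ennreal (max 0 (H x))). \<phi> x) = (LINT x|L. \<phi> x * max 0 (H x))"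
    "integrable L (\<lambda>x. \<phi> x * max 0 (H x))"
    if H: "integrable L H" and L: "sets L = sets B" for L and H :: "'a \<Rightarrow> real"
  proof -
    have i: "integrable L (\<lambda>x. max 0 (H x))" using H by simp
    have \<phi>L: "\<phi> \<in> borel_measurable L" using \<phi>(1) measurable_cong_sets[OF L refl] by blast
    show "finite_measure (density L (\<lambda>x. ennreal (max 0 (H x))))"
    proof (rule finite_measureI)
      have "emeasure (density L (\<lambda>x. ennreal (max 0 (H x)))) (space L) = (\<integral>\<^sup>+x. ennreal (max 0 (H x)) \<partial>L)"
        using i by (subst emeasure_density) (auto intro!: nn_integral_cong)
      also have "\<dots> = ennreal (LINT x|L. max 0 (H x))" by (rule nn_integral_eq_integral[OF i]) simp
      finally show "emeasure (density L (\<lambda>x. ennreal (max 0 (H x)))) (space (density L (\<lambda>x. ennreal (max 0 (H x))))) \<noteq> \<infinity>"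
        by simp
    qed
    show "sets (density L (\<lambda>x. ennreal (max 0 (H x)))) = sets B" using L by simp
    show "measure (density L (\<lambda>x. ennreal (max 0 (H x)))) A = (LINT x|L. indicator A x * max 0 (H x))" if "A \<in> sets B" for A
      by (rule integral_indicator_density[OF i]) (use that L in auto)
    show "(LINT x|density L (\<lambda>x. ennreal (max 0 (H x))). \<phi> x) = (LINT x|L. \<phi> x * max 0 (H x))"
      using i \<phi>L by (subst integral_density) (auto simp: mult.commute)
    show "integrable L (\<lambda>x. \<phi> x * max 0 (H x))"
      by (rule integrable_bounded_mult[OF i \<phi>L \<phi>(2)])
  qed
  have split: "(LINT x|L. \<psi> x * H x) = (LINT x|L. \<psi> x * max 0 (H x)) - (LINT x|L. \<psi> x * max 0 (- H x))"
    if "integrable L (\<lambda>x. \<psi> x * max 0 (H x))" "integrable L (\<lambda>x. \<psi> x * max 0 (- H x))" for L \<psi> and H :: "'a \<Rightarrow> real"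
  proof -
    have "(LINT x|L. \<psi> x * H x) = (LINT x|L. \<psi> x * max 0 (H x) - \<psi> x * max 0 (- H x))"
      by (intro Bochner_Integration.integral_cong refl) (auto simp: max_def)
    then show ?thesis using that by simp
  qed
  have iF: "integrable M (\<lambda>x. - F x)" and iG: "integrable N (\<lambda>x. - G x)" using F G by simp_all
  have ind: "integrable L (\<lambda>x. indicator A x * max 0 (H x))" if "integrable L H" "A \<in> sets L" for L A and H :: "'a \<Rightarrow> real"
    using integrable_mult_indicator[of A L "\<lambda>x. max 0 (H x)"] that by simp
  have "(LINT x|density M (\<lambda>x. ennreal (max 0 (F x))). \<phi> x) - (LINT x|density M (\<lambda>x. ennreal (max 0 (- F x))). \<phi> x) =
    (LINT x|density N (\<lambda>x. ennreal (max 0 (G x))). \<phi> x) - (LINT x|density N (\<lambda>x. ennreal (max 0 (- G x))). \<phi> x)"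
  proof (rule integral_difference_measures_eq[OF key(1)[OF F sets(1)] key(1)[OF iF sets(1)] key(1)[OF G sets(2)] key(1)[OF iG sets(2)]
        key(2)[OF F sets(1)] key(2)[OF iF sets(1)] key(2)[OF G sets(2)] key(2)[OF iG sets(2)] _ \<phi>])
    fix A assume A: "A \<in> sets B"
    have "(LINT x|M. indicator A x * max 0 (F x)) - (LINT x|M. indicator A x * max 0 (- F x)) =
      (LINT x|N. indicator A x * max 0 (G x)) - (LINT x|N. indicator A x * max 0 (- G x))"
      using split[of M "indicator A" F, OF ind[OF F] ind[OF iF]] split[of N "indicator A" G, OF ind[OF G] ind[OF iG]] A sets eq[OF A] by simp
    then show "measure (density M (\<lambda>x. ennreal (max 0 (F x)))) A - measure (density M (\<lambda>x. ennreal (max 0 (- F x)))) A =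
      measure (density N (\<lambda>x. ennreal (max 0 (G x)))) A - measure (density N (\<lambda>x. ennreal (max 0 (- G x)))) A"
      by (simp only: key(3)[OF F sets(1) A] key(3)[OF iF sets(1) A] key(3)[OF G sets(2) A] key(3)[OF iG sets(2) A])
  qed
  then show ?thesis
    unfolding key(4)[OF F sets(1)] key(4)[OF iF sets(1)] key(4)[OF G sets(2)] key(4)[OF iG sets(2)]
    using split[OF key(5)[OF F sets(1)] key(5)[OF iF sets(1)]] split[OF key(5)[OF G sets(2)] key(5)[OF iG sets(2)]] by simp
qed

lemma lebesgue_borel_version:
  fixes f :: "'a::euclidean_space \<Rightarrow> 'b::euclidean_space"
  assumes f: "f \<in> borel_measurable lebesgue"
  obtains f' where "f' \<in> borel_measurable borel" "AE x in lborel. f x = f' x"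
proof -
  have "\<exists>g\<in>borel_measurable lborel. (AE x in lborel. f x \<bullet> b = g x)" for b
    using f by (intro completion_ex_borel_measurable_real) auto
  then obtain g where g: "\<And>b. g b \<in> borel_measurable lborel" "\<And>b. AE x in lborel. f x \<bullet> b = g b x" by metis
  have gb [measurable]: "g b \<in> borel_measurable borel" for b using g(1)[of b] by simp
  show ?thesis
  proof (rule that[of "\<lambda>x. \<Sum>b\<in>Basis. g b x *\<^sub>R b"])
    show "(\<lambda>x. \<Sum>b\<in>Basis. g b x *\<^sub>R b) \<in> borel_measurable borel" by measurable
    have "AE x in lborel. \<forall>b\<in>Basis. f x \<bullet> b = g b x" by (rule AE_finite_allI[OF finite_Basis g(2)])
    then show "AE x in lborel. f x = (\<Sum>b\<in>Basis. g b x *\<^sub>R b)"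
    proof eventually_elim
      case (elim x)
      then have "(\<Sum>b\<in>Basis. g b x *\<^sub>R b) = (\<Sum>b\<in>Basis. (f x \<bullet> b) *\<^sub>R b)" by (intro sum.cong) auto
      then show ?case by (simp add: euclidean_representation)
    qed
  qed
qed

lemma set_integrable_borel_version:
  fixes f :: "'a::euclidean_space \<Rightarrow> 'b::euclidean_space"
  assumes f: "set_integrable lebesgue \<Omega> f" and \<Omega>: "\<Omega> \<in> sets borel"
  obtains f' where "integrable lborel f'" "\<And>x. x \<notin> \<Omega> \<Longrightarrow> f' x = 0" "AE x in lborel. x \<in> \<Omega> \<longrightarrow> f x = f' x"
    "\<And>A. A \<in> sets borel \<Longrightarrow> A \<subseteq> \<Omega> \<Longrightarrow> (LINT x:A|lebesgue. f x) = (LINT x|lborel. indicator A x *\<^sub>R f' x)"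
proof -
  have i: "integrable lebesgue (\<lambda>x. indicator \<Omega> x *\<^sub>R f x)" using f by (simp add: set_integrable_def)
  then have m: "(\<lambda>x. indicator \<Omega> x *\<^sub>R f x) \<in> borel_measurable lebesgue" by auto
  obtain g where g: "g \<in> borel_measurable borel" "AE x in lborel. indicator \<Omega> x *\<^sub>R f x = g x"
    by (rule lebesgue_borel_version[OF m])
  define f' where "f' x = indicator \<Omega> x *\<^sub>R g x" for x
  have f'm: "f' \<in> borel_measurable borel" unfolding f'_def[abs_def] using g(1) \<Omega> by measurable
  have ae: "AE x in lborel. indicator \<Omega> x *\<^sub>R f x = f' x"
    using g(2) by eventually_elim (auto simp: f'_def indicator_def)
  have aec: "AE x in lebesgue. indicator \<Omega> x *\<^sub>R f x = f' x" using ae by (rule AE_completion)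
  have f'c: "f' \<in> borel_measurable lebesgue" using f'm by (intro measurable_completion) simp
  have "integrable lebesgue f'" using integrable_cong_AE[OF m f'c aec] i by simp
  then have il: "integrable lborel f'" using integrable_completion[of f' lborel] f'm by simp
  show ?thesis
  proof (rule that[OF il])
    show "f' x = 0" if "x \<notin> \<Omega>" for x using that by (simp add: f'_def)
    show "AE x in lborel. x \<in> \<Omega> \<longrightarrow> f x = f' x" using ae by eventually_elim auto
    fix A assume A: "A \<in> sets borel" "A \<subseteq> \<Omega>"
    have ai: "indicator A x *\<^sub>R f x = indicator A x *\<^sub>R (indicator \<Omega> x *\<^sub>R f x)" for x
      using A(2) by (auto simp: indicator_def)
    have Ac: "A \<in> sets lebesgue" using A(1) by simp
    have "(LINT x:A|lebesgue. f x) = (LINT x|lebesgue. indicator A x *\<^sub>R (indicator \<Omega> x *\<^sub>R f x))"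
      unfolding set_lebesgue_integral_def by (rule Bochner_Integration.integral_cong[OF refl ai])
    also have "\<dots> = (LINT x|lebesgue. indicator A x *\<^sub>R f' x)"
    proof (rule integral_cong_AE)
      show "(\<lambda>x. indicator A x *\<^sub>R (indicator \<Omega> x *\<^sub>R f x)) \<in> borel_measurable lebesgue"
        by (rule borel_measurable_scaleR[OF borel_measurable_indicator[OF Ac] m])
      show "(\<lambda>x. indicator A x *\<^sub>R f' x) \<in> borel_measurable lebesgue"
        by (rule borel_measurable_scaleR[OF borel_measurable_indicator[OF Ac] f'c])
      show "AE x in lebesgue. indicator A x *\<^sub>R (indicator \<Omega> x *\<^sub>R f x) = indicator A x *\<^sub>R f' x"
        using aec by eventually_elim simp
    qed
    also have "\<dots> = (LINT x|lborel. indicator A x *\<^sub>R f' x)"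
      using f'm A(1) by (intro integral_completion) simp
    finally show "(LINT x:A|lebesgue. f x) = (LINT x|lborel. indicator A x *\<^sub>R f' x)" .
  qed
qed

text \<open>Transports the measures on subsets of \<open>\<Omega>\<close> from \<^const>\<open>has_signed_integral\<close> to measures on the whole
  space.\<close>

lemma restricted_measure_extension:
  fixes P :: "'a::euclidean_space measure"
  assumes fin: "finite_measure P" and sets: "sets P = sets (restrict_space borel \<Omega>)" and \<Omega>: "\<Omega> \<in> sets borel"
  obtains E where "finite_measure E" "sets E = sets borel" "\<And>A. A \<in> sets borel \<Longrightarrow> measure E A = measure P (A \<inter> \<Omega>)"
    "\<And>\<phi>. \<phi> \<in> borel_measurable borel \<Longrightarrow> (LINT x|E. \<phi> x) = (LINT x|P. (\<phi> x :: real))"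
proof -
  have sp: "space P = \<Omega>" using sets_eq_imp_space_eq[OF sets] by (simp add: space_restrict_space)
  have id: "(\<lambda>x. x) \<in> measurable P borel"
    unfolding measurable_cong_sets[OF sets refl] by (rule measurable_restrict_space1) simp
  show ?thesis
  proof (rule that[of "distr P borel (\<lambda>x. x)"])
    show "finite_measure (distr P borel (\<lambda>x. x))" by (rule finite_measure.finite_measure_distr[OF fin id])
    show "measure (distr P borel (\<lambda>x. x)) A = measure P (A \<inter> \<Omega>)" if "A \<in> sets borel" for A
      using that id by (simp add: measure_distr sp)
    show "(LINT x|distr P borel (\<lambda>x. x). \<phi> x) = (LINT x|P. \<phi> x)" if "\<phi> \<in> borel_measurable borel" for \<phi> :: "'a \<Rightarrow> real"
      using that id by (intro integral_distr)
  qed simp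
qed

lemma test_function_zero: "test_function \<Omega> (\<lambda>_. 0)"
  by (rule test_functionI[of _ "{}"]) (auto intro: Ck_const)

text \<open>A distributional derivative is a difference of finite measures in each component, hence has a
  density with respect to their sum.\<close>

lemma bv_deriv_has_density:
  fixes \<Omega> :: "'a::euclidean_space set"
  assumes \<Omega>: "open \<Omega>" and u: "u \<in> BV \<Omega>"
  obtains M \<xi> where "finite_measure M" "sets M = sets borel" "integrable M \<xi>" "\<And>x. x \<notin> \<Omega> \<Longrightarrow> \<xi> x = 0"
    "\<And>A. A \<in> sets borel \<Longrightarrow> A \<subseteq> \<Omega> \<Longrightarrow> bv_deriv \<Omega> u A = (LINT x|M. indicator A x *\<^sub>R \<xi> x)"
    "\<And>\<phi> b. test_function \<Omega> \<phi> \<Longrightarrow> b \<in> Basis \<Longrightarrow>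
      (LINT x|M. \<phi> x * (\<xi> x \<bullet> b)) = - (LINT x:\<Omega>|lebesgue. u x * frechet_derivative \<phi> (at x) b)"
proof -
  define \<nu> where "\<nu> = bv_deriv \<Omega> u"
  have \<Omega>b: "\<Omega> \<in> sets borel" using \<Omega> by simp
  have dd: "is_distributional_derivative \<Omega> u \<nu>"
    unfolding \<nu>_def bv_deriv_def using u by (intro someI_ex[of "is_distributional_derivative \<Omega> u"]) (auto simp: BV_def)
  define J where "J \<phi> b = - (LINT x:\<Omega>|lebesgue. u x * frechet_derivative \<phi> (at x) b)" for \<phi> b
  have rep: "\<exists>P Q. finite_measure P \<and> finite_measure Q \<and> sets P = sets (borel :: 'a measure) \<and> sets Q = sets (borel :: 'a measure) \<and>
     (\<forall>A\<in>sets borel. \<nu> (A \<inter> \<Omega>) \<bullet> b = measure P A - measure Q A) \<and> (LINT x|P. \<phi> x) - (LINT x|Q. \<phi> x) = J \<phi> b"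
    if \<phi>: "test_function \<Omega> \<phi>" and b: "b \<in> Basis" for \<phi> b
  proof -
    have "has_signed_integral \<Omega> (\<lambda>A. \<nu> A \<bullet> b) \<phi> (J \<phi> b)"
      using dd \<phi> b unfolding is_distributional_derivative_def J_def by blast
    then obtain P Q where PQ: "finite_measure P" "finite_measure Q" "sets P = sets (restrict_space borel \<Omega>)"
      "sets Q = sets (restrict_space borel \<Omega>)" "\<And>A. A \<in> sets (restrict_space borel \<Omega>) \<Longrightarrow> \<nu> A \<bullet> b = measure P A - measure Q A"
      "J \<phi> b = (LINT x|P. \<phi> x) - (LINT x|Q. \<phi> x)"
      unfolding has_signed_integral_def by (elim exE conjE) (rule that, auto)
    obtain P' where P': "finite_measure P'" "sets P' = sets borel" "\<And>A. A \<in> sets borel \<Longrightarrow> measure P' A = measure P (A \<inter> \<Omega>)"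
      "\<And>\<phi>. \<phi> \<in> borel_measurable borel \<Longrightarrow> (LINT x|P'. \<phi> x) = (LINT x|P. (\<phi> x :: real))"
      by (rule restricted_measure_extension[OF PQ(1,3) \<Omega>b]) blast
    obtain Q' where Q': "finite_measure Q'" "sets Q' = sets borel" "\<And>A. A \<in> sets borel \<Longrightarrow> measure Q' A = measure Q (A \<inter> \<Omega>)"
      "\<And>\<phi>. \<phi> \<in> borel_measurable borel \<Longrightarrow> (LINT x|Q'. \<phi> x) = (LINT x|Q. (\<phi> x :: real))"
      by (rule restricted_measure_extension[OF PQ(2,4) \<Omega>b]) blast
    have "A \<inter> \<Omega> \<in> sets (restrict_space borel \<Omega>)" if "A \<in> sets borel" for A
      using that \<Omega>b by (auto simp: sets_restrict_space_iff)
    then show ?thesis using P' Q' PQ test_function_borel[OF \<phi>] by (intro exI[of _ P'] exI[of _ Q']) auto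
  qed
  have "\<forall>b\<in>Basis. \<exists>P Q. finite_measure P \<and> finite_measure Q \<and> sets P = sets (borel :: 'a measure) \<and> sets Q = sets (borel :: 'a measure) \<and>
     (\<forall>A\<in>sets borel. \<nu> (A \<inter> \<Omega>) \<bullet> b = measure P A - measure Q A)"
    using rep[OF test_function_zero] by blast
  then obtain P Q where P: "\<And>b. b \<in> Basis \<Longrightarrow> finite_measure (P b)" "\<And>b. b \<in> Basis \<Longrightarrow> sets (P b) = sets (borel :: 'a measure)"
    and Q: "\<And>b. b \<in> Basis \<Longrightarrow> finite_measure (Q b)" "\<And>b. b \<in> Basis \<Longrightarrow> sets (Q b) = sets (borel :: 'a measure)"
    and PQ: "\<And>b A. b \<in> Basis \<Longrightarrow> A \<in> sets borel \<Longrightarrow> \<nu> (A \<inter> \<Omega>) \<bullet> b = measure (P b) A - measure (Q b) A" by metis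
  have PQ\<phi>: "(LINT x|P b. \<phi> x) - (LINT x|Q b. \<phi> x) = J \<phi> b" if \<phi>: "test_function \<Omega> \<phi>" and b: "b \<in> Basis" for \<phi> b
  proof -
    obtain P' Q' where P': "finite_measure P'" "finite_measure Q'" "sets P' = sets (borel :: 'a measure)" "sets Q' = sets (borel :: 'a measure)"
     "\<And>A. A \<in> sets borel \<Longrightarrow> \<nu> (A \<inter> \<Omega>) \<bullet> b = measure P' A - measure Q' A" "(LINT x|P'. \<phi> x) - (LINT x|Q'. \<phi> x) = J \<phi> b"
      using rep[OF \<phi> b] by blast
    obtain C where C: "\<And>x. \<bar>\<phi> x\<bar> \<le> C" using test_function_bounded[OF \<phi>] by metis
    have "(LINT x|P b. \<phi> x) - (LINT x|Q b. \<phi> x) = (LINT x|P'. \<phi> x) - (LINT x|Q'. \<phi> x)"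
      by (rule integral_difference_measures_eq[OF P(1)[OF b] Q(1)[OF b] P'(1,2) P(2)[OF b] Q(2)[OF b] P'(3,4) _ test_function_borel[OF \<phi>] C])
        (metis PQ[OF b] P'(5))
    then show ?thesis using P'(6) by simp
  qed
  define N where "N i = (if snd i then P (fst i) else Q (fst i))" for i :: "'a \<times> bool"
  obtain M where M: "finite_measure M" "sets M = sets (borel :: 'a measure)"
    "\<And>A. A \<in> sets (borel :: 'a measure) \<Longrightarrow> emeasure M A = (\<Sum>i\<in>Basis \<times> UNIV. emeasure (N i) A)"
    by (rule finite_sum_measure[of "Basis \<times> (UNIV :: bool set)" N "borel :: 'a measure"]) (use P Q in \<open>auto simp: N_def\<close>)
  have sf: "sigma_finite_measure M" using M(1) by (simp add: finite_measure_def)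
  have dens: "\<exists>p. integrable M p \<and> (\<forall>x. 0 \<le> p x) \<and> N i = density M (\<lambda>x. ennreal (p x))" if i: "i \<in> Basis \<times> UNIV" for i
  proof -
    have Ni: "finite_measure (N i)" "sets (N i) = sets M" using i P Q M by (auto simp: N_def)
    have "absolutely_continuous M (N i)"
      unfolding absolutely_continuous_def
    proof
      fix A assume A: "A \<in> null_sets M"
      then have Ab: "A \<in> sets borel" and "emeasure M A = 0" using M(2) by auto
      then have "(\<Sum>i\<in>Basis \<times> UNIV. emeasure (N i) A) = 0" using M(3)[OF Ab] by simp
      then have "emeasure (N i) A = 0" using i by (subst (asm) sum_eq_0_iff) auto
      then show "A \<in> null_sets (N i)" using A Ni(2) by (auto simp: null_sets_def)
    qed
    from finite_measure_real_density[OF sf Ni this] show ?thesis by metis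
  qed
  then obtain p where p: "\<And>i. i \<in> Basis \<times> UNIV \<Longrightarrow> integrable M (p i)" "\<And>i x. i \<in> Basis \<times> UNIV \<Longrightarrow> 0 \<le> p i x"
    "\<And>i. i \<in> Basis \<times> UNIV \<Longrightarrow> N i = density M (\<lambda>x. ennreal (p i x))" by metis
  define \<xi>0 where "\<xi>0 x = (\<Sum>b\<in>Basis. (p (b, True) x - p (b, False) x) *\<^sub>R b)" for x
  define \<xi> where "\<xi> x = indicator \<Omega> x *\<^sub>R \<xi>0 x" for x
  have \<xi>0b: "\<xi>0 x \<bullet> b = p (b, True) x - p (b, False) x" if "b \<in> Basis" for x b
    unfolding \<xi>0_def using that by simp
  have \<xi>0i: "integrable M \<xi>0" unfolding \<xi>0_def[abs_def] using p(1) by (intro Bochner_Integration.integrable_sum) auto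
  have \<xi>i: "integrable M \<xi>" unfolding \<xi>_def[abs_def] using \<xi>0i \<Omega> M(2) by (intro integrable_mult_indicator) auto
  show ?thesis
  proof (rule that[OF M(1,2) \<xi>i])
    show "\<xi> x = 0" if "x \<notin> \<Omega>" for x using that by (simp add: \<xi>_def)
    show "bv_deriv \<Omega> u A = (LINT x|M. indicator A x *\<^sub>R \<xi> x)" if A: "A \<in> sets borel" "A \<subseteq> \<Omega>" for A
      unfolding \<nu>_def[symmetric]
    proof (rule euclidean_eqI)
      fix b :: 'a assume b: "b \<in> Basis"
      have AM: "A \<in> sets M" using A M by simp
      have iA: "integrable M (\<lambda>x. indicator A x *\<^sub>R \<xi> x)" using \<xi>i AM by (intro integrable_mult_indicator)
      have ip: "integrable M (\<lambda>x. indicator A x * p (b, c) x)" for c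
        using integrable_mult_indicator[OF AM p(1)[of "(b, c)"]] b by simp
      have "(LINT x|M. indicator A x *\<^sub>R \<xi> x) \<bullet> b = (LINT x|M. (indicator A x *\<^sub>R \<xi> x) \<bullet> b)"
        by (rule integral_inner_left[symmetric]) (use iA in simp)
      also have "\<dots> = (LINT x|M. indicator A x * p (b, True) x - indicator A x * p (b, False) x)"
        using A(2) by (intro Bochner_Integration.integral_cong refl) (auto simp: \<xi>_def \<xi>0b[OF b] indicator_def)
      also have "\<dots> = measure (N (b, True)) A - measure (N (b, False)) A"
        using ip b AM by (simp add: p(3) integral_indicator_density[OF p(1,2)])
      also have "\<dots> = \<nu> A \<bullet> b" using PQ[OF b A(1)] A(2) by (simp add: N_def inf_absorb1)
      finally show "\<nu> A \<bullet> b = (LINT x|M. indicator A x *\<^sub>R \<xi> x) \<bullet> b" ..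
    qed
    show "(LINT x|M. \<phi> x * (\<xi> x \<bullet> b)) = - (LINT x:\<Omega>|lebesgue. u x * frechet_derivative \<phi> (at x) b)"
      if \<phi>: "test_function \<Omega> \<phi>" and b: "b \<in> Basis" for \<phi> b
    proof -
      obtain C where C: "\<And>x. \<bar>\<phi> x\<bar> \<le> C" using test_function_bounded[OF \<phi>] by metis
      have \<phi>M: "\<phi> \<in> borel_measurable M" using test_function_borel[OF \<phi>] measurable_cong_sets[OF M(2) refl] by blast
      obtain K where K: "K \<subseteq> \<Omega>" "\<And>x. x \<notin> K \<Longrightarrow> \<phi> x = 0" using test_function_support[OF \<phi>] by metis
      have ip: "integrable M (\<lambda>x. \<phi> x * p (b, c) x)" for c
        by (rule integrable_bounded_mult[OF p(1) \<phi>M C]) (use b in auto)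
      have dp: "(LINT x|N (b, c). \<phi> x) = (LINT x|M. \<phi> x * p (b, c) x)" for c
        using b \<phi>M p(1,2)[of "(b, c)"] by (subst p(3), simp, subst integral_density) (auto simp: mult.commute)
      have "\<phi> x * (\<xi> x \<bullet> b) = \<phi> x * p (b, True) x - \<phi> x * p (b, False) x" for x
        using K by (cases "x \<in> \<Omega>") (auto simp: \<xi>_def \<xi>0b[OF b] right_diff_distrib)
      then have "(LINT x|M. \<phi> x * (\<xi> x \<bullet> b)) = (LINT x|N (b, True). \<phi> x) - (LINT x|N (b, False). \<phi> x)"
        using ip by (simp add: dp)
      then show ?thesis using PQ\<phi>[OF \<phi> b] by (simp add: N_def J_def)
    qed
  qed
qed

text \<open>Off \<open>Z\<close> the positive and negative parts of \<open>F M\<close> are absolutely continuous, so both have Radon-Nikodym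
  densities.\<close>

lemma absolutely_continuous_part_density:
  fixes F :: "'a::euclidean_space \<Rightarrow> real"
  assumes M: "finite_measure M" "sets M = sets borel" and F: "integrable M F"
    and Z: "Z \<in> sets borel" "\<And>A. A \<in> null_sets lborel \<Longrightarrow> A - Z \<in> null_sets M"
  obtains a where "integrable lborel a"
    "\<And>A. A \<in> sets borel \<Longrightarrow> (LINT x|M. indicator (A - Z) x * F x) = (LINT x|lborel. indicator A x * a x)"
proof -
  have "\<exists>a. integrable lborel a \<and> (\<forall>A\<in>sets borel. (LINT x|M. indicator (A - Z) x * max 0 (H x)) = (LINT x|lborel. indicator A x * a x))"
    if H: "integrable M H" for H :: "'a \<Rightarrow> real"
  proof -
    define p where "p x = indicator (- Z) x * max 0 (H x)" for x
    have pi: "integrable M p"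
      unfolding p_def[abs_def] using integrable_mult_indicator[of "- Z" M "\<lambda>x. max 0 (H x)"] H Z(1) M(2) by auto
    have p0: "0 \<le> p x" for x by (simp add: p_def)
    define D where "D = density M (\<lambda>x. ennreal (p x))"
    have Dfin: "finite_measure D"
    proof (rule finite_measureI)
      have "emeasure D (space M) = (\<integral>\<^sup>+x. ennreal (p x) \<partial>M)"
        unfolding D_def using pi by (subst emeasure_density) (auto intro!: nn_integral_cong)
      also have "\<dots> = ennreal (LINT x|M. p x)" by (rule nn_integral_eq_integral[OF pi]) (simp add: p0)
      finally show "emeasure D (space D) \<noteq> \<infinity>" by (simp add: D_def)
    qed
    have ac: "absolutely_continuous lborel D"
      unfolding absolutely_continuous_def
    proof
      fix A :: "'a set" assume A: "A \<in> null_sets lborel"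
      have "AE x in M. x \<notin> A - Z" by (rule AE_not_in[OF Z(2)[OF A]])
      then have ae: "AE x in M. x \<in> A \<longrightarrow> ennreal (p x) = 0" by eventually_elim (auto simp: p_def)
      have pm: "(\<lambda>x. ennreal (p x)) \<in> borel_measurable M" using pi by auto
      have "A \<in> sets M" using null_setsD2[OF A] M(2) by simp
      then show "A \<in> null_sets D" unfolding D_def null_sets_density_iff[OF pm] using ae by blast
    qed
    obtain a where a: "integrable lborel a" "\<And>x. 0 \<le> a x" "D = density lborel (\<lambda>x. ennreal (a x))"
      by (rule finite_measure_real_density[OF sigma_finite_lborel Dfin _ ac]) (use M(2) in \<open>auto simp: D_def\<close>)
    have "(LINT x|M. indicator (A - Z) x * max 0 (H x)) = (LINT x|lborel. indicator A x * a x)" if A: "A \<in> sets borel" for A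
    proof -
      have "(LINT x|M. indicator (A - Z) x * max 0 (H x)) = (LINT x|M. indicator A x * p x)"
        by (intro Bochner_Integration.integral_cong refl) (auto simp: p_def indicator_def)
      also have "\<dots> = measure D A" unfolding D_def by (rule integral_indicator_density[OF pi p0, symmetric]) (use A M(2) in simp)
      also have "\<dots> = (LINT x|lborel. indicator A x * a x)" unfolding a(3) by (rule integral_indicator_density[OF a(1,2)]) (use A in simp)
      finally show ?thesis .
    qed
    then show ?thesis using a(1) by blast
  qed
  from this[OF F] this[of "\<lambda>x. - F x"] F
  obtain a1 a2 where a: "integrable lborel a1" "integrable lborel a2"
    "\<And>A. A \<in> sets borel \<Longrightarrow> (LINT x|M. indicator (A - Z) x * max 0 (F x)) = (LINT x|lborel. indicator A x * a1 x)"
    "\<And>A. A \<in> sets borel \<Longrightarrow> (LINT x|M. indicator (A - Z) x * max 0 (- F x)) = (LINT x|lborel. indicator A x * a2 x)"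
    by auto
  show ?thesis
  proof (rule that[of "\<lambda>x. a1 x - a2 x"])
    show "integrable lborel (\<lambda>x. a1 x - a2 x)" using a by simp
    fix A :: "'a set" assume A: "A \<in> sets borel"
    have AZ: "A - Z \<in> sets M" using A Z(1) M(2) by simp
    have i: "integrable M (\<lambda>x. indicator (A - Z) x * max 0 (F x))" "integrable M (\<lambda>x. indicator (A - Z) x * max 0 (- F x))"
      using integrable_mult_indicator[OF AZ, of "\<lambda>x. max 0 (F x)"] integrable_mult_indicator[OF AZ, of "\<lambda>x. max 0 (- F x)"] F by auto
    have j: "integrable lborel (\<lambda>x. indicator A x * a1 x)" "integrable lborel (\<lambda>x. indicator A x * a2 x)"
      using integrable_mult_indicator[of A lborel a1] integrable_mult_indicator[of A lborel a2] A a by auto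
    have "(LINT x|M. indicator (A - Z) x * F x) = (LINT x|M. indicator (A - Z) x * max 0 (F x) - indicator (A - Z) x * max 0 (- F x))"
      by (intro Bochner_Integration.integral_cong refl) (auto simp: max_def)
    also have "\<dots> = (LINT x|lborel. indicator A x * a1 x) - (LINT x|lborel. indicator A x * a2 x)"
      using i by (simp add: a(3,4)[OF A])
    also have "\<dots> = (LINT x|lborel. indicator A x * (a1 x - a2 x))"
      using j by (simp add: right_diff_distrib)
    finally show "(LINT x|M. indicator (A - Z) x * F x) = (LINT x|lborel. indicator A x * (a1 x - a2 x))" .
  qed
qed

text \<open>The choice in \<^const>\<open>bv_grad\<close> has a candidate: the density of \<open>Du\<close> off the null set from
  \<open>singular_carrier\<close>.\<close>

lemma bv_grad_exists:
  fixes \<Omega> :: "'a::euclidean_space set"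
  assumes \<Omega>: "open \<Omega>" and u: "u \<in> BV \<Omega>"
  shows "\<exists>g. set_integrable lebesgue \<Omega> g \<and> singular_on \<Omega> (\<lambda>A. bv_deriv \<Omega> u A - (LINT x:A|lebesgue. g x))"
proof -
  have \<Omega>b: "\<Omega> \<in> sets borel" using \<Omega> by simp
  obtain M \<xi> where M: "finite_measure M" "sets M = sets borel" "integrable M \<xi>" "\<And>x. x \<notin> \<Omega> \<Longrightarrow> \<xi> x = 0"
    and \<nu>: "\<And>A. A \<in> sets borel \<Longrightarrow> A \<subseteq> \<Omega> \<Longrightarrow> bv_deriv \<Omega> u A = (LINT x|M. indicator A x *\<^sub>R \<xi> x)"
    by (rule bv_deriv_has_density[OF \<Omega> u]) blast
  obtain Z where Z: "Z \<in> null_sets lborel" "\<And>A. A \<in> null_sets lborel \<Longrightarrow> A - Z \<in> null_sets M"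
    by (rule singular_carrier[OF M(1,2)]) blast
  have Zb: "Z \<in> sets borel" using Z(1) by auto
  have "\<exists>a. integrable lborel a \<and> (\<forall>A\<in>sets borel. (LINT x|M. indicator (A - Z) x * (\<xi> x \<bullet> b)) = (LINT x|lborel. indicator A x * a x))" for b
  proof -
    have "integrable M (\<lambda>x. \<xi> x \<bullet> b)" using M(3) by simp
    from absolutely_continuous_part_density[OF M(1,2) this Zb Z(2)] show ?thesis by metis
  qed
  then obtain a where a: "\<And>b. integrable lborel (a b)"
    "\<And>b A. A \<in> sets borel \<Longrightarrow> (LINT x|M. indicator (A - Z) x * (\<xi> x \<bullet> b)) = (LINT x|lborel. indicator A x * a b x)" by metis
  define g where "g x = (\<Sum>b\<in>Basis. a b x *\<^sub>R b)" for x
  have gi: "integrable lborel g" unfolding g_def[abs_def] using a(1) by (intro Bochner_Integration.integrable_sum) auto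
  have gm: "g \<in> borel_measurable borel" using gi by auto
  have gA: "(LINT x:A|lebesgue. g x) = (LINT x|lborel. indicator A x *\<^sub>R g x)" if "A \<in> sets borel" for A
    unfolding set_lebesgue_integral_def using gm that by (intro integral_completion) simp
  have zero: "bv_deriv \<Omega> u A - (LINT x:A|lebesgue. g x) = 0" if A: "A \<in> sets borel" "A \<subseteq> \<Omega> - Z" for A
  proof -
    have "(LINT x|M. indicator A x *\<^sub>R \<xi> x) = (LINT x|lborel. indicator A x *\<^sub>R g x)"
    proof (rule euclidean_eqI)
      fix b :: 'a assume b: "b \<in> Basis"
      have i1: "integrable M (\<lambda>x. indicator A x *\<^sub>R \<xi> x)" using M A by (intro integrable_mult_indicator) auto
      have i2: "integrable lborel (\<lambda>x. indicator A x *\<^sub>R g x)" using gi A by (intro integrable_mult_indicator) auto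
      have AZ: "A - Z = A" using A(2) by auto
      have "(LINT x|M. indicator A x *\<^sub>R \<xi> x) \<bullet> b = (LINT x|M. indicator (A - Z) x * (\<xi> x \<bullet> b))"
        unfolding AZ using i1 by (subst integral_inner_left[symmetric]) auto
      also have "\<dots> = (LINT x|lborel. indicator A x * a b x)" by (rule a(2)[OF A(1)])
      also have "\<dots> = (LINT x|lborel. (indicator A x *\<^sub>R g x) \<bullet> b)" using b by (simp add: g_def)
      also have "\<dots> = (LINT x|lborel. indicator A x *\<^sub>R g x) \<bullet> b" using i2 by (intro integral_inner_left) auto
      finally show "(LINT x|M. indicator A x *\<^sub>R \<xi> x) \<bullet> b = (LINT x|lborel. indicator A x *\<^sub>R g x) \<bullet> b" .
    qed
    then show ?thesis using A \<nu>[of A] gA[of A] by auto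
  qed
  have "integrable lebesgue (\<lambda>x. indicator \<Omega> x *\<^sub>R g x)"
    using integrable_mult_indicator[of \<Omega> lborel g] gi \<Omega>b gm by (subst integrable_completion) auto
  then have "set_integrable lebesgue \<Omega> g" by (simp add: set_integrable_def)
  moreover have "singular_on \<Omega> (\<lambda>A. bv_deriv \<Omega> u A - (LINT x:A|lebesgue. g x))"
    unfolding singular_on_def
  proof (intro bexI conjI)
    show "Z \<inter> \<Omega> \<in> null_sets lborel" using Z(1) \<Omega>b by (intro null_set_Int2) auto
    have "variation (\<lambda>A. bv_deriv \<Omega> u A - (LINT x:A|lebesgue. g x)) (\<Omega> - Z \<inter> \<Omega>) \<le> 0"
      unfolding variation_def
    proof (rule SUP_least)
      fix A assume "A \<in> {A :: nat \<Rightarrow> 'a set. (\<forall>i. A i \<in> sets borel) \<and> disjoint_family A \<and> (\<Union>i. A i) = \<Omega> - Z \<inter> \<Omega>}"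
      then have "A i \<in> sets borel" "A i \<subseteq> \<Omega> - Z" for i by auto
      then have "bv_deriv \<Omega> u (A i) - (LINT x:A i|lebesgue. g x) = 0" for i by (rule zero)
      then show "(\<Sum>i. ennreal (norm (bv_deriv \<Omega> u (A i) - (LINT x:A i|lebesgue. g x)))) \<le> 0" by simp
    qed
    then show "variation (\<lambda>A. bv_deriv \<Omega> u A - (LINT x:A|lebesgue. g x)) (\<Omega> - Z \<inter> \<Omega>) = 0" by simp
  qed auto
  ultimately show ?thesis by blast
qed

lemma norm_le_variation:
  assumes "A \<in> sets borel" "B \<in> sets borel" "A \<subseteq> B"
  shows "ennreal (norm (\<sigma> A)) \<le> variation \<sigma> B"
proof -
  have "ennreal (norm (\<sigma> A)) = (\<Sum>i\<in>{0}. ennreal (norm (\<sigma> (binaryset A (B - A) i))))"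
    by (simp add: binaryset_def)
  also have "\<dots> \<le> (\<Sum>i. ennreal (norm (\<sigma> (binaryset A (B - A) i))))"
    by (rule sum_le_suminf) auto
  also have "\<dots> \<le> variation \<sigma> B"
    unfolding variation_def
  proof (rule SUP_upper, intro CollectI conjI)
    have "B - A \<in> sets borel" using assms(1,2) by (rule sets.Diff[rotated])
    then show "\<forall>i. binaryset A (B - A) i \<in> sets borel" using assms(1) by (simp add: binaryset_def)
    show "disjoint_family (binaryset A (B - A))" by (auto simp: disjoint_family_on_def binaryset_def)
    show "(\<Union>i. binaryset A (B - A) i) = B" using assms(3) by (auto simp: UN_binaryset_eq)
  qed
  finally show ?thesis .
qed

text \<open>Let \<open>Du = \<xi> M\<close> and let \<open>Z\<close> be the null set that carries \<open>D\<^sup>su\<close>.  Then \<open>D\<^sup>su\<close> is the restriction of \<open>\<xi> M\<close>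
  to \<open>Z\<close>, and off \<open>Z\<close> the measure \<open>\<xi> M\<close> coincides with \<open>\<nabla>u \<L>\<close>.  The functions \<open>u\<close> and \<open>\<nabla>u\<close>, which
  are only Lebesgue measurable, are replaced by Borel versions that vanish off \<open>\<Omega>\<close>.\<close>

lemma bv_deriv_split:
  fixes \<Omega> :: "'a::euclidean_space set"
  assumes \<Omega>: "open \<Omega>" and u: "u \<in> BV \<Omega>"
  obtains U G M \<zeta> where "split_distributional_derivative \<Omega> U G M \<zeta>"
    "AE x in lborel. x \<in> \<Omega> \<longrightarrow> u x = U x" "AE x in lborel. x \<in> \<Omega> \<longrightarrow> bv_grad \<Omega> u x = G x"
    "variation (bv_sing \<Omega> u) \<Omega> = ennreal (LINT x|M. norm (\<zeta> x))"
proof -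
  have \<Omega>b: "\<Omega> \<in> sets borel" using \<Omega> by simp
  obtain M \<xi> where M: "finite_measure M" "sets M = sets borel" and \<xi>: "integrable M \<xi>" "\<And>x. x \<notin> \<Omega> \<Longrightarrow> \<xi> x = 0"
    and \<nu>: "\<And>A. A \<in> sets borel \<Longrightarrow> A \<subseteq> \<Omega> \<Longrightarrow> bv_deriv \<Omega> u A = (LINT x|M. indicator A x *\<^sub>R \<xi> x)"
    and ibp: "\<And>\<phi> b. test_function \<Omega> \<phi> \<Longrightarrow> b \<in> Basis \<Longrightarrow>
      (LINT x|M. \<phi> x * (\<xi> x \<bullet> b)) = - (LINT x:\<Omega>|lebesgue. u x * frechet_derivative \<phi> (at x) b)"
    by (rule bv_deriv_has_density[OF \<Omega> u], rule that, assumption+)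
  define g where "g = bv_grad \<Omega> u"
  define \<sigma> where "\<sigma> = bv_sing \<Omega> u"
  have gs: "set_integrable lebesgue \<Omega> g \<and> singular_on \<Omega> (\<lambda>A. bv_deriv \<Omega> u A - (LINT x:A|lebesgue. g x))"
    unfolding g_def bv_grad_def by (rule someI_ex[OF bv_grad_exists[OF \<Omega> u]])
  have \<sigma>_eq: "\<sigma> = (\<lambda>A. bv_deriv \<Omega> u A - (LINT x:A|lebesgue. g x))"
    by (simp add: \<sigma>_def bv_sing_def[abs_def] g_def)
  obtain Z where Z: "Z \<in> null_sets lborel" "Z \<subseteq> \<Omega>" "variation \<sigma> (\<Omega> - Z) = 0"
    using gs unfolding singular_on_def \<sigma>_eq by auto
  have Zb: "Z \<in> sets borel" using Z(1) by auto
  obtain G where G: "integrable lborel G" "\<And>x. x \<notin> \<Omega> \<Longrightarrow> G x = 0" "AE x in lborel. x \<in> \<Omega> \<longrightarrow> g x = G x"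
    "\<And>A. A \<in> sets borel \<Longrightarrow> A \<subseteq> \<Omega> \<Longrightarrow> (LINT x:A|lebesgue. g x) = (LINT x|lborel. indicator A x *\<^sub>R G x)"
    by (rule set_integrable_borel_version[OF conjunct1[OF gs] \<Omega>b]) blast
  have us: "set_integrable lebesgue \<Omega> u" using u by (simp add: BV_def)
  obtain U where U: "integrable lborel U" "\<And>x. x \<notin> \<Omega> \<Longrightarrow> U x = 0" "AE x in lborel. x \<in> \<Omega> \<longrightarrow> u x = U x"
    by (rule set_integrable_borel_version[OF us \<Omega>b]) blast
  have Gm: "G \<in> borel_measurable borel" and Um: "U \<in> borel_measurable borel" using G(1) U(1) by auto
  define \<zeta> where "\<zeta> x = indicator Z x *\<^sub>R \<xi> x" for x
  have \<zeta>i: "integrable M \<zeta>" unfolding \<zeta>_def[abs_def] using \<xi>(1) Zb M(2) by (intro integrable_mult_indicator) auto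
  have \<sigma>A: "\<sigma> A = (LINT x|M. indicator A x *\<^sub>R \<xi> x) - (LINT x|lborel. indicator A x *\<^sub>R G x)"
    if "A \<in> sets borel" "A \<subseteq> \<Omega>" for A
    using that by (simp add: \<sigma>_eq \<nu> G(4))
  have i\<xi>: "integrable M (\<lambda>x. indicator A x *\<^sub>R \<xi> x)" if "A \<in> sets borel" for A
    using that \<xi>(1) M(2) by (intro integrable_mult_indicator) auto
  have iG: "integrable lborel (\<lambda>x. indicator A x *\<^sub>R G x)" if "A \<in> sets borel" for A
    using that G(1) by (intro integrable_mult_indicator) auto
  have off: "(LINT x|M. indicator A x *\<^sub>R \<xi> x) = (LINT x|lborel. indicator A x *\<^sub>R G x)" if A: "A \<in> sets borel" "A \<subseteq> \<Omega> - Z" for A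
  proof -
    have "ennreal (norm (\<sigma> A)) \<le> variation \<sigma> (\<Omega> - Z)" using A \<Omega>b Zb by (intro norm_le_variation) auto
    then have "\<sigma> A = 0" using Z(3) by simp
    then show ?thesis using \<sigma>A[of A] A by auto
  qed
  have aeZ: "AE x in lborel. x \<notin> Z" by (rule AE_not_in[OF Z(1)])
  have "variation \<sigma> \<Omega> = ennreal (LINT x|M. indicator \<Omega> x * norm (\<zeta> x))"
  proof (rule variation_density[OF M \<zeta>i \<Omega>b])
    fix A assume A: "A \<in> sets borel" "A \<subseteq> \<Omega>"
    have 1: "(LINT x|M. indicator A x *\<^sub>R \<xi> x) = (LINT x|M. indicator (A - Z) x *\<^sub>R \<xi> x) + (LINT x|M. indicator A x *\<^sub>R \<zeta> x)"
    proof -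
      have "indicator A x *\<^sub>R \<xi> x = indicator (A - Z) x *\<^sub>R \<xi> x + indicator (A \<inter> Z) x *\<^sub>R \<xi> x" for x by (auto simp: indicator_def)
      moreover have "indicator A x *\<^sub>R \<zeta> x = indicator (A \<inter> Z) x *\<^sub>R \<xi> x" for x by (auto simp: indicator_def \<zeta>_def)
      ultimately show ?thesis using i\<xi>[of "A - Z"] i\<xi>[of "A \<inter> Z"] A(1) Zb by simp
    qed
    have 2: "(LINT x|lborel. indicator A x *\<^sub>R G x) = (LINT x|lborel. indicator (A - Z) x *\<^sub>R G x)"
    proof (rule integral_cong_AE)
      show "AE x in lborel. indicator A x *\<^sub>R G x = indicator (A - Z) x *\<^sub>R G x"
        using aeZ by eventually_elim (simp add: indicator_def)
      show "(\<lambda>x. indicator A x *\<^sub>R G x) \<in> borel_measurable lborel" using iG[OF A(1)] by (rule borel_measurable_integrable)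
      show "(\<lambda>x. indicator (A - Z) x *\<^sub>R G x) \<in> borel_measurable lborel" using iG[of "A - Z"] A(1) Zb by (intro borel_measurable_integrable) auto
    qed
    have "A - Z \<in> sets borel" "A - Z \<subseteq> \<Omega> - Z" using A Zb by auto
    from off[OF this] show "\<sigma> A = (LINT x|M. indicator A x *\<^sub>R \<zeta> x)"
      unfolding \<sigma>A[OF A] 1 2 by simp
  qed
  moreover have "indicator \<Omega> x * norm (\<zeta> x) = norm (\<zeta> x)" for x using Z(2) by (auto simp: \<zeta>_def indicator_def)
  ultimately have var: "variation \<sigma> \<Omega> = ennreal (LINT x|M. norm (\<zeta> x))" by simp
  have acpart: "(LINT x|M. \<phi> x * (indicator (- Z) x * (\<xi> x \<bullet> b))) = (LINT x|lborel. \<phi> x * (G x \<bullet> b))"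
    if \<phi>: "test_function \<Omega> \<phi>" for \<phi> b
  proof -
    obtain C where C: "\<And>x. \<bar>\<phi> x\<bar> \<le> C" using test_function_bounded[OF \<phi>] by metis
    have i: "integrable M (\<lambda>x. indicator (- Z) x * (\<xi> x \<bullet> b))"
      using integrable_mult_indicator[of "- Z" M "\<lambda>x. \<xi> x \<bullet> b"] \<xi>(1) Zb M(2) by auto
    have j: "integrable lborel (\<lambda>x. G x \<bullet> b)" using G(1) by simp
    show ?thesis
    proof (rule integral_eq_of_set_integrals_eq[OF i j M(2) _ _ test_function_borel[OF \<phi>] C])
      fix A :: "'a set" assume A: "A \<in> sets borel"
      let ?A = "A \<inter> \<Omega> - Z"
      have Ab: "?A \<in> sets borel" "?A \<subseteq> \<Omega> - Z" using A \<Omega>b Zb by auto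
      have "(LINT x|M. indicator A x * (indicator (- Z) x * (\<xi> x \<bullet> b))) = (LINT x|M. (indicator ?A x *\<^sub>R \<xi> x) \<bullet> b)"
        using \<xi>(2) by (intro Bochner_Integration.integral_cong refl) (auto simp: indicator_def)
      also have "\<dots> = (LINT x|M. indicator ?A x *\<^sub>R \<xi> x) \<bullet> b" using i\<xi>[OF Ab(1)] by (intro integral_inner_left) auto
      also have "\<dots> = (LINT x|lborel. indicator ?A x *\<^sub>R G x) \<bullet> b" using off[OF Ab] by simp
      also have "\<dots> = (LINT x|lborel. (indicator ?A x *\<^sub>R G x) \<bullet> b)" using iG[OF Ab(1)] by (intro integral_inner_left[symmetric]) auto
      also have "\<dots> = (LINT x|lborel. indicator A x * (G x \<bullet> b))"
      proof (rule integral_cong_AE)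
        show "AE x in lborel. (indicator ?A x *\<^sub>R G x) \<bullet> b = indicator A x * (G x \<bullet> b)"
          using aeZ by eventually_elim (use G(2) in \<open>auto simp: indicator_def\<close>)
        show "(\<lambda>x. (indicator ?A x *\<^sub>R G x) \<bullet> b) \<in> borel_measurable lborel"
          using iG[OF Ab(1)] by (intro borel_measurable_inner borel_measurable_integrable borel_measurable_const)
        show "(\<lambda>x. indicator A x * (G x \<bullet> b)) \<in> borel_measurable lborel"
          using j A by (intro borel_measurable_times borel_measurable_indicator borel_measurable_integrable) auto
      qed
      finally show "(LINT x|M. indicator A x * (indicator (- Z) x * (\<xi> x \<bullet> b))) = (LINT x|lborel. indicator A x * (G x \<bullet> b))" .
    qed simp
  qed
  have sdd: "split_distributional_derivative \<Omega> U G M \<zeta>"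
  proof (rule split_distributional_derivative.intro)
    show "\<zeta> x = 0" if "x \<notin> \<Omega>" for x using that Z(2) by (auto simp: \<zeta>_def indicator_def)
    fix \<phi> and b :: 'a assume \<phi>: "test_function \<Omega> \<phi>" and b: "b \<in> Basis"
    obtain C where C: "\<And>x. \<bar>\<phi> x\<bar> \<le> C" using test_function_bounded[OF \<phi>] by metis
    have \<phi>M: "\<phi> \<in> borel_measurable M" using test_function_borel[OF \<phi>] measurable_cong_sets[OF M(2) refl] by blast
    have i1: "integrable M (\<lambda>x. \<phi> x * (\<zeta> x \<bullet> b))"
      by (rule integrable_bounded_mult[OF _ \<phi>M C]) (use \<zeta>i in auto)
    have i2: "integrable M (\<lambda>x. \<phi> x * (indicator (- Z) x * (\<xi> x \<bullet> b)))"
      by (rule integrable_bounded_mult[OF _ \<phi>M C])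
        (use integrable_mult_indicator[of "- Z" M "\<lambda>x. \<xi> x \<bullet> b"] \<xi>(1) Zb M(2) in auto)
    have "(LINT x|M. \<phi> x * (\<zeta> x \<bullet> b)) + (LINT x|lborel. \<phi> x * (G x \<bullet> b)) =
      (LINT x|M. \<phi> x * (\<zeta> x \<bullet> b) + \<phi> x * (indicator (- Z) x * (\<xi> x \<bullet> b)))"
      using i1 i2 by (simp add: acpart[OF \<phi>])
    also have "\<dots> = (LINT x|M. \<phi> x * (\<xi> x \<bullet> b))"
      by (intro Bochner_Integration.integral_cong refl) (auto simp: \<zeta>_def indicator_def)
    also have "\<dots> = - (LINT x:\<Omega>|lebesgue. u x * frechet_derivative \<phi> (at x) b)" by (rule ibp[OF \<phi> b])
    also have "(LINT x:\<Omega>|lebesgue. u x * frechet_derivative \<phi> (at x) b) = (LINT x|lborel. U x * frechet_derivative \<phi> (at x) b)"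
    proof -
      have Dm: "(\<lambda>x. frechet_derivative \<phi> (at x) b) \<in> borel_measurable borel"
        using test_function_borel[OF test_function_deriv[OF \<phi>]] .
      have m1: "(\<lambda>x. indicator \<Omega> x *\<^sub>R u x) \<in> borel_measurable lebesgue" using us by (auto simp: set_integrable_def)
      have Dl: "(\<lambda>x. frechet_derivative \<phi> (at x) b) \<in> borel_measurable lebesgue" using Dm by (intro measurable_completion) simp
      have Ul: "U \<in> borel_measurable lebesgue" using Um by (intro measurable_completion) simp
      have "(LINT x:\<Omega>|lebesgue. u x * frechet_derivative \<phi> (at x) b) = (LINT x|lebesgue. (indicator \<Omega> x *\<^sub>R u x) * frechet_derivative \<phi> (at x) b)"
        unfolding set_lebesgue_integral_def by (simp add: mult.assoc)
      also have "\<dots> = (LINT x|lebesgue. U x * frechet_derivative \<phi> (at x) b)"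
      proof (rule integral_cong_AE)
        show "AE x in lebesgue. (indicator \<Omega> x *\<^sub>R u x) * frechet_derivative \<phi> (at x) b = U x * frechet_derivative \<phi> (at x) b"
          using AE_completion[OF U(3)] by eventually_elim (use U(2) in \<open>auto simp: indicator_def\<close>)
      qed (use m1 Dl Ul in \<open>auto intro: borel_measurable_times\<close>)
      also have "\<dots> = (LINT x|lborel. U x * frechet_derivative \<phi> (at x) b)"
        using Um Dm by (intro integral_completion) simp
      finally show ?thesis .
    qed
    finally show "(LINT x|M. \<phi> x * (\<zeta> x \<bullet> b)) + (LINT x|lborel. \<phi> x * (G x \<bullet> b)) =
       - (LINT x|lborel. U x * frechet_derivative \<phi> (at x) b)" .
  qed (fact \<Omega> U(1) G(1) M \<zeta>i U(2) G(2))+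
  show ?thesis by (rule that[OF sdd U(3) G(3)[unfolded g_def] var[unfolded \<sigma>_def]])
qed

section \<open>The limit of the weighted remainders\<close>

lemma AE_lborel_translate:
  fixes c :: "'a::euclidean_space"
  assumes "AE x in lborel. P x"
  shows "AE x in lborel. P (x + c)"
proof (rule AE_lborel_measure_preserving[OF _ _ assms])
  show "(\<lambda>x. x + c) \<in> borel_measurable borel" by measurable
qed (rule nn_integral_lborel_translate)

lemma AE_lborel_reflection:
  fixes a :: "'a::euclidean_space"
  assumes "AE x in lborel. P x"
  shows "AE x in lborel. P (reflection a x)"
  by (rule AE_lborel_measure_preserving[OF borel_measurable_reflection _ assms]) (rule nn_integral_lborel_reflection)

context split_distributional_derivative
begin

definition remainder_norm :: "'a \<Rightarrow> real" where
  "remainder_norm h = (LINT x|lborel. indicator (overlap h) x * \<bar>remainder h x\<bar>)"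

text \<open>The total variation of the signed measure \<open>\<zeta> M \<bullet> h\<close>.\<close>

definition jump :: "'a \<Rightarrow> real" where
  "jump h = (LINT x|M. \<bar>\<zeta> x \<bullet> h\<bar>)"

definition total_jump :: real where
  "total_jump = (LINT x|M. norm (\<zeta> x))"

lemma indicator_overlap: "indicator (overlap h) x = (indicator \<Omega> x * indicator \<Omega> (x + h) :: 'b::semiring_1)"
  by (auto simp: overlap_def indicator_def)

lemma borel_\<Omega> [measurable]: "\<Omega> \<in> sets borel"
  using open_\<Omega> by simp

lemma borel_remainder_norm [measurable]: "remainder_norm \<in> borel_measurable borel"
proof -
  have "(\<lambda>h. LINT x|lborel. indicator \<Omega> x * indicator \<Omega> (x + h) * \<bar>remainder h x\<bar>) \<in> borel_measurable borel"
    by (rule lborel.borel_measurable_lebesgue_integral) measurable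
  then show ?thesis unfolding remainder_norm_def[abs_def] indicator_overlap .
qed

lemma borel_jump [measurable]: "jump \<in> borel_measurable borel"
proof -
  interpret finite_measure M by (rule finite_M)
  have [measurable]: "\<zeta> \<in> borel_measurable M" using integrable_\<zeta> by auto
  show ?thesis unfolding jump_def[abs_def] by (rule borel_measurable_lebesgue_integral) measurable
qed

lemma remainder_norm_nonneg: "remainder_norm h \<ge> 0"
  unfolding remainder_norm_def by (intro Bochner_Integration.integral_nonneg) auto

lemma jump_nonneg: "jump h \<ge> 0"
  unfolding jump_def by (intro Bochner_Integration.integral_nonneg) auto

lemma total_jump_nonneg: "total_jump \<ge> 0"
  unfolding total_jump_def by (intro Bochner_Integration.integral_nonneg) auto

lemma jump_le: "jump h \<le> norm h * total_jump"
proof -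
  have "jump h \<le> (LINT x|M. norm h * norm (\<zeta> x))"
    unfolding jump_def
  proof (rule integral_mono)
    show "\<bar>\<zeta> x \<bullet> h\<bar> \<le> norm h * norm (\<zeta> x)" for x using Cauchy_Schwarz_ineq2[of "\<zeta> x" h] by (simp add: mult.commute)
  qed (use integrable_\<zeta> in auto)
  then show ?thesis by (simp add: total_jump_def)
qed

lemma remainder_norm_le:
  "remainder_norm h \<le> 2 * (LINT x|lborel. \<bar>U x\<bar>) + norm h * (LINT x|lborel. norm (g x))"
proof -
  have i: "integrable lborel (\<lambda>x. \<bar>U (x + h)\<bar>)" "integrable lborel (\<lambda>x. \<bar>U x\<bar>)" "integrable lborel (\<lambda>x. norm h * norm (g x))"
    using integrable_U integrable_shift_U integrable_g by auto
  have "remainder_norm h \<le> (LINT x|lborel. (\<bar>U (x + h)\<bar> + \<bar>U x\<bar>) + norm h * norm (g x))"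
    unfolding remainder_norm_def
  proof (rule integral_mono)
    show "integrable lborel (\<lambda>x. indicator (overlap h) x * \<bar>remainder h x\<bar>)"
      using open_overlap by (intro integrable_indicator_abs[OF integrable_remainder]) auto
    fix x
    have "\<bar>remainder h x\<bar> \<le> (\<bar>U (x + h)\<bar> + \<bar>U x\<bar>) + norm h * norm (g x)"
      using Cauchy_Schwarz_ineq2[of "g x" h] by (simp add: mult.commute)
    then show "indicator (overlap h) x * \<bar>remainder h x\<bar> \<le> (\<bar>U (x + h)\<bar> + \<bar>U x\<bar>) + norm h * norm (g x)"
      by (auto simp: indicator_def)
  qed (intro Bochner_Integration.integrable_add i)
  also have "\<dots> = (LINT x|lborel. \<bar>U (x + h)\<bar>) + (LINT x|lborel. \<bar>U x\<bar>) + (LINT x|lborel. norm h * norm (g x))"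
    by (subst Bochner_Integration.integral_add[OF Bochner_Integration.integrable_add[OF i(1,2)] i(3)],
        subst Bochner_Integration.integral_add[OF i(1,2)]) simp
  also have "(LINT x|lborel. \<bar>U (x + h)\<bar>) = (LINT x|lborel. \<bar>U x\<bar>)"
    by (rule lborel_integral_translate(1)[where f = "\<lambda>x. \<bar>U x\<bar>"]) measurable
  finally show ?thesis by simp
qed

text \<open>For \<open>|h| < \<delta>\<close> this is the uniform estimate of the remainder.  For larger \<open>h\<close> both quotients are at most
  \<open>C\<close>, which suffices because the weight vanishes there in the limit.\<close>

lemma remainder_norm_near_jump:
  assumes sm: "smooth_boundary \<Omega>" and cp: "compact (frontier \<Omega>)" and \<eta>: "\<eta> > 0"
  obtains \<delta> C where "\<delta> > 0" "C \<ge> 0"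
    "\<And>h. remainder_norm h / norm h \<le> jump h / norm h + \<eta> + C * indicator {h. norm h \<ge> \<delta>} h"
    "\<And>h. jump h / norm h \<le> remainder_norm h / norm h + \<eta> + C * indicator {h. norm h \<ge> \<delta>} h"
proof -
  obtain d1 where d1: "d1 > 0" "\<And>h. h \<noteq> 0 \<Longrightarrow> norm h < d1 \<Longrightarrow> remainder_norm h \<le> jump h + \<eta> * norm h"
    unfolding remainder_norm_def jump_def by (rule remainder_upper[OF sm cp \<eta>]) blast
  obtain d2 where d2: "d2 > 0" "\<And>h. h \<noteq> 0 \<Longrightarrow> norm h < d2 \<Longrightarrow> remainder_norm h \<ge> jump h - \<eta> * norm h"
    unfolding remainder_norm_def jump_def by (rule remainder_lower[OF \<eta>]) blast
  define \<delta> where "\<delta> = min d1 d2"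
  define C where "C = 2 * (LINT x|lborel. \<bar>U x\<bar>) / \<delta> + (LINT x|lborel. norm (g x)) + total_jump"
  have \<delta>: "\<delta> > 0" using d1 d2 by (simp add: \<delta>_def)
  have U0: "(LINT x|lborel. \<bar>U x\<bar>) \<ge> 0" "(LINT x|lborel. norm (g x)) \<ge> 0" by simp_all
  have C: "C \<ge> 0" unfolding C_def using U0 \<delta> total_jump_nonneg by simp
  show ?thesis
  proof (rule that[OF \<delta> C])
    fix h :: 'a
    consider "h = 0" | "h \<noteq> 0" "norm h < \<delta>" | "norm h \<ge> \<delta>" by force
    then have "remainder_norm h / norm h \<le> jump h / norm h + \<eta> + C * indicator {h. norm h \<ge> \<delta>} h \<and>
      jump h / norm h \<le> remainder_norm h / norm h + \<eta> + C * indicator {h. norm h \<ge> \<delta>} h"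
    proof cases
      case 1
      then show ?thesis using \<eta> C by (simp add: indicator_def)
    next
      case 2
      then have "remainder_norm h \<le> jump h + \<eta> * norm h" "jump h \<le> remainder_norm h + \<eta> * norm h"
        using d1(2)[of h] d2(2)[of h] by (auto simp: \<delta>_def)
      then show ?thesis using 2 by (simp add: field_simps)
    next
      case 3
      then have h: "norm h > 0" using \<delta> by linarith
      have "2 * (LINT x|lborel. \<bar>U x\<bar>) / norm h \<le> 2 * (LINT x|lborel. \<bar>U x\<bar>) / \<delta>"
        using 3 \<delta> U0 h by (intro divide_left_mono mult_pos_pos) auto
      moreover have "remainder_norm h / norm h \<le> 2 * (LINT x|lborel. \<bar>U x\<bar>) / norm h + (LINT x|lborel. norm (g x))"
        using remainder_norm_le[of h] h by (simp add: field_simps)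
      ultimately have "remainder_norm h / norm h \<le> C" unfolding C_def using total_jump_nonneg by linarith
      moreover have "jump h / norm h \<le> total_jump" using jump_le[of h] h by (simp add: field_simps)
      moreover have "total_jump \<le> C" unfolding C_def using U0 \<delta> by simp
      moreover have "jump h / norm h \<ge> 0" "remainder_norm h / norm h \<ge> 0" using jump_nonneg remainder_norm_nonneg by auto
      ultimately show ?thesis using 3 \<eta> by simp
    qed
    then show "remainder_norm h / norm h \<le> jump h / norm h + \<eta> + C * indicator {h. norm h \<ge> \<delta>} h"
      "jump h / norm h \<le> remainder_norm h / norm h + \<eta> + C * indicator {h. norm h \<ge> \<delta>} h" by auto
  qed
qed

lemma weighted_le:
  fixes r :: "'a \<Rightarrow> ennreal"
  assumes [measurable]: "r \<in> borel_measurable borel" "A \<in> borel_measurable borel" "B \<in> borel_measurable borel"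
    and nn: "\<And>h. B h \<ge> 0" "\<eta> \<ge> 0" "C \<ge> 0"
    and le: "\<And>h. A h \<le> B h + \<eta> + C * indicator {h. norm h \<ge> \<delta>} h"
  shows "(\<integral>\<^sup>+h. r h * ennreal (A h) \<partial>lborel) \<le> (\<integral>\<^sup>+h. r h * ennreal (B h) \<partial>lborel) +
    (ennreal \<eta> * (\<integral>\<^sup>+h. r h \<partial>lborel) + ennreal C * (\<integral>\<^sup>+h. r h * indicator {h. norm h \<ge> \<delta>} h \<partial>lborel))"
proof -
  have [measurable]: "{h::'a. norm h \<ge> \<delta>} \<in> sets borel" by measurable
  have "(\<integral>\<^sup>+h. r h * ennreal (A h) \<partial>lborel) \<le>
    (\<integral>\<^sup>+h. r h * ennreal (B h) + (ennreal \<eta> * r h + ennreal C * (r h * indicator {h. norm h \<ge> \<delta>} h)) \<partial>lborel)"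
  proof (rule nn_integral_mono)
    fix h
    have "ennreal (A h) \<le> ennreal (B h + \<eta> + C * indicator {h. norm h \<ge> \<delta>} h)" by (rule ennreal_leI[OF le])
    also have "\<dots> = ennreal (B h) + ennreal \<eta> + ennreal C * indicator {h. norm h \<ge> \<delta>} h"
      using nn by (simp add: ennreal_plus ennreal_mult ennreal_indicator)
    finally have "r h * ennreal (A h) \<le> r h * (ennreal (B h) + ennreal \<eta> + ennreal C * indicator {h. norm h \<ge> \<delta>} h)"
      by (rule mult_left_mono) simp
    also have "\<dots> = r h * ennreal (B h) + (ennreal \<eta> * r h + ennreal C * (r h * indicator {h. norm h \<ge> \<delta>} h))"
      by (simp add: distrib_left mult_ac add_ac)
    finally show "r h * ennreal (A h) \<le> r h * ennreal (B h) + (ennreal \<eta> * r h + ennreal C * (r h * indicator {h. norm h \<ge> \<delta>} h))" .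
  qed
  also have "\<dots> = (\<integral>\<^sup>+h. r h * ennreal (B h) \<partial>lborel) +
    (ennreal \<eta> * (\<integral>\<^sup>+h. r h \<partial>lborel) + ennreal C * (\<integral>\<^sup>+h. r h * indicator {h. norm h \<ge> \<delta>} h \<partial>lborel))"
    by (simp add: nn_integral_add nn_integral_cmult)
  finally show ?thesis .
qed

lemma weighted_jump:
  fixes r :: "'a \<Rightarrow> ennreal" and e :: 'a
  assumes [measurable]: "r \<in> borel_measurable borel"
    and inv: "\<And>a. AE h in lborel. r (reflection a h) = r h"
    and e: "norm e = 1"
  shows "(\<integral>\<^sup>+h. r h * ennreal (jump h / norm h) \<partial>lborel) = ennreal (K1 e * total_jump) * (\<integral>\<^sup>+h. r h \<partial>lborel)"
proof -
  interpret M: finite_measure M by (rule finite_M)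
  interpret P: pair_sigma_finite M "lborel :: 'a measure" ..
  have [measurable]: "\<zeta> \<in> borel_measurable M" using integrable_\<zeta> by auto
  define R where "R = (\<integral>\<^sup>+h. r h \<partial>lborel)"
  have "(\<integral>\<^sup>+h. r h * ennreal (jump h / norm h) \<partial>lborel) = (\<integral>\<^sup>+h. (\<integral>\<^sup>+x. r h * ennreal (\<bar>\<zeta> x \<bullet> h\<bar> / norm h) \<partial>M) \<partial>lborel)"
  proof (rule nn_integral_cong)
    fix h
    have "(\<integral>\<^sup>+x. ennreal (\<bar>\<zeta> x \<bullet> h\<bar> / norm h) \<partial>M) = ennreal (LINT x|M. \<bar>\<zeta> x \<bullet> h\<bar> / norm h)"
      using integrable_\<zeta>_inner by (intro nn_integral_eq_integral) auto
    also have "(LINT x|M. \<bar>\<zeta> x \<bullet> h\<bar> / norm h) = jump h / norm h" by (simp add: jump_def)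
    finally show "r h * ennreal (jump h / norm h) = (\<integral>\<^sup>+x. r h * ennreal (\<bar>\<zeta> x \<bullet> h\<bar> / norm h) \<partial>M)"
      by (subst nn_integral_cmult) auto
  qed
  also have "\<dots> = (\<integral>\<^sup>+x. (\<integral>\<^sup>+h. r h * ennreal (\<bar>\<zeta> x \<bullet> h\<bar> / norm h) \<partial>lborel) \<partial>M)"
    by (rule P.Fubini') measurable
  also have "\<dots> = (\<integral>\<^sup>+x. (ennreal (K1 e) * R) * ennreal (norm (\<zeta> x)) \<partial>M)"
    by (intro nn_integral_cong)
      (simp add: radial_direction_average[OF assms(1) inv e] R_def ennreal_mult K1_nonneg mult_ac)
  also have "\<dots> = (ennreal (K1 e) * R) * (\<integral>\<^sup>+x. ennreal (norm (\<zeta> x)) \<partial>M)" by (rule nn_integral_cmult) measurable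
  also have "(\<integral>\<^sup>+x. ennreal (norm (\<zeta> x)) \<partial>M) = ennreal total_jump"
    unfolding total_jump_def using integrable_\<zeta> by (intro nn_integral_eq_integral) auto
  finally show ?thesis by (simp add: R_def ennreal_mult K1_nonneg[of e] total_jump_nonneg mult_ac)
qed

text \<open>Substituting \<open>y = x + h\<close> and exchanging the integrals; the radial weight is even.\<close>

lemma double_integral_eq_weighted_remainder:
  fixes r :: "'a \<Rightarrow> ennreal" and u :: "'a \<Rightarrow> real" and v :: "'a \<Rightarrow> 'a"
  assumes r [measurable]: "r \<in> borel_measurable borel" and \<rho>r: "AE h in lborel. ennreal (\<rho> h) = r h"
    and even: "\<And>h. \<rho> (- h) = \<rho> h" and \<rho>0: "\<And>h. \<rho> h \<ge> 0"
    and u: "AE x in lborel. x \<in> \<Omega> \<longrightarrow> u x = U x" and v: "AE x in lborel. x \<in> \<Omega> \<longrightarrow> v x = g x"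
  shows "(\<integral>\<^sup>+x\<in>\<Omega>. (\<integral>\<^sup>+y\<in>\<Omega>. ennreal (\<bar>u x - u y - v x \<bullet> (x - y)\<bar> / norm (x - y) * \<rho> (x - y)) \<partial>lebesgue) \<partial>lebesgue)
    = (\<integral>\<^sup>+h. r h * ennreal (remainder_norm h / norm h) \<partial>lborel)"
proof -
  define F where "F x h = ennreal (\<bar>remainder h x\<bar> / norm h) * r h * indicator \<Omega> (x + h)" for x h
  have [measurable]: "(\<lambda>(x, h). F x h) \<in> borel_measurable (lborel \<Otimes>\<^sub>M lborel)"
    unfolding F_def by measurable
  have inner: "(\<integral>\<^sup>+y\<in>\<Omega>. ennreal (\<bar>u x - u y - v x \<bullet> (x - y)\<bar> / norm (x - y) * \<rho> (x - y)) \<partial>lebesgue) = (\<integral>\<^sup>+h. F x h \<partial>lborel)"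
    if x: "u x = U x" "v x = g x" for x
  proof -
    have Fx [measurable]: "F x \<in> borel_measurable borel" unfolding F_def[abs_def] by measurable
    have "AE y in lborel. ennreal (\<rho> (y + - x)) = r (y + - x)" by (rule AE_lborel_translate[OF \<rho>r])
    with u have "AE y in lborel. ennreal (\<bar>u x - u y - v x \<bullet> (x - y)\<bar> / norm (x - y) * \<rho> (x - y)) * indicator \<Omega> y = F x (y + - x)"
    proof eventually_elim
      case (elim y)
      show ?case
      proof (cases "y \<in> \<Omega>")
        case True
        have 1: "\<rho> (x - y) = \<rho> (y + - x)" using even[of "y + - x"] by simp
        have 2: "\<bar>u x - u y - v x \<bullet> (x - y)\<bar> = \<bar>remainder (y + - x) x\<bar>"
          using elim(1) True x by (simp add: inner_diff_right abs_minus_commute algebra_simps)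
        have 3: "norm (x - y) = norm (y + - x)" by (simp add: norm_minus_commute)
        have 4: "ennreal (\<bar>remainder (y + - x) x\<bar> / norm (y + - x) * \<rho> (y + - x)) =
            ennreal (\<bar>remainder (y + - x) x\<bar> / norm (y + - x)) * r (y + - x)"
          unfolding elim(2)[symmetric] by (intro ennreal_mult) (use \<rho>0 in auto)
        show ?thesis unfolding 1 2 3 4 F_def using True by simp
      qed (simp add: F_def)
    qed
    then have "(\<integral>\<^sup>+y. ennreal (\<bar>u x - u y - v x \<bullet> (x - y)\<bar> / norm (x - y) * \<rho> (x - y)) * indicator \<Omega> y \<partial>lborel) = (\<integral>\<^sup>+y. F x (y + - x) \<partial>lborel)"
      by (rule nn_integral_cong_AE)
    also have "\<dots> = (\<integral>\<^sup>+h. F x h \<partial>lborel)" by (rule nn_integral_lborel_translate[OF Fx])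
    finally show ?thesis by (simp add: nn_integral_completion)
  qed
  have "(\<integral>\<^sup>+x\<in>\<Omega>. (\<integral>\<^sup>+y\<in>\<Omega>. ennreal (\<bar>u x - u y - v x \<bullet> (x - y)\<bar> / norm (x - y) * \<rho> (x - y)) \<partial>lebesgue) \<partial>lebesgue)
    = (\<integral>\<^sup>+x. (\<integral>\<^sup>+y\<in>\<Omega>. ennreal (\<bar>u x - u y - v x \<bullet> (x - y)\<bar> / norm (x - y) * \<rho> (x - y)) \<partial>lebesgue) * indicator \<Omega> x \<partial>lborel)"
    by (rule nn_integral_completion)
  also have "\<dots> = (\<integral>\<^sup>+x. (\<integral>\<^sup>+h. F x h \<partial>lborel) * indicator \<Omega> x \<partial>lborel)"
  proof (rule nn_integral_cong_AE)
    show "AE x in lborel. (\<integral>\<^sup>+y\<in>\<Omega>. ennreal (\<bar>u x - u y - v x \<bullet> (x - y)\<bar> / norm (x - y) * \<rho> (x - y)) \<partial>lebesgue) * indicator \<Omega> x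
      = (\<integral>\<^sup>+h. F x h \<partial>lborel) * indicator \<Omega> x"
      using u v
    proof eventually_elim
      case (elim x)
      show ?case
      proof (cases "x \<in> \<Omega>")
        case True
        then have "u x = U x" "v x = g x" using elim by auto
        from inner[OF this] show ?thesis by (rule arg_cong[where f = "\<lambda>z. z * indicator \<Omega> x"])
      qed simp
    qed
  qed
  also have "\<dots> = (\<integral>\<^sup>+x. (\<integral>\<^sup>+h. F x h * indicator \<Omega> x \<partial>lborel) \<partial>lborel)"
    by (intro nn_integral_cong nn_integral_multc[symmetric]) measurable
  also have "\<dots> = (\<integral>\<^sup>+h. (\<integral>\<^sup>+x. F x h * indicator \<Omega> x \<partial>lborel) \<partial>lborel)"
    by (rule lborel_pair.Fubini'[symmetric]) measurable
  also have "\<dots> = (\<integral>\<^sup>+h. r h * ennreal (remainder_norm h / norm h) \<partial>lborel)"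
  proof (rule nn_integral_cong)
    fix h
    have i: "integrable lborel (\<lambda>x. indicator (overlap h) x * \<bar>remainder h x\<bar> / norm h)"
      using open_overlap by (intro integrable_divide integrable_indicator_abs[OF integrable_remainder]) auto
    have "(\<integral>\<^sup>+x. F x h * indicator \<Omega> x \<partial>lborel) = (\<integral>\<^sup>+x. r h * ennreal (indicator (overlap h) x * \<bar>remainder h x\<bar> / norm h) \<partial>lborel)"
      by (intro nn_integral_cong) (auto simp: F_def indicator_def overlap_def mult_ac)
    also have "\<dots> = r h * (\<integral>\<^sup>+x. ennreal (indicator (overlap h) x * \<bar>remainder h x\<bar> / norm h) \<partial>lborel)"
      using i by (intro nn_integral_cmult) auto
    also have "(\<integral>\<^sup>+x. ennreal (indicator (overlap h) x * \<bar>remainder h x\<bar> / norm h) \<partial>lborel) = ennreal (remainder_norm h / norm h)"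
      using nn_integral_eq_integral[OF i] by (simp add: remainder_norm_def)
    finally show "(\<integral>\<^sup>+x. F x h * indicator \<Omega> x \<partial>lborel) = r h * ennreal (remainder_norm h / norm h)" .
  qed
  finally show ?thesis .
qed

end

text \<open>A change on a null set makes the weight Borel, as Tonelli's theorem on product measures of Borel sets
  requires; invariance under reflections then survives almost everywhere.\<close>

lemma radial_kernel_borel_version:
  fixes \<rho> :: "'a::euclidean_space \<Rightarrow> real"
  assumes i: "integrable lebesgue \<rho>" and \<rho>0: "\<And>h. \<rho> h \<ge> 0" and rad: "radial \<rho>"
  obtains r :: "'a \<Rightarrow> ennreal" where "r \<in> borel_measurable borel" "AE h in lborel. ennreal (\<rho> h) = r h"
    "\<And>a. AE h in lborel. r (reflection a h) = r h"
    "(\<integral>\<^sup>+h. r h \<partial>lborel) = ennreal (LINT h|lebesgue. \<rho> h)"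
    "\<And>\<delta>. \<delta> > 0 \<Longrightarrow> (\<integral>\<^sup>+h. r h * indicator {h. norm h \<ge> \<delta>} h \<partial>lborel) \<le> ennreal (LINT h:{h. norm h > \<delta> / 2}|lebesgue. \<rho> h)"
proof -
  have "\<rho> \<in> borel_measurable lebesgue" using i by auto
  then obtain \<rho>' where \<rho>': "\<rho>' \<in> borel_measurable borel" "AE h in lborel. \<rho> h = \<rho>' h"
    by (rule lebesgue_borel_version) blast
  define r where "r h = ennreal (\<rho>' h)" for h
  have rb: "r \<in> borel_measurable borel" unfolding r_def[abs_def] using \<rho>'(1) by measurable
  have ae: "AE h in lborel. ennreal (\<rho> h) = r h" using \<rho>'(2) by eventually_elim (simp add: r_def)
  obtain f where f: "\<And>h. \<rho> h = f (norm h)" using rad unfolding radial_def by auto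
  have set: "(\<integral>\<^sup>+h. r h * indicator A h \<partial>lborel) = ennreal (LINT h:A|lebesgue. \<rho> h)" if A: "A \<in> sets borel" for A
  proof -
    have "(\<integral>\<^sup>+h. r h * indicator A h \<partial>lborel) = (\<integral>\<^sup>+h. ennreal (indicator A h *\<^sub>R \<rho> h) \<partial>lborel)"
    proof (rule nn_integral_cong_AE)
      show "AE h in lborel. r h * indicator A h = ennreal (indicator A h *\<^sub>R \<rho> h)"
        using ae by eventually_elim (auto simp: indicator_def)
    qed
    also have "\<dots> = (\<integral>\<^sup>+h. ennreal (indicator A h *\<^sub>R \<rho> h) \<partial>lebesgue)" by (simp add: nn_integral_completion)
    also have "\<dots> = ennreal (LINT h|lebesgue. indicator A h *\<^sub>R \<rho> h)"
      using A \<rho>0 by (intro nn_integral_eq_integral integrable_mult_indicator i) auto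
    finally show ?thesis by (simp add: set_lebesgue_integral_def)
  qed
  show ?thesis
  proof (rule that[OF rb ae])
    show "AE h in lborel. r (reflection a h) = r h" for a
      using ae AE_lborel_reflection[OF ae, of a]
    proof eventually_elim
      case (elim h)
      then show ?case by (simp add: f)
    qed
    show "(\<integral>\<^sup>+h. r h \<partial>lborel) = ennreal (LINT h|lebesgue. \<rho> h)" using set[of UNIV] by (simp add: set_lebesgue_integral_def)
    fix \<delta> :: real assume \<delta>: "\<delta> > 0"
    have "(\<integral>\<^sup>+h. r h * indicator {h. norm h \<ge> \<delta>} h \<partial>lborel) \<le> (\<integral>\<^sup>+h. r h * indicator {h. norm h > \<delta> / 2} h \<partial>lborel)"
      using \<delta> by (intro nn_integral_mono mult_left_mono) (auto simp: indicator_def)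
    also have "\<dots> = ennreal (LINT h:{h. norm h > \<delta> / 2}|lebesgue. \<rho> h)" by (rule set) measurable
    finally show "(\<integral>\<^sup>+h. r h * indicator {h. norm h \<ge> \<delta>} h \<partial>lborel) \<le> ennreal (LINT h:{h. norm h > \<delta> / 2}|lebesgue. \<rho> h)" .
  qed
qed

text \<open>The two regions \<open>|h| < 1\<close> and \<open>|h| > 1 / 2\<close> overlap and cover the space, so the sphere \<open>|h| = 1\<close> causes
  no trouble.\<close>

lemma total_mass_tendsto:
  fixes \<rho> :: "real \<Rightarrow> 'a::euclidean_space \<Rightarrow> real"
  assumes i: "\<And>\<epsilon>. \<epsilon> > 0 \<Longrightarrow> integrable lebesgue (\<rho> \<epsilon>)" and \<rho>0: "\<And>\<epsilon> h. \<epsilon> > 0 \<Longrightarrow> \<rho> \<epsilon> h \<ge> 0"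
    and lim1: "((\<lambda>\<epsilon>. LINT h:{h. norm h < 1}|lebesgue. \<rho> \<epsilon> h) \<longlongrightarrow> 1) (at_right 0)"
    and lim0: "((\<lambda>\<epsilon>. LINT h:{h. norm h > 1 / 2}|lebesgue. \<rho> \<epsilon> h) \<longlongrightarrow> 0) (at_right 0)"
  shows "((\<lambda>\<epsilon>. LINT h|lebesgue. \<rho> \<epsilon> h) \<longlongrightarrow> 1) (at_right 0)"
proof (rule tendsto_sandwich[OF _ _ lim1])
  have pos: "\<forall>\<^sub>F \<epsilon>::real in at_right 0. \<epsilon> > 0" by (simp add: eventually_at_right_less)
  have s: "{h::'a. norm h < 1} \<in> sets lebesgue" "{h::'a. norm h > 1 / 2} \<in> sets lebesgue"
  proof -
    have "{h::'a. norm h < 1} \<in> sets borel" "{h::'a. norm h > 1 / 2} \<in> sets borel" by measurable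
    then show "{h::'a. norm h < 1} \<in> sets lebesgue" "{h::'a. norm h > 1 / 2} \<in> sets lebesgue" by simp_all
  qed
  have ii: "integrable lebesgue (\<lambda>h. indicator A h *\<^sub>R \<rho> \<epsilon> h)" if "A \<in> sets lebesgue" "\<epsilon> > 0" for A \<epsilon>
    using that i by (intro integrable_mult_indicator) auto
  show "\<forall>\<^sub>F \<epsilon> in at_right 0. (LINT h:{h. norm h < 1}|lebesgue. \<rho> \<epsilon> h) \<le> (LINT h|lebesgue. \<rho> \<epsilon> h)"
    using pos
  proof eventually_elim
    case (elim \<epsilon>)
    show ?case unfolding set_lebesgue_integral_def
      by (rule integral_mono[OF ii[OF s(1) elim] i[OF elim]]) (use \<rho>0[OF elim] in \<open>auto simp: indicator_def\<close>)
  qed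
  show "\<forall>\<^sub>F \<epsilon> in at_right 0. (LINT h|lebesgue. \<rho> \<epsilon> h) \<le>
    (LINT h:{h. norm h < 1}|lebesgue. \<rho> \<epsilon> h) + (LINT h:{h. norm h > 1 / 2}|lebesgue. \<rho> \<epsilon> h)"
    using pos
  proof eventually_elim
    case (elim \<epsilon>)
    have "(LINT h|lebesgue. \<rho> \<epsilon> h) \<le> (LINT h|lebesgue. indicator {h. norm h < 1} h *\<^sub>R \<rho> \<epsilon> h + indicator {h. norm h > 1 / 2} h *\<^sub>R \<rho> \<epsilon> h)"
      by (rule integral_mono[OF i[OF elim] Bochner_Integration.integrable_add[OF ii[OF s(1) elim] ii[OF s(2) elim]]])
        (use \<rho>0[OF elim] in \<open>auto simp: indicator_def\<close>)
    also have "\<dots> = (LINT h|lebesgue. indicator {h. norm h < 1} h *\<^sub>R \<rho> \<epsilon> h) + (LINT h|lebesgue. indicator {h. norm h > 1 / 2} h *\<^sub>R \<rho> \<epsilon> h)"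
      by (rule Bochner_Integration.integral_add[OF ii[OF s(1) elim] ii[OF s(2) elim]])
    finally show ?case unfolding set_lebesgue_integral_def .
  qed
  show "((\<lambda>\<epsilon>. (LINT h:{h. norm h < 1}|lebesgue. \<rho> \<epsilon> h) + (LINT h:{h. norm h > 1 / 2}|lebesgue. \<rho> \<epsilon> h)) \<longlongrightarrow> 1) (at_right 0)"
    using tendsto_add[OF lim1 lim0] by simp
qed

text \<open>The shape in which the error estimates arrive: the leading term and the error are both multiples of the mass
  \<open>R\<close>, and \<open>T\<close> is the contribution of \<open>h\<close> away from \<open>0\<close>.\<close>

lemma tendsto_ennreal_two_sided:
  fixes I :: "real \<Rightarrow> ennreal" and L :: real
  assumes L: "L \<ge> 0"
    and bounds: "\<And>\<eta>. \<eta> > 0 \<Longrightarrow> \<exists>R T. (R \<longlongrightarrow> 1) F \<and> (T \<longlongrightarrow> 0) F \<and>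
      (\<forall>\<^sub>F \<epsilon> in F. R \<epsilon> \<ge> 0 \<and> T \<epsilon> \<ge> 0 \<and> I \<epsilon> \<le> ennreal (L * R \<epsilon>) + ennreal (\<eta> * R \<epsilon> + T \<epsilon>) \<and>
         ennreal (L * R \<epsilon>) \<le> I \<epsilon> + ennreal (\<eta> * R \<epsilon> + T \<epsilon>))"
  shows "(I \<longlongrightarrow> ennreal L) F"
proof -
  define i where "i \<epsilon> = enn2real (I \<epsilon>)" for \<epsilon>
  have b: "\<exists>R T. (R \<longlongrightarrow> 1) F \<and> (T \<longlongrightarrow> 0) F \<and>
      (\<forall>\<^sub>F \<epsilon> in F. I \<epsilon> = ennreal (i \<epsilon>) \<and> i \<epsilon> \<le> L * R \<epsilon> + (\<eta> * R \<epsilon> + T \<epsilon>) \<and> L * R \<epsilon> - (\<eta> * R \<epsilon> + T \<epsilon>) \<le> i \<epsilon>)" if \<eta>: "\<eta> > 0" for \<eta>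
  proof -
    obtain R T where RT: "(R \<longlongrightarrow> 1) F" "(T \<longlongrightarrow> 0) F"
      "\<forall>\<^sub>F \<epsilon> in F. R \<epsilon> \<ge> 0 \<and> T \<epsilon> \<ge> 0 \<and> I \<epsilon> \<le> ennreal (L * R \<epsilon>) + ennreal (\<eta> * R \<epsilon> + T \<epsilon>) \<and>
         ennreal (L * R \<epsilon>) \<le> I \<epsilon> + ennreal (\<eta> * R \<epsilon> + T \<epsilon>)"
      using bounds[OF \<eta>] by blast
    from RT(3) have "\<forall>\<^sub>F \<epsilon> in F. I \<epsilon> = ennreal (i \<epsilon>) \<and> i \<epsilon> \<le> L * R \<epsilon> + (\<eta> * R \<epsilon> + T \<epsilon>) \<and> L * R \<epsilon> - (\<eta> * R \<epsilon> + T \<epsilon>) \<le> i \<epsilon>"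
    proof eventually_elim
      case (elim \<epsilon>)
      then have nn: "L * R \<epsilon> \<ge> 0" "\<eta> * R \<epsilon> + T \<epsilon> \<ge> 0" using L \<eta> by auto
      have "I \<epsilon> \<le> ennreal (L * R \<epsilon> + (\<eta> * R \<epsilon> + T \<epsilon>))" using elim nn by (simp add: ennreal_plus)
      then have fin: "I \<epsilon> = ennreal (i \<epsilon>)" "i \<epsilon> \<ge> 0"
        unfolding i_def using le_less_trans[OF _ ennreal_less_top] by (auto simp: less_top)
      have "i \<epsilon> \<le> L * R \<epsilon> + (\<eta> * R \<epsilon> + T \<epsilon>)"
        using \<open>I \<epsilon> \<le> ennreal (L * R \<epsilon> + (\<eta> * R \<epsilon> + T \<epsilon>))\<close> nn unfolding fin(1) by (subst (asm) ennreal_le_iff) auto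
      moreover have "ennreal (L * R \<epsilon>) \<le> ennreal (i \<epsilon> + (\<eta> * R \<epsilon> + T \<epsilon>))"
        using elim fin nn by (simp add: ennreal_plus)
      then have "L * R \<epsilon> \<le> i \<epsilon> + (\<eta> * R \<epsilon> + T \<epsilon>)" using fin nn by (subst (asm) ennreal_le_iff) auto
      ultimately show ?case using fin(1) by simp
    qed
    then show ?thesis using RT by blast
  qed
  have "(i \<longlongrightarrow> L) F"
  proof (rule order_tendstoI)
    fix a assume a: "a < L"
    define \<eta> where "\<eta> = (L - a) / 2"
    have \<eta>: "\<eta> > 0" "a < L - \<eta>" using a by (auto simp: \<eta>_def field_simps)
    obtain R T where RT: "(R \<longlongrightarrow> 1) F" "(T \<longlongrightarrow> 0) F"
      "\<forall>\<^sub>F \<epsilon> in F. I \<epsilon> = ennreal (i \<epsilon>) \<and> i \<epsilon> \<le> L * R \<epsilon> + (\<eta> * R \<epsilon> + T \<epsilon>) \<and> L * R \<epsilon> - (\<eta> * R \<epsilon> + T \<epsilon>) \<le> i \<epsilon>"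
      using b[OF \<eta>(1)] by blast
    have "((\<lambda>\<epsilon>. L * R \<epsilon> - (\<eta> * R \<epsilon> + T \<epsilon>)) \<longlongrightarrow> L * 1 - (\<eta> * 1 + 0)) F" by (intro tendsto_intros RT)
    then have "\<forall>\<^sub>F \<epsilon> in F. a < L * R \<epsilon> - (\<eta> * R \<epsilon> + T \<epsilon>)" using \<eta>(2) by (intro order_tendstoD(1)) auto
    with RT(3) show "\<forall>\<^sub>F \<epsilon> in F. a < i \<epsilon>" by eventually_elim auto
  next
    fix a assume a: "L < a"
    define \<eta> where "\<eta> = (a - L) / 2"
    have \<eta>: "\<eta> > 0" "L + \<eta> < a" using a by (auto simp: \<eta>_def field_simps)
    obtain R T where RT: "(R \<longlongrightarrow> 1) F" "(T \<longlongrightarrow> 0) F"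
      "\<forall>\<^sub>F \<epsilon> in F. I \<epsilon> = ennreal (i \<epsilon>) \<and> i \<epsilon> \<le> L * R \<epsilon> + (\<eta> * R \<epsilon> + T \<epsilon>) \<and> L * R \<epsilon> - (\<eta> * R \<epsilon> + T \<epsilon>) \<le> i \<epsilon>"
      using b[OF \<eta>(1)] by blast
    have "((\<lambda>\<epsilon>. L * R \<epsilon> + (\<eta> * R \<epsilon> + T \<epsilon>)) \<longlongrightarrow> L * 1 + (\<eta> * 1 + 0)) F" by (intro tendsto_intros RT)
    then have "\<forall>\<^sub>F \<epsilon> in F. L * R \<epsilon> + (\<eta> * R \<epsilon> + T \<epsilon>) < a" using \<eta>(2) by (intro order_tendstoD(2)) auto
    with RT(3) show "\<forall>\<^sub>F \<epsilon> in F. i \<epsilon> < a" by eventually_elim auto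
  qed
  then have "((\<lambda>\<epsilon>. ennreal (i \<epsilon>)) \<longlongrightarrow> ennreal L) F" by (rule tendsto_ennrealI)
  moreover have "\<forall>\<^sub>F \<epsilon> in F. ennreal (i \<epsilon>) = I \<epsilon>"
    using b[of 1] by (auto elim: eventually_mono)
  ultimately show ?thesis by (rule Lim_transform_eventually)
qed

theorem theorem1p4:
  fixes \<Omega> :: "'a::euclidean_space set"
    and \<rho> :: "real \<Rightarrow> 'a \<Rightarrow> real"
    and u :: "'a \<Rightarrow> real"
    and e :: 'a
  assumes "(open \<Omega> \<and> bounded \<Omega> \<and> smooth_boundary \<Omega>) \<or> \<Omega> = UNIV"
    and "\<And>\<epsilon>. \<epsilon> > 0 \<Longrightarrow> integrable lebesgue (\<rho> \<epsilon>)"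
    and "\<And>\<epsilon> h. \<epsilon> > 0 \<Longrightarrow> \<rho> \<epsilon> h \<ge> 0"
    and "\<And>\<epsilon>. \<epsilon> > 0 \<Longrightarrow> radial (\<rho> \<epsilon>)"
    and "\<And>\<delta>. \<delta> > 0 \<Longrightarrow> ((\<lambda>\<epsilon>. LINT h:{h. norm h < \<delta>}|lebesgue. \<rho> \<epsilon> h) \<longlongrightarrow> 1) (at_right 0)"
    and "\<And>\<delta>. \<delta> > 0 \<Longrightarrow> ((\<lambda>\<epsilon>. LINT h:{h. norm h > \<delta>}|lebesgue. \<rho> \<epsilon> h) \<longlongrightarrow> 0) (at_right 0)"
    and "u \<in> BV \<Omega>"
    and "norm e = 1"
  shows "((\<lambda>\<epsilon>. \<integral>\<^sup>+x\<in>\<Omega>. (\<integral>\<^sup>+y\<in>\<Omega>.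
            ennreal (\<bar>u x - u y - bv_grad \<Omega> u x \<bullet> (x - y)\<bar> / norm (x - y) * \<rho> \<epsilon> (x - y))
            \<partial>lebesgue) \<partial>lebesgue)
          \<longlongrightarrow> ennreal (K1 e) * variation (bv_sing \<Omega> u) \<Omega>) (at_right 0)"
proof -
  have \<Omega>: "open \<Omega>" "smooth_boundary \<Omega>" "compact (frontier \<Omega>)"
    using assms(1) by (auto simp: smooth_boundary_def compact_frontier_bounded)
  obtain U G M \<zeta> where sdd: "split_distributional_derivative \<Omega> U G M \<zeta>"
    and u: "AE x in lborel. x \<in> \<Omega> \<longrightarrow> u x = U x" and v: "AE x in lborel. x \<in> \<Omega> \<longrightarrow> bv_grad \<Omega> u x = G x"
    and var: "variation (bv_sing \<Omega> u) \<Omega> = ennreal (LINT x|M. norm (\<zeta> x))"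
    by (rule bv_deriv_split[OF \<Omega>(1) assms(7)]) blast
  interpret split_distributional_derivative \<Omega> U G M \<zeta> by (rule sdd)
  define I where "I \<epsilon> = (\<integral>\<^sup>+x\<in>\<Omega>. (\<integral>\<^sup>+y\<in>\<Omega>.
            ennreal (\<bar>u x - u y - bv_grad \<Omega> u x \<bullet> (x - y)\<bar> / norm (x - y) * \<rho> \<epsilon> (x - y))
            \<partial>lebesgue) \<partial>lebesgue)" for \<epsilon>
  define R where "R \<epsilon> = (LINT h|lebesgue. \<rho> \<epsilon> h)" for \<epsilon>
  have R1: "(R \<longlongrightarrow> 1) (at_right 0)"
    unfolding R_def[abs_def]
  proof (rule total_mass_tendsto)
    show "((\<lambda>\<epsilon>. LINT h:{h. norm h < 1}|lebesgue. \<rho> \<epsilon> h) \<longlongrightarrow> 1) (at_right 0)" by (rule assms(5)) simp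
    show "((\<lambda>\<epsilon>. LINT h:{h. norm h > 1 / 2}|lebesgue. \<rho> \<epsilon> h) \<longlongrightarrow> 0) (at_right 0)" by (rule assms(6)) simp
  qed (rule assms(2,3), assumption)+
  have pos: "\<forall>\<^sub>F \<epsilon>::real in at_right 0. \<epsilon> > 0" by (simp add: eventually_at_right_less)
  have "(I \<longlongrightarrow> ennreal (K1 e * total_jump)) (at_right 0)"
  proof (rule tendsto_ennreal_two_sided)
    show "K1 e * total_jump \<ge> 0" using K1_nonneg[of e] total_jump_nonneg by simp
    fix \<eta> :: real assume \<eta>: "\<eta> > 0"
    obtain \<delta> C where \<delta>: "\<delta> > 0" and C: "C \<ge> 0"
      and up: "\<And>h. remainder_norm h / norm h \<le> jump h / norm h + \<eta> + C * indicator {h. norm h \<ge> \<delta>} h"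
      and low: "\<And>h. jump h / norm h \<le> remainder_norm h / norm h + \<eta> + C * indicator {h. norm h \<ge> \<delta>} h"
      by (rule remainder_norm_near_jump[OF \<Omega>(2,3) \<eta>]) blast
    define T where "T \<epsilon> = C * (LINT h:{h. norm h > \<delta> / 2}|lebesgue. \<rho> \<epsilon> h)" for \<epsilon>
    have T0: "(T \<longlongrightarrow> 0) (at_right 0)"
      unfolding T_def[abs_def] using tendsto_mult[OF tendsto_const assms(6)[of "\<delta> / 2"], of C] \<delta> by simp
    have "\<forall>\<^sub>F \<epsilon> in at_right 0. R \<epsilon> \<ge> 0 \<and> T \<epsilon> \<ge> 0 \<and> I \<epsilon> \<le> ennreal (K1 e * total_jump * R \<epsilon>) + ennreal (\<eta> * R \<epsilon> + T \<epsilon>) \<and>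
         ennreal (K1 e * total_jump * R \<epsilon>) \<le> I \<epsilon> + ennreal (\<eta> * R \<epsilon> + T \<epsilon>)"
      using pos
    proof eventually_elim
      case (elim \<epsilon>)
      obtain r where r [measurable]: "r \<in> borel_measurable borel" and \<rho>r: "AE h in lborel. ennreal (\<rho> \<epsilon> h) = r h"
        and inv: "\<And>a. AE h in lborel. r (reflection a h) = r h"
        and rR: "(\<integral>\<^sup>+h. r h \<partial>lborel) = ennreal (LINT h|lebesgue. \<rho> \<epsilon> h)"
        and rT: "\<And>\<delta>. \<delta> > 0 \<Longrightarrow> (\<integral>\<^sup>+h. r h * indicator {h. norm h \<ge> \<delta>} h \<partial>lborel) \<le> ennreal (LINT h:{h. norm h > \<delta> / 2}|lebesgue. \<rho> \<epsilon> h)"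
        by (rule radial_kernel_borel_version[OF assms(2)[OF elim] assms(3)[OF elim] assms(4)[OF elim]]) blast
      have R0: "R \<epsilon> \<ge> 0" unfolding R_def using assms(3)[OF elim] by simp
      have L0: "(LINT h:{h. norm h > \<delta> / 2}|lebesgue. \<rho> \<epsilon> h) \<ge> 0"
        unfolding set_lebesgue_integral_def using assms(3)[OF elim] by (intro Bochner_Integration.integral_nonneg) auto
      have T0: "T \<epsilon> \<ge> 0" unfolding T_def using C L0 by simp
      obtain f where f: "\<And>h. \<rho> \<epsilon> h = f (norm h)" using assms(4)[OF elim] unfolding radial_def by auto
      have Ieq: "I \<epsilon> = (\<integral>\<^sup>+h. r h * ennreal (remainder_norm h / norm h) \<partial>lborel)"
        unfolding I_def
        by (rule double_integral_eq_weighted_remainder[OF r \<rho>r _ assms(3)[OF elim] u v]) (simp add: f)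
      have Jeq: "(\<integral>\<^sup>+h. r h * ennreal (jump h / norm h) \<partial>lborel) = ennreal (K1 e * total_jump * R \<epsilon>)"
      proof -
        have "ennreal (K1 e * total_jump) * ennreal (R \<epsilon>) = ennreal (K1 e * total_jump * R \<epsilon>)"
          using K1_nonneg[of e] total_jump_nonneg R0 by (intro ennreal_mult[symmetric]) auto
        then show ?thesis unfolding weighted_jump[OF r inv assms(8)] rR R_def .
      qed
      have err: "ennreal \<eta> * (\<integral>\<^sup>+h. r h \<partial>lborel) + ennreal C * (\<integral>\<^sup>+h. r h * indicator {h. norm h \<ge> \<delta>} h \<partial>lborel) \<le> ennreal (\<eta> * R \<epsilon> + T \<epsilon>)"
      proof -
        have "ennreal C * (\<integral>\<^sup>+h. r h * indicator {h. norm h \<ge> \<delta>} h \<partial>lborel) \<le> ennreal (T \<epsilon>)"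
          unfolding T_def using mult_left_mono[OF rT[OF \<delta>], of "ennreal C"] C L0 by (simp add: ennreal_mult)
        moreover have "ennreal \<eta> * (\<integral>\<^sup>+h. r h \<partial>lborel) = ennreal (\<eta> * R \<epsilon>)"
          using rR \<eta> R0 by (simp add: R_def ennreal_mult)
        ultimately show ?thesis using \<eta> R0 T0 by (simp add: ennreal_plus add_left_mono)
      qed
      have "I \<epsilon> \<le> ennreal (K1 e * total_jump * R \<epsilon>) + ennreal (\<eta> * R \<epsilon> + T \<epsilon>)"
        unfolding Ieq Jeq[symmetric]
        by (rule order_trans[OF weighted_le add_left_mono[OF err]])
          (use up \<eta> C jump_nonneg in \<open>auto intro!: divide_nonneg_nonneg\<close>)
      moreover have "ennreal (K1 e * total_jump * R \<epsilon>) \<le> I \<epsilon> + ennreal (\<eta> * R \<epsilon> + T \<epsilon>)"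
        unfolding Ieq Jeq[symmetric]
        by (rule order_trans[OF weighted_le add_left_mono[OF err]])
          (use low \<eta> C remainder_norm_nonneg in \<open>auto intro!: divide_nonneg_nonneg\<close>)
      ultimately show ?case using R0 T0 by simp
    qed
    then show "\<exists>R T. (R \<longlongrightarrow> 1) (at_right 0) \<and> (T \<longlongrightarrow> 0) (at_right 0) \<and>
      (\<forall>\<^sub>F \<epsilon> in at_right 0. R \<epsilon> \<ge> 0 \<and> T \<epsilon> \<ge> 0 \<and> I \<epsilon> \<le> ennreal (K1 e * total_jump * R \<epsilon>) + ennreal (\<eta> * R \<epsilon> + T \<epsilon>) \<and>
         ennreal (K1 e * total_jump * R \<epsilon>) \<le> I \<epsilon> + ennreal (\<eta> * R \<epsilon> + T \<epsilon>))"
      using R1 T0 by blast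
  qed
  moreover have "ennreal (K1 e * total_jump) = ennreal (K1 e) * variation (bv_sing \<Omega> u) \<Omega>"
    unfolding var total_jump_def[symmetric] using K1_nonneg[of e] total_jump_nonneg by (intro ennreal_mult) auto
  ultimately show ?thesis unfolding I_def[abs_def] by simp
qed

end
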